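(* Let $R$ be a commutative Noetherian ring, $\mathfrak{a}$ a proper ideal of $R$, and let $C$ be a $\Gamma_{\mathfrak{a}}$-acyclic $R$-complex in $\mathrm{C}_\sqsubset(R)$. Then $\mathbf{R}\Gamma_{\mathfrak{a}}(C)\simeq \Gamma_{\mathfrak{a}}(C)$ in $\mathrm{D}(R)$.
   Context: Complexes are graded homologically (differentials lower degree by $1$). $\mathrm{D}(R)$ is the derived category of $R$-modules; $\simeq$ denotes isomorphism in $\mathrm{D}(R)$. $\mathrm{C}_\sqsubset(R)$ is the category of $R$-complexes $X$ with $X_v=0$ for $v\gg 0$. $\Gamma_{\mathfrak{a}}(N)=\{x\in N: \mathfrak{a}^n x=0 \text{ for some } n\}$ for a module $N$, applied degreewise to complexes. A module $N$ is $\Gamma_{\mathfrak{a}}$-acyclic if the local cohomology modules $\mathbf{H}^j_{\mathfrak{a}}(N)$ vanish for all $j>0$; a complex $C$ is $\Gamma_{\mathfrak{a}}$-acyclic if every module $C_i$ is $\Gamma_{\mathfrak{a}}$-acyclic. An $R$-complex $I$ is semiinjective if $\mathrm{Hom}_R(-,I)$ converts injective quasiisomorphisms into surjective quasiisomorphisms; a semiinjective resolution of $M$ is a quasiisomorphism $M\to I$ with $I$ semiinjective. $\mathbf{R}\Gamma_{\mathfrak{a}}(M)=\Gamma_{\mathfrak{a}}(E)$, where $E$ is a semiinjective resolution of $M$. *)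

theory Defs
  imports "HOL-Algebra.Module" "HOL-Algebra.Ideal_Product" "HOL-Algebra.Ring_Divisibility" "HOL-Library.Equipollence"
begin

text \<open>
  All modules have their carriers inside one type \<open>'m\<close>, which plays the role of the universe over
  which the notions below quantify (test complexes for semiinjectivity, resolutions, objects of
  the derived category). The theorem requires \<open>'m\<close> to be infinite and at least as large as the
  ring. For a Noetherian ring this makes every such notion the absolute one:
  injectivity of modules is tested on ideals (Baer), semiinjectivity on complexes of cardinality at
  most \<open>max(|R|, \<aleph>\<^sub>0)\<close> (these detect the fibrations of the injective model structure), injective
  hulls of modules of cardinality at most \<open>\<kappa> \<ge> max(|R|, \<aleph>\<^sub>0)\<close> again have cardinality at most
  \<open>\<kappa>\<close>, and zigzags of quasiisomorphisms can be chosen within the same bound.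
\<close>

section \<open>Complexes of modules\<close>

definition mod_hom ::
  "('r, 'x) ring_scheme \<Rightarrow> ('r, 'm) module \<Rightarrow> ('r, 'n) module \<Rightarrow> ('m \<Rightarrow> 'n) set"
  where "mod_hom R M N =
    {f. f \<in> carrier M \<rightarrow> carrier N
      \<and> (\<forall>x\<in>carrier M. \<forall>y\<in>carrier M. f (x \<oplus>\<^bsub>M\<^esub> y) = f x \<oplus>\<^bsub>N\<^esub> f y)
      \<and> (\<forall>r\<in>carrier R. \<forall>x\<in>carrier M. f (r \<odot>\<^bsub>M\<^esub> x) = r \<odot>\<^bsub>N\<^esub> f x)}"

text \<open>Homological grading: \<open>bd X i\<close> maps \<open>obj X i\<close> to \<open>obj X (i - 1)\<close>.\<close>

record ('r, 'm) cpx =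
  obj :: "int \<Rightarrow> ('r, 'm) module"
  bd :: "int \<Rightarrow> 'm \<Rightarrow> 'm"

definition chain_complex :: "('r, 'x) ring_scheme \<Rightarrow> ('r, 'm) cpx \<Rightarrow> bool"
  where "chain_complex R X \<longleftrightarrow>
    (\<forall>i. module R (obj X i))
    \<and> (\<forall>i. bd X i \<in> mod_hom R (obj X i) (obj X (i - 1)))
    \<and> (\<forall>i. \<forall>x\<in>carrier (obj X i). bd X (i - 1) (bd X i x) = \<zero>\<^bsub>obj X (i - 2)\<^esub>)"

text \<open>Maps are relevant on the carriers only; their values elsewhere are arbitrary.\<close>

definition chain_map ::
  "('r, 'x) ring_scheme \<Rightarrow> ('r, 'm) cpx \<Rightarrow> ('r, 'n) cpx \<Rightarrow> (int \<Rightarrow> 'm \<Rightarrow> 'n) \<Rightarrow> bool"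
  where "chain_map R X Y f \<longleftrightarrow>
    chain_complex R X \<and> chain_complex R Y
    \<and> (\<forall>i. f i \<in> mod_hom R (obj X i) (obj Y i))
    \<and> (\<forall>i. \<forall>x\<in>carrier (obj X i). f (i - 1) (bd X i x) = bd Y i (f i x))"

definition trivial_module :: "('r, 'm) module \<Rightarrow> bool"
  where "trivial_module M \<longleftrightarrow> carrier M = {\<zero>\<^bsub>M\<^esub>}"

text \<open>The subcategory of complexes \<open>X\<close> with \<open>X\<^sub>v = 0\<close> for \<open>v \<ggreater> 0\<close>.\<close>

definition bounded_left :: "('r, 'm) cpx \<Rightarrow> bool"
  where "bounded_left X \<longleftrightarrow> (\<exists>s. \<forall>v>s. trivial_module (obj X v))"

definition stalk_complex :: "('r, 'm) module \<Rightarrow> ('r, 'm) cpx"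
  where "stalk_complex N =
    \<lparr> obj = (\<lambda>i. if i = 0 then N else N\<lparr>carrier := {\<zero>\<^bsub>N\<^esub>}\<rparr>),
      bd = (\<lambda>i x. \<zero>\<^bsub>N\<^esub>) \<rparr>"

section \<open>Homology and quasiisomorphisms\<close>

definition cycles :: "('r, 'm) cpx \<Rightarrow> int \<Rightarrow> 'm set"
  where "cycles X i = {x \<in> carrier (obj X i). bd X i x = \<zero>\<^bsub>obj X (i - 1)\<^esub>}"

definition boundaries :: "('r, 'm) cpx \<Rightarrow> int \<Rightarrow> 'm set"
  where "boundaries X i = bd X (i + 1) ` carrier (obj X (i + 1))"

text \<open>
  The quotient module of cycles modulo boundaries, with cosets as elements. The ring
  multiplication and unit, which every module record carries, are irrelevant.
\<close>

definition homology :: "('r, 'm) cpx \<Rightarrow> int \<Rightarrow> ('r, 'm set) module"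
  where "homology X i =
    \<lparr> carrier = a_rcosets\<^bsub>(obj X i)\<lparr>carrier := cycles X i\<rparr>\<^esub> (boundaries X i),
      monoid.mult = undefined, one = undefined,
      zero = boundaries X i,
      add = (\<lambda>U V. U <+>\<^bsub>obj X i\<^esub> V),
      smult = (\<lambda>r U. boundaries X i <+>\<^bsub>obj X i\<^esub> ((\<lambda>x. r \<odot>\<^bsub>obj X i\<^esub> x) ` U)) \<rparr>"

definition homology_map :: "('r, 'n) cpx \<Rightarrow> (int \<Rightarrow> 'm \<Rightarrow> 'n) \<Rightarrow> int \<Rightarrow> 'm set \<Rightarrow> 'n set"
  where "homology_map Y f i U = boundaries Y i <+>\<^bsub>obj Y i\<^esub> (f i ` U)"

definition quasi_iso ::
  "('r, 'x) ring_scheme \<Rightarrow> ('r, 'm) cpx \<Rightarrow> ('r, 'n) cpx \<Rightarrow> (int \<Rightarrow> 'm \<Rightarrow> 'n) \<Rightarrow> bool"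
  where "quasi_iso R X Y f \<longleftrightarrow> chain_map R X Y f
    \<and> (\<forall>i. bij_betw (homology_map Y f i) (carrier (homology X i)) (carrier (homology Y i)))"

definition injective_map :: "('r, 'm) cpx \<Rightarrow> (int \<Rightarrow> 'm \<Rightarrow> 'n) \<Rightarrow> bool"
  where "injective_map X f \<longleftrightarrow> (\<forall>i. inj_on (f i) (carrier (obj X i)))"

definition surjective_map ::
  "('r, 'm) cpx \<Rightarrow> ('r, 'n) cpx \<Rightarrow> (int \<Rightarrow> 'm \<Rightarrow> 'n) \<Rightarrow> bool"
  where "surjective_map X Y f \<longleftrightarrow> (\<forall>i. f i ` carrier (obj X i) = carrier (obj Y i))"

section \<open>The Hom complex and semiinjective complexes\<close>

text \<open>
  \<open>Hom(X, Y)\<^sub>n = \<Prod>\<^sub>i Hom(X\<^sub>i, Y\<^sub>i\<^sub>+\<^sub>n)\<close>, a homomorphism being represented by its extension with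
  value \<open>undefined\<close> off the carrier, so that equality in the complex is equality of functions.
  The differential is \<open>\<alpha> \<mapsto> d\<^sup>Y \<circ> \<alpha> - (-1)\<^sup>n \<alpha> \<circ> d\<^sup>X\<close>.
\<close>

definition hom_component ::
  "('r, 'x) ring_scheme \<Rightarrow> ('r, 'm) cpx \<Rightarrow> ('r, 'n) cpx \<Rightarrow> int \<Rightarrow> ('r, int \<Rightarrow> 'm \<Rightarrow> 'n) module"
  where "hom_component R X Y n =
    \<lparr> carrier = {\<alpha>. \<forall>i. \<alpha> i \<in> mod_hom R (obj X i) (obj Y (i + n))
                          \<inter> extensional (carrier (obj X i))},
      monoid.mult = undefined, one = undefined,
      zero = (\<lambda>i. \<lambda>x\<in>carrier (obj X i). \<zero>\<^bsub>obj Y (i + n)\<^esub>),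
      add = (\<lambda>\<alpha> \<beta> i. \<lambda>x\<in>carrier (obj X i). \<alpha> i x \<oplus>\<^bsub>obj Y (i + n)\<^esub> \<beta> i x),
      smult = (\<lambda>r \<alpha> i. \<lambda>x\<in>carrier (obj X i). r \<odot>\<^bsub>obj Y (i + n)\<^esub> \<alpha> i x) \<rparr>"

definition hom_complex ::
  "('r, 'x) ring_scheme \<Rightarrow> ('r, 'm) cpx \<Rightarrow> ('r, 'n) cpx \<Rightarrow> ('r, int \<Rightarrow> 'm \<Rightarrow> 'n) cpx"
  where "hom_complex R X Y =
    \<lparr> obj = hom_component R X Y,
      bd = (\<lambda>n \<alpha> i. \<lambda>x\<in>carrier (obj X i).
        if even n
        then bd Y (i + n) (\<alpha> i x) \<ominus>\<^bsub>obj Y (i + n - 1)\<^esub> \<alpha> (i - 1) (bd X i x)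
        else bd Y (i + n) (\<alpha> i x) \<oplus>\<^bsub>obj Y (i + n - 1)\<^esub> \<alpha> (i - 1) (bd X i x)) \<rparr>"

text \<open>For \<open>f : X \<rightarrow> X'\<close>, the induced map \<open>Hom(X', Y) \<rightarrow> Hom(X, Y)\<close>.\<close>

definition hom_pullback ::
  "('r, 'm) cpx \<Rightarrow> (int \<Rightarrow> 'm \<Rightarrow> 'k) \<Rightarrow> int \<Rightarrow> (int \<Rightarrow> 'k \<Rightarrow> 'n) \<Rightarrow> (int \<Rightarrow> 'm \<Rightarrow> 'n)"
  where "hom_pullback X f n \<alpha> = (\<lambda>i. \<lambda>x\<in>carrier (obj X i). \<alpha> i (f i x))"

definition semiinjective :: "('r, 'x) ring_scheme \<Rightarrow> ('r, 'm) cpx \<Rightarrow> bool"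
  where "semiinjective R I \<longleftrightarrow> chain_complex R I
    \<and> (\<forall>(X :: ('r, 'm) cpx) (Y :: ('r, 'm) cpx) f.
          quasi_iso R X Y f \<and> injective_map X f \<longrightarrow>
          quasi_iso R (hom_complex R Y I) (hom_complex R X I) (hom_pullback X f)
          \<and> surjective_map (hom_complex R Y I) (hom_complex R X I) (hom_pullback X f))"

definition semiinjective_resolution ::
  "('r, 'x) ring_scheme \<Rightarrow> ('r, 'm) cpx \<Rightarrow> ('r, 'm) cpx \<Rightarrow> (int \<Rightarrow> 'm \<Rightarrow> 'm) \<Rightarrow> bool"
  where "semiinjective_resolution R M I \<iota> \<longleftrightarrow> semiinjective R I \<and> quasi_iso R M I \<iota>"

section \<open>Torsion functor and local cohomology\<close>

definition torsion_module ::
  "('r, 'x) ring_scheme \<Rightarrow> 'r set \<Rightarrow> ('r, 'm) module \<Rightarrow> ('r, 'm) module"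
  where "torsion_module R \<aa> N =
    N\<lparr>carrier := {x \<in> carrier N.
        \<exists>n::nat. \<forall>r \<in> \<aa> [^]\<^bsub>ideals_set R\<^esub> n. r \<odot>\<^bsub>N\<^esub> x = \<zero>\<^bsub>N\<^esub>}\<rparr>"

definition torsion_complex ::
  "('r, 'x) ring_scheme \<Rightarrow> 'r set \<Rightarrow> ('r, 'm) cpx \<Rightarrow> ('r, 'm) cpx"
  where "torsion_complex R \<aa> X = X\<lparr>obj := (\<lambda>i. torsion_module R \<aa> (obj X i))\<rparr>"

text \<open>
  The right derived torsion functor is determined only up to isomorphism in the derived category,
  by the choice of a resolution; the predicate says that \<open>X\<close> is one of its values at \<open>M\<close>.
\<close>

definition is_RGamma ::
  "('r, 'x) ring_scheme \<Rightarrow> 'r set \<Rightarrow> ('r, 'm) cpx \<Rightarrow> ('r, 'm) cpx \<Rightarrow> bool"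
  where "is_RGamma R \<aa> M X \<longleftrightarrow>
    (\<exists>E \<iota>. semiinjective_resolution R M E \<iota> \<and> X = torsion_complex R \<aa> E)"

text \<open>
  The \<open>j\<close>-th local cohomology of \<open>N\<close> is the homology in degree \<open>-j\<close> of the right derived torsion
  functor at \<open>N\<close>. It does not depend on the resolution, so the existential quantifier only fixes
  the choice by which the local cohomology modules are computed.
\<close>

definition torsion_acyclic_module ::
  "('r, 'x) ring_scheme \<Rightarrow> 'r set \<Rightarrow> ('r, 'm) module \<Rightarrow> bool"
  where "torsion_acyclic_module R \<aa> N \<longleftrightarrow>
    (\<exists>X. is_RGamma R \<aa> (stalk_complex N) X \<and> (\<forall>j>0. trivial_module (homology X (- j))))"

definition torsion_acyclic_complex ::
  "('r, 'x) ring_scheme \<Rightarrow> 'r set \<Rightarrow> ('r, 'm) cpx \<Rightarrow> bool"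
  where "torsion_acyclic_complex R \<aa> C \<longleftrightarrow> (\<forall>i. torsion_acyclic_module R \<aa> (obj C i))"

section \<open>The derived category\<close>

text \<open>
  The derived category is the localization of the category of complexes at the quasiisomorphisms:
  its morphisms are composable words in chain maps and formal inverses of quasiisomorphisms,
  modulo the congruence generated by the relations below. Words are read from left to right.
\<close>

datatype ('r, 'm) dstep =
  Fwd "('r, 'm) cpx" "int \<Rightarrow> 'm \<Rightarrow> 'm" "('r, 'm) cpx"
| Inv "('r, 'm) cpx" "int \<Rightarrow> 'm \<Rightarrow> 'm" "('r, 'm) cpx"
    \<comment> \<open>\<open>Inv X s Y\<close> is the formal inverse of \<open>s : X \<rightarrow> Y\<close>, hence a step from \<open>Y\<close> to \<open>X\<close>\<close>

inductive dpath ::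
  "('r, 'x) ring_scheme \<Rightarrow> ('r, 'm) cpx \<Rightarrow> ('r, 'm) dstep list \<Rightarrow> ('r, 'm) cpx \<Rightarrow> bool"
  for R :: "('r, 'x) ring_scheme"
  where
    dpath_Nil: "chain_complex R X \<Longrightarrow> dpath R X [] X"
  | dpath_Fwd: "\<lbrakk>chain_map R X Y f; dpath R Y p Z\<rbrakk> \<Longrightarrow> dpath R X (Fwd X f Y # p) Z"
  | dpath_Inv: "\<lbrakk>quasi_iso R Y X s; dpath R Y p Z\<rbrakk> \<Longrightarrow> dpath R X (Inv Y s X # p) Z"

inductive deq ::
  "('r, 'x) ring_scheme \<Rightarrow> ('r, 'm) cpx \<Rightarrow> ('r, 'm) cpx \<Rightarrow>
    ('r, 'm) dstep list \<Rightarrow> ('r, 'm) dstep list \<Rightarrow> bool"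
  for R :: "('r, 'x) ring_scheme"
  where
    deq_refl: "dpath R X p Y \<Longrightarrow> deq R X Y p p"
  | deq_sym: "deq R X Y p q \<Longrightarrow> deq R X Y q p"
  | deq_trans: "\<lbrakk>deq R X Y p q; deq R X Y q r\<rbrakk> \<Longrightarrow> deq R X Y p r"
  | deq_cong: "\<lbrakk>dpath R W u X; deq R X Y p q; dpath R Y v Z\<rbrakk> \<Longrightarrow>
      deq R W Z (u @ p @ v) (u @ q @ v)"
  | deq_id: "chain_complex R X \<Longrightarrow> deq R X X [Fwd X (\<lambda>i x. x) X] []"
  | deq_comp: "\<lbrakk>chain_map R X Y f; chain_map R Y Z g; chain_map R X Z h;
      \<forall>i. \<forall>x\<in>carrier (obj X i). h i x = g i (f i x)\<rbrakk> \<Longrightarrow>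
      deq R X Z [Fwd X f Y, Fwd Y g Z] [Fwd X h Z]"
  | deq_inv_right: "quasi_iso R X Y s \<Longrightarrow> deq R X X [Fwd X s Y, Inv X s Y] []"
  | deq_inv_left: "quasi_iso R X Y s \<Longrightarrow> deq R Y Y [Inv X s Y, Fwd X s Y] []"

definition derived_iso ::
  "('r, 'x) ring_scheme \<Rightarrow> ('r, 'm) cpx \<Rightarrow> ('r, 'm) cpx \<Rightarrow> bool"
  where "derived_iso R X Y \<longleftrightarrow>
    (\<exists>p q. dpath R X p Y \<and> dpath R Y q X \<and> deq R X X (p @ q) [] \<and> deq R Y Y (q @ p) [])"

end

theory Submission
  imports Defs
begin

text \<open>
  Let \<open>\<iota> : C \<rightarrow> E\<close> be the semiinjective resolution. It suffices that \<open>\<Gamma>(\<iota>)\<close> is a quasiisomorphism, that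
  is, that \<open>\<Gamma>\<close> keeps the mapping cone \<open>K\<close> of \<open>\<iota>\<close> exact. The modules of \<open>K\<close> are \<open>\<Gamma>\<close>-acyclic, so by
  descending induction along \<open>0 \<rightarrow> Z\<^sub>v \<rightarrow> K\<^sub>v \<rightarrow> Z\<^sub>v\<^sub>-\<^sub>1 \<rightarrow> 0\<close> all its cycle modules are, provided that they
  are in high degrees. There \<open>K\<close> agrees with \<open>E\<close>, which is exact and hence, being semiinjective, split.

  The cycle modules come without a resolution in the given universe. Acyclicity is therefore
  expressed without injectives, as vanishing of \<open>colim Ext\<^sup>j(R/\<aa>\<^sup>n, -)\<close> for \<open>j > 0\<close>, where \<open>Ext\<close> is
  computed by a free resolution of \<open>R/\<aa>\<^sup>n\<close> that is strictly functorial in \<open>n\<close>.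
\<close>

section \<open>Homomorphisms and complexes\<close>

text \<open>The descending induction loses a cohomological degree at every step:
  \<open>H^(j+1)\<close> of one cycle module vanishes because \<open>H^(j+2)\<close> of the cycle
  module one degree higher does. Hence it must carry all \<open>j\<close> at once and start where
  all of them vanish together; the bound on \<open>C\<close> provides such a start. Exactness of
  \<Gamma> at one spot then uses \<open>H^1\<close> only.

  Strict functoriality means that the generators for a smaller ideal are among those for a larger
  one. Passing to a higher power of the ideal is then plain restriction of a function, and vanishing
  in the colimit says that a cocycle becomes a coboundary after restriction. No comparison maps or
  homotopies between resolutions occur.

  Two bridges lead to this notion. Modules of a semiinjective complex satisfy Baer's criterion, by
  testing against complexes built from ideals, and Baer's criterion kills Ext. The hypothesis on a
  module \<open>N\<close> of \<open>C\<close> is stated through a semiinjective resolution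
  \<open>F\<close>; dimension shifting along \<open>F\<close> reaches its cycle module in degree 0,
  and \<open>N\<close> is a retract of that.\<close>

lemma (in abelian_group) neg_zero: "\<ominus> \<zero> = \<zero>"
  using minus_equality[of \<zero> \<zero>] by simp

lemma (in abelian_group) diff_zero: "x \<in> carrier G \<Longrightarrow> x \<ominus> \<zero> = x"
  by (simp add: minus_eq neg_zero)

lemma (in abelian_group) diff_eq_zeroD:
  "x \<ominus> y = \<zero> \<Longrightarrow> x \<in> carrier G \<Longrightarrow> y \<in> carrier G \<Longrightarrow> x = y"
  by (metis minus_eq minus_equality minus_minus a_inv_closed)

lemma mod_homI:
  assumes "\<And>x. x \<in> carrier M \<Longrightarrow> f x \<in> carrier N"
    and "\<And>x y. x \<in> carrier M \<Longrightarrow> y \<in> carrier M \<Longrightarrow> f (x \<oplus>\<^bsub>M\<^esub> y) = f x \<oplus>\<^bsub>N\<^esub> f y"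
    and "\<And>r x. r \<in> carrier R \<Longrightarrow> x \<in> carrier M \<Longrightarrow> f (r \<odot>\<^bsub>M\<^esub> x) = r \<odot>\<^bsub>N\<^esub> f x"
  shows "f \<in> mod_hom R M N"
  using assms by (auto simp: mod_hom_def)

lemma mod_hom_closed: "f \<in> mod_hom R M N \<Longrightarrow> x \<in> carrier M \<Longrightarrow> f x \<in> carrier N"
  by (auto simp: mod_hom_def)

lemma mod_hom_add:
  "f \<in> mod_hom R M N \<Longrightarrow> x \<in> carrier M \<Longrightarrow> y \<in> carrier M \<Longrightarrow> f (x \<oplus>\<^bsub>M\<^esub> y) = f x \<oplus>\<^bsub>N\<^esub> f y"
  by (auto simp: mod_hom_def)

lemma mod_hom_smult:
  "f \<in> mod_hom R M N \<Longrightarrow> r \<in> carrier R \<Longrightarrow> x \<in> carrier M \<Longrightarrow> f (r \<odot>\<^bsub>M\<^esub> x) = r \<odot>\<^bsub>N\<^esub> f x"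
  by (auto simp: mod_hom_def)

lemma mod_hom_zero:
  assumes "f \<in> mod_hom R M N" "module R M" "module R N"
  shows "f \<zero>\<^bsub>M\<^esub> = \<zero>\<^bsub>N\<^esub>"
proof -
  interpret M: module R M by fact
  interpret N: module R N by fact
  have "f (\<zero>\<^bsub>R\<^esub> \<odot>\<^bsub>M\<^esub> \<zero>\<^bsub>M\<^esub>) = \<zero>\<^bsub>R\<^esub> \<odot>\<^bsub>N\<^esub> f \<zero>\<^bsub>M\<^esub>"
    by (rule mod_hom_smult[OF assms(1)]) auto
  then show ?thesis using mod_hom_closed[OF assms(1) M.M.zero_closed] by simp
qed

lemma mod_hom_neg:
  assumes "f \<in> mod_hom R M N" "module R M" "module R N" "x \<in> carrier M"
  shows "f (\<ominus>\<^bsub>M\<^esub> x) = \<ominus>\<^bsub>N\<^esub> f x"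
proof -
  interpret M: module R M by fact
  interpret N: module R N by fact
  have "f x \<oplus>\<^bsub>N\<^esub> f (\<ominus>\<^bsub>M\<^esub> x) = \<zero>\<^bsub>N\<^esub>"
    using mod_hom_add[OF assms(1), of x "\<ominus>\<^bsub>M\<^esub> x"] assms mod_hom_zero[OF assms(1-3)]
    by (simp add: M.M.r_neg)
  then show ?thesis using mod_hom_closed[OF assms(1)] assms(4)
    by (metis M.M.a_inv_closed N.M.minus_equality N.M.a_comm)
qed

lemma mod_hom_diff:
  assumes "f \<in> mod_hom R M N" "module R M" "module R N" "x \<in> carrier M" "y \<in> carrier M"
  shows "f (x \<ominus>\<^bsub>M\<^esub> y) = f x \<ominus>\<^bsub>N\<^esub> f y"
proof -
  interpret M: module R M by fact
  show ?thesis using mod_hom_add[OF assms(1), of x "\<ominus>\<^bsub>M\<^esub> y"] mod_hom_neg[OF assms(1-3,5)] assms(4,5)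
    by (simp add: a_minus_def)
qed

lemma chain_complexD:
  assumes "chain_complex R X"
  shows "module R (obj X i)" "bd X i \<in> mod_hom R (obj X i) (obj X (i - 1))"
    "x \<in> carrier (obj X i) \<Longrightarrow> bd X (i - 1) (bd X i x) = \<zero>\<^bsub>obj X (i - 2)\<^esub>"
  using assms by (auto simp: chain_complex_def)

lemma chain_complex_bd_succ:
  assumes "chain_complex R X"
  shows "bd X (i + 1) \<in> mod_hom R (obj X (i + 1)) (obj X i)"
    "x \<in> carrier (obj X (i + 1)) \<Longrightarrow> bd X i (bd X (i + 1) x) = \<zero>\<^bsub>obj X (i - 1)\<^esub>"
  using chain_complexD(2)[OF assms, of "i + 1"] chain_complexD(3)[OF assms, where i = "i + 1"] by simp_all

lemma chain_mapD:
  assumes "chain_map R X Y f"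
  shows "chain_complex R X" "chain_complex R Y" "f i \<in> mod_hom R (obj X i) (obj Y i)"
    "x \<in> carrier (obj X i) \<Longrightarrow> f (i - 1) (bd X i x) = bd Y i (f i x)"
  using assms by (auto simp: chain_map_def)

lemma chain_map_bd_succ:
  assumes "chain_map R X Y f" "x \<in> carrier (obj X (i + 1))"
  shows "f i (bd X (i + 1) x) = bd Y (i + 1) (f (i + 1) x)"
  using chain_mapD(4)[OF assms] by simp

lemma cyclesD:
  "x \<in> cycles X i \<Longrightarrow> x \<in> carrier (obj X i)" "x \<in> cycles X i \<Longrightarrow> bd X i x = \<zero>\<^bsub>obj X (i - 1)\<^esub>"
  by (auto simp: cycles_def)

lemma boundaries_subset_cycles:
  assumes "chain_complex R X"
  shows "boundaries X i \<subseteq> cycles X i"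
  using chain_complex_bd_succ[OF assms, where i = i]
  by (auto simp: boundaries_def cycles_def intro: mod_hom_closed)

lemma submodule_kernel:
  assumes "f \<in> mod_hom R M N" "module R M" "module R N"
  shows "submodule {x \<in> carrier M. f x = \<zero>\<^bsub>N\<^esub>} R M"
proof -
  interpret M: module R M by fact
  interpret N: module R N by fact
  show ?thesis
    by (rule M.submoduleI)
      (auto simp: mod_hom_zero[OF assms] mod_hom_neg[OF assms] mod_hom_add[OF assms(1)]
        mod_hom_smult[OF assms(1)])
qed

lemma submodule_image:
  assumes "f \<in> mod_hom R M N" "module R M" "module R N"
  shows "submodule (f ` carrier M) R N"
proof -
  interpret M: module R M by fact
  interpret N: module R N by fact
  show ?thesis
  proof (rule N.submoduleI)
    show "f ` carrier M \<subseteq> carrier N" using mod_hom_closed[OF assms(1)] by auto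
    show "\<zero>\<^bsub>N\<^esub> \<in> f ` carrier M" using mod_hom_zero[OF assms] by (metis M.M.zero_closed imageI)
    show "\<ominus>\<^bsub>N\<^esub> a \<in> f ` carrier M" if "a \<in> f ` carrier M" for a
      using that mod_hom_neg[OF assms] by (metis (no_types, opaque_lifting) M.M.a_inv_closed imageE imageI)
    show "a \<oplus>\<^bsub>N\<^esub> b \<in> f ` carrier M" if "a \<in> f ` carrier M" "b \<in> f ` carrier M" for a b
      using that mod_hom_add[OF assms(1)] by (metis (no_types, opaque_lifting) M.M.a_closed imageE imageI)
    show "r \<odot>\<^bsub>N\<^esub> b \<in> f ` carrier M" if "r \<in> carrier R" "b \<in> f ` carrier M" for r b
      using that mod_hom_smult[OF assms(1)] by (metis (no_types, opaque_lifting) M.smult_closed imageE imageI)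
  qed
qed

lemma submodule_cycles:
  assumes "chain_complex R X"
  shows "submodule (cycles X i) R (obj X i)"
  unfolding cycles_def by (intro submodule_kernel chain_complexD assms)

lemma submodule_boundaries:
  assumes "chain_complex R X"
  shows "submodule (boundaries X i) R (obj X i)"
  unfolding boundaries_def by (intro submodule_image chain_complexD chain_complex_bd_succ assms)

lemma module_restrict:
  assumes "submodule H R M" "module R M"
  shows "module R (M\<lparr>carrier := H\<rparr>)"
  using submodule.submodule_is_module[OF assms] .

section \<open>Quasiisomorphisms\<close>

text \<open>The addition is that of the ambient module, so classes of cycles and classes of
  arbitrary elements have the same form.\<close>

definition coset where "coset M B x = (\<lambda>b. b \<oplus>\<^bsub>M\<^esub> x) ` B"

lemma coset_eq_iff:
  assumes "module R M" "submodule B R M" "x \<in> carrier M" "y \<in> carrier M"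
  shows "coset M B x = coset M B y \<longleftrightarrow> x \<ominus>\<^bsub>M\<^esub> y \<in> B"
proof -
  interpret M: module R M by fact
  note B = M.submoduleE[OF assms(2)] 
  have sub: "coset M B x \<subseteq> coset M B y" if "x \<ominus>\<^bsub>M\<^esub> y \<in> B" "x \<in> carrier M" "y \<in> carrier M" for x y
  proof
    fix z assume "z \<in> coset M B x"
    then obtain b where b: "b \<in> B" "z = b \<oplus>\<^bsub>M\<^esub> x" by (auto simp: coset_def)
    have "z = (b \<oplus>\<^bsub>M\<^esub> (x \<ominus>\<^bsub>M\<^esub> y)) \<oplus>\<^bsub>M\<^esub> y" using b B that
      by (simp add: a_minus_def M.M.a_assoc M.M.l_neg subset_iff)
    then show "z \<in> coset M B y" using B(5)[OF b(1) that(1)] by (auto simp: coset_def)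
  qed
  have sym: "y \<ominus>\<^bsub>M\<^esub> x \<in> B" if "x \<ominus>\<^bsub>M\<^esub> y \<in> B"
  proof -
    have "\<ominus>\<^bsub>M\<^esub> (x \<ominus>\<^bsub>M\<^esub> y) = y \<ominus>\<^bsub>M\<^esub> x" using assms(3,4)
      by (simp add: a_minus_def M.M.minus_add M.M.a_comm)
    then show ?thesis using B(3)[OF that] by simp
  qed
  have "x \<ominus>\<^bsub>M\<^esub> y \<in> B" if "coset M B x = coset M B y"
  proof -
    have "\<zero>\<^bsub>M\<^esub> \<in> B" using B(1-3,5) by (metis M.M.r_neg ex_in_conv subsetD)
    then have "x \<in> coset M B x" using assms(3) by (auto simp: coset_def image_iff intro!: bexI[of _ "\<zero>\<^bsub>M\<^esub>"])
    then have "x \<in> coset M B y" using that by simp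
    then obtain b where "b \<in> B" "x = b \<oplus>\<^bsub>M\<^esub> y" by (auto simp: coset_def)
    moreover have "b \<in> carrier M" using B(1) calculation by auto
    ultimately show ?thesis using assms(4) by (simp add: a_minus_def M.M.a_assoc M.M.r_neg)
  qed
  then show ?thesis using sub assms(3,4) sym by blast
qed

lemma carrier_homology: "carrier (homology X i) = coset (obj X i) (boundaries X i) ` cycles X i"
  by (auto simp: homology_def A_RCOSETS_def' a_r_coset_def' coset_def)

text \<open>The image of a coset under \<open>f\<close> is only part of a coset. Adding
  \<open>boundaries Y i\<close> completes it, and the images of the boundaries of \<open>X\<close>
  are absorbed because \<open>f\<close> sends boundaries to boundaries.\<close>

lemma homology_map_coset:
  assumes "chain_map R X Y f" "x \<in> cycles X i"
  shows "homology_map Y f i (coset (obj X i) (boundaries X i) x)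
    = coset (obj Y i) (boundaries Y i) (f i x)"
proof -
  note f = chain_mapD[OF assms(1)]
  interpret X: module R "obj X i" by (rule chain_complexD f)+
  interpret Y: module R "obj Y i" by (rule chain_complexD f)+
  note BX = X.submoduleE[OF submodule_boundaries[OF f(1)]]
  note BY = Y.submoduleE[OF submodule_boundaries[OF f(2)]]
  have x: "x \<in> carrier (obj X i)" using assms(2) by (rule cyclesD)
  have fx: "f i x \<in> carrier (obj Y i)" using mod_hom_closed[OF f(3) x] .
  have fB: "f i b \<in> boundaries Y i" if "b \<in> boundaries X i" for b
  proof -
    obtain c where c: "c \<in> carrier (obj X (i + 1))" "b = bd X (i + 1) c"
      using \<open>b \<in> boundaries X i\<close> by (auto simp: boundaries_def)
    then show ?thesis using chain_map_bd_succ[OF assms(1), of c i] mod_hom_closed[OF f(3) c(1)]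
      by (auto simp: boundaries_def)
  qed
  have z: "\<zero>\<^bsub>obj X i\<^esub> \<in> boundaries X i" using BX(1-3,5) by (metis X.M.r_neg ex_in_conv subsetD)
  have "homology_map Y f i (coset (obj X i) (boundaries X i) x) =
    {c \<oplus>\<^bsub>obj Y i\<^esub> f i (b \<oplus>\<^bsub>obj X i\<^esub> x) | c b. c \<in> boundaries Y i \<and> b \<in> boundaries X i}"
    by (auto simp: homology_map_def coset_def set_add_def') 
  also have "\<dots> = {(c \<oplus>\<^bsub>obj Y i\<^esub> f i b) \<oplus>\<^bsub>obj Y i\<^esub> f i x | c b. c \<in> boundaries Y i \<and> b \<in> boundaries X i}"
  proof -
    have "c \<oplus>\<^bsub>obj Y i\<^esub> f i (b \<oplus>\<^bsub>obj X i\<^esub> x) = (c \<oplus>\<^bsub>obj Y i\<^esub> f i b) \<oplus>\<^bsub>obj Y i\<^esub> f i x"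
      if "c \<in> boundaries Y i" "b \<in> boundaries X i" for b c
      using that BX(1) BY(1) x fx mod_hom_closed[OF f(3), of b i] mod_hom_add[OF f(3), of b i x]
      by (simp add: subset_iff Y.M.a_assoc)
    then show ?thesis by (metis (no_types, lifting))
  qed
  also have "\<dots> = coset (obj Y i) (boundaries Y i) (f i x)"
  proof -
    have "c \<in> boundaries Y i \<Longrightarrow> c = c \<oplus>\<^bsub>obj Y i\<^esub> f i \<zero>\<^bsub>obj X i\<^esub>" for c
      using BY(1) mod_hom_zero[OF f(3), of i] X.module_axioms Y.module_axioms by (auto simp: subset_iff)
    then show ?thesis using BY(5) fB z unfolding coset_def image_def by (smt (verit) Collect_cong)
  qed
  finally show ?thesis .
qed

text \<open>Removes cosets from the later arguments. By additivity, injectivity on homology reduces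
  to a trivial kernel; surjectivity is hitting every cycle up to a boundary.\<close>

lemma quasi_iso_iff:
  assumes "chain_map R X Y f"
  shows "quasi_iso R X Y f \<longleftrightarrow> (\<forall>i.
    (\<forall>x\<in>cycles X i. f i x \<in> boundaries Y i \<longrightarrow> x \<in> boundaries X i) \<and>
    (\<forall>y\<in>cycles Y i. \<exists>x\<in>cycles X i. y \<ominus>\<^bsub>obj Y i\<^esub> f i x \<in> boundaries Y i))"
proof -
  note f = chain_mapD[OF assms(1)]
  have fcyc: "f i x \<in> cycles Y i" if "x \<in> cycles X i" for i x
    using that f(3)[of i] f(4)[of x i] mod_hom_zero[OF f(3), of "i - 1"] chain_complexD(1)[OF f(1)] chain_complexD(1)[OF f(2)]
    by (auto simp: cycles_def intro: mod_hom_closed)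
  have "bij_betw (homology_map Y f i) (carrier (homology X i)) (carrier (homology Y i)) \<longleftrightarrow>
    (\<forall>x\<in>cycles X i. f i x \<in> boundaries Y i \<longrightarrow> x \<in> boundaries X i) \<and>
    (\<forall>y\<in>cycles Y i. \<exists>x\<in>cycles X i. y \<ominus>\<^bsub>obj Y i\<^esub> f i x \<in> boundaries Y i)" (is "?bij \<longleftrightarrow> ?inj \<and> ?sur") for i
  proof -
    interpret X: module R "obj X i" by (rule chain_complexD f)+
    interpret Y: module R "obj Y i" by (rule chain_complexD f)+
    note BX = submodule_boundaries[OF f(1), of i]
    note BY = submodule_boundaries[OF f(2), of i]
    note ZX = X.submoduleE[OF submodule_cycles[OF f(1)]]
    let ?X = "coset (obj X i) (boundaries X i)"
    let ?Y = "coset (obj Y i) (boundaries Y i)"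
    have eqX: "?X x = ?X y \<longleftrightarrow> x \<ominus>\<^bsub>obj X i\<^esub> y \<in> boundaries X i" if "x \<in> cycles X i" "y \<in> cycles X i" for x y
      using coset_eq_iff[OF X.module_axioms BX] that by (auto dest: cyclesD)
    have eqY: "?Y x = ?Y y \<longleftrightarrow> x \<ominus>\<^bsub>obj Y i\<^esub> y \<in> boundaries Y i" if "x \<in> cycles Y i" "y \<in> cycles Y i" for x y
      using coset_eq_iff[OF Y.module_axioms BY] that by (auto dest: cyclesD)
    have d: "f i (x \<ominus>\<^bsub>obj X i\<^esub> y) = f i x \<ominus>\<^bsub>obj Y i\<^esub> f i y" if "x \<in> cycles X i" "y \<in> cycles X i" for x y
      using mod_hom_diff[OF f(3) X.module_axioms Y.module_axioms] that by (auto dest: cyclesD)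
    have "inj_on (homology_map Y f i) (carrier (homology X i)) \<longleftrightarrow>
      (\<forall>x\<in>cycles X i. \<forall>y\<in>cycles X i. f i x \<ominus>\<^bsub>obj Y i\<^esub> f i y \<in> boundaries Y i \<longrightarrow> x \<ominus>\<^bsub>obj X i\<^esub> y \<in> boundaries X i)"
      by (simp add: inj_on_def carrier_homology homology_map_coset[OF assms] eqX eqY fcyc)
    also have "\<dots> \<longleftrightarrow> ?inj"
    proof
      assume L: "\<forall>x\<in>cycles X i. \<forall>y\<in>cycles X i. f i x \<ominus>\<^bsub>obj Y i\<^esub> f i y \<in> boundaries Y i \<longrightarrow> x \<ominus>\<^bsub>obj X i\<^esub> y \<in> boundaries X i"
      have z: "\<zero>\<^bsub>obj X i\<^esub> \<in> cycles X i" using ZX(1-3,5) by (metis X.M.r_neg ex_in_conv subsetD)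
      have "x \<ominus>\<^bsub>obj X i\<^esub> \<zero>\<^bsub>obj X i\<^esub> = x" if "x \<in> cycles X i" for x
        using that by (auto dest: cyclesD simp: a_minus_def)
      then show ?inj using L z d by metis
    next
      assume ?inj
      moreover have "x \<ominus>\<^bsub>obj X i\<^esub> y \<in> cycles X i" if "x \<in> cycles X i" "y \<in> cycles X i" for x y
        using that ZX by (simp add: a_minus_def)
      ultimately show "\<forall>x\<in>cycles X i. \<forall>y\<in>cycles X i. f i x \<ominus>\<^bsub>obj Y i\<^esub> f i y \<in> boundaries Y i \<longrightarrow> x \<ominus>\<^bsub>obj X i\<^esub> y \<in> boundaries X i"
        using d by metis
    qed
    finally have 1: "inj_on (homology_map Y f i) (carrier (homology X i)) \<longleftrightarrow> ?inj" .
    have "homology_map Y f i ` carrier (homology X i) = (\<lambda>x. ?Y (f i x)) ` cycles X i"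
      by (auto simp: carrier_homology homology_map_coset[OF assms] image_iff)
    moreover have surj_iff: "(\<lambda>x. ?Y (f i x)) ` cycles X i = ?Y ` cycles Y i \<longleftrightarrow>
      (\<forall>y\<in>cycles Y i. \<exists>x\<in>cycles X i. ?Y y = ?Y (f i x))"
    proof -
      have "(\<lambda>x. ?Y (f i x)) ` cycles X i \<subseteq> ?Y ` cycles Y i" using fcyc by blast
      moreover have "?Y ` cycles Y i \<subseteq> (\<lambda>x. ?Y (f i x)) ` cycles X i \<longleftrightarrow>
        (\<forall>y\<in>cycles Y i. \<exists>x\<in>cycles X i. ?Y y = ?Y (f i x))" 
        by (simp only: image_subset_iff image_iff)
      ultimately show ?thesis by (simp only: set_eq_subset simp_thms)
    qed
    ultimately have "homology_map Y f i ` carrier (homology X i) = carrier (homology Y i) \<longleftrightarrow>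
      (\<forall>y\<in>cycles Y i. \<exists>x\<in>cycles X i. ?Y y = ?Y (f i x))"
      using surj_iff unfolding carrier_homology by metis
    also have "\<dots> \<longleftrightarrow> ?sur" using eqY fcyc by (metis (lifting))
    finally show ?thesis using 1 by (simp add: bij_betw_def)
  qed
  then show ?thesis using assms by (simp add: quasi_iso_def)
qed

lemma quasi_isoD:
  assumes "quasi_iso R X Y f"
  shows "chain_map R X Y f"
    "x \<in> cycles X i \<Longrightarrow> f i x \<in> boundaries Y i \<Longrightarrow> x \<in> boundaries X i"
    "y \<in> cycles Y i \<Longrightarrow> \<exists>x\<in>cycles X i. y \<ominus>\<^bsub>obj Y i\<^esub> f i x \<in> boundaries Y i"
  using assms quasi_iso_iff[of R X Y f] by (auto simp: quasi_iso_def)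

text \<open>Source of the test maps for semiinjectivity: between exact complexes nothing but the
  chain map property has to be checked.\<close>

lemma quasi_iso_exact:
  assumes "chain_map R X Y f"
    and "\<And>i. cycles X i \<subseteq> boundaries X i" "\<And>i. cycles Y i \<subseteq> boundaries Y i"
  shows "quasi_iso R X Y f"
proof -
  note f = chain_mapD[OF assms(1)]
  have "\<exists>x\<in>cycles X i. y \<ominus>\<^bsub>obj Y i\<^esub> f i x \<in> boundaries Y i" if "y \<in> cycles Y i" for y i
  proof 
    interpret X: module R "obj X i" by (rule chain_complexD f)+
    interpret Y: module R "obj Y i" by (rule chain_complexD f)+
    show "\<zero>\<^bsub>obj X i\<^esub> \<in> cycles X i"
      using mod_hom_zero[OF chain_complexD(2,1,1)[OF f(1)]] by (auto simp: cycles_def)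
    show "y \<ominus>\<^bsub>obj Y i\<^esub> f i \<zero>\<^bsub>obj X i\<^esub> \<in> boundaries Y i"
      using assms(3) that mod_hom_zero[OF f(3) X.module_axioms Y.module_axioms] cyclesD(1)[OF that]
      by (auto simp: Y.M.diff_zero)
  qed
  then show ?thesis using assms(2) by (subst quasi_iso_iff[OF assms(1)]) blast
qed

section \<open>Formal linear combinations\<close>

text \<open>A list of pairs stands for an element of a free module, and two lists stand for the same
  element when all their \<open>coef\<close> agree. Lists are chosen because a datatype can recurse
  through them, but not through the domain of a coefficient function; the generators in
  \<open>tree\<close> rely on this.\<close>

primrec lin_comb :: "('r, 'm, 'y) module_scheme \<Rightarrow> ('t \<Rightarrow> 'm) \<Rightarrow> ('r \<times> 't) list \<Rightarrow> 'm" where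
  "lin_comb M \<phi> [] = \<zero>\<^bsub>M\<^esub>"
| "lin_comb M \<phi> (p # l) = fst p \<odot>\<^bsub>M\<^esub> \<phi> (snd p) \<oplus>\<^bsub>M\<^esub> lin_comb M \<phi> l"

primrec coef :: "('r, 'x) ring_scheme \<Rightarrow> 't \<Rightarrow> ('r \<times> 't) list \<Rightarrow> 'r" where
  "coef R t [] = \<zero>\<^bsub>R\<^esub>"
| "coef R t (p # l) = (if snd p = t then fst p \<oplus>\<^bsub>R\<^esub> coef R t l else coef R t l)"

definition scale :: "('r, 'x) ring_scheme \<Rightarrow> 'r \<Rightarrow> ('r \<times> 't) list \<Rightarrow> ('r \<times> 't) list" where
  "scale R r = map (\<lambda>(s, t). (r \<otimes>\<^bsub>R\<^esub> s, t))"

lemma scale_simps [simp]: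
  "scale R r [] = []" "scale R r (p # l) = (r \<otimes>\<^bsub>R\<^esub> fst p, snd p) # scale R r l"
  by (auto simp: scale_def split: prod.splits)

lemma lin_comb_cong:
  "(\<And>t. t \<in> snd ` set l \<Longrightarrow> \<phi> t = \<psi> t) \<Longrightarrow> lin_comb M \<phi> l = lin_comb M \<psi> l"
  by (induction l) auto

lemma lin_comb_restrict [simp]: "lin_comb (M\<lparr>carrier := H\<rparr>) \<phi> l = lin_comb M \<phi> l"
  by (induction l) auto

lemma (in cring) coef_closed: "set l \<subseteq> carrier R \<times> S \<Longrightarrow> coef R t l \<in> carrier R"
  by (induction l) auto

lemma (in cring) scale_closed:
  "set l \<subseteq> carrier R \<times> S \<Longrightarrow> r \<in> carrier R \<Longrightarrow> set (scale R r l) \<subseteq> carrier R \<times> S"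
  by (induction l) auto

lemma (in cring) coef_append:
  "set l \<subseteq> carrier R \<times> S \<Longrightarrow> set l' \<subseteq> carrier R \<times> S' \<Longrightarrow>
    coef R t (l @ l') = coef R t l \<oplus> coef R t l'"
  by (induction l) (auto simp: coef_closed a_assoc)

lemma (in cring) coef_scale:
  "set l \<subseteq> carrier R \<times> S \<Longrightarrow> r \<in> carrier R \<Longrightarrow> coef R t (scale R r l) = r \<otimes> coef R t l"
  by (induction l) (auto simp: coef_closed r_distr)

lemma (in cring) coef_filter:
  "coef R s (filter (\<lambda>p. snd p \<noteq> t) l) = (if s = t then \<zero> else coef R s l)"
  by (induction l) auto

context module
begin

lemma lin_comb_closed:
  "set l \<subseteq> carrier R \<times> S \<Longrightarrow> \<phi> \<in> S \<rightarrow> carrier M \<Longrightarrow> lin_comb M \<phi> l \<in> carrier M"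
  by (induction l) (auto simp: Pi_iff)

lemma lin_comb_append:
  "set l \<subseteq> carrier R \<times> S \<Longrightarrow> set l' \<subseteq> carrier R \<times> S \<Longrightarrow> \<phi> \<in> S \<rightarrow> carrier M \<Longrightarrow>
    lin_comb M \<phi> (l @ l') = lin_comb M \<phi> l \<oplus>\<^bsub>M\<^esub> lin_comb M \<phi> l'"
  by (induction l) (auto simp: Pi_iff lin_comb_closed[of _ S] M.a_assoc)

lemma lin_comb_scale:
  "set l \<subseteq> carrier R \<times> S \<Longrightarrow> r \<in> carrier R \<Longrightarrow> \<phi> \<in> S \<rightarrow> carrier M \<Longrightarrow>
    lin_comb M \<phi> (scale R r l) = r \<odot>\<^bsub>M\<^esub> lin_comb M \<phi> l"
  by (induction l) (auto simp: Pi_iff lin_comb_closed[of _ S] smult_r_distr smult_assoc1)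

lemma lin_comb_remove:
  "set l \<subseteq> carrier R \<times> S \<Longrightarrow> \<phi> \<in> S \<rightarrow> carrier M \<Longrightarrow> \<phi> t \<in> carrier M \<Longrightarrow>
    lin_comb M \<phi> l = coef R t l \<odot>\<^bsub>M\<^esub> \<phi> t \<oplus>\<^bsub>M\<^esub> lin_comb M \<phi> (filter (\<lambda>p. snd p \<noteq> t) l)"
proof (induction l)
  case (Cons p l)
  obtain r s where p: "p = (r, s)" by force
  have l: "set l \<subseteq> carrier R \<times> S" "r \<in> carrier R" "s \<in> S" using Cons.prems p by auto
  have fl: "set (filter (\<lambda>p. snd p \<noteq> t) l) \<subseteq> carrier R \<times> S" using l by auto
  have \<phi>: "\<phi> s \<in> carrier M" using Cons.prems l by auto
  note c = lin_comb_closed[OF fl Cons.prems(2)] coef_closed[OF l(1), of t] l(2) \<phi> Cons.prems(3)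
  show ?case using Cons.IH[OF l(1) Cons.prems(2,3)] c
    by (simp add: p smult_l_distr M.a_ac)
qed simp

text \<open>Evaluation is well defined on the free module. Dropping only the head of the list would
  destroy the hypothesis on the coefficients, so all occurrences of its generator are removed
  together and the induction is on the length.\<close>

lemma lin_comb_null:
  assumes "set l \<subseteq> carrier R \<times> S" "\<phi> \<in> S \<rightarrow> carrier M" "\<And>t. coef R t l = \<zero>"
  shows "lin_comb M \<phi> l = \<zero>\<^bsub>M\<^esub>"
  using assms
proof (induction "length l" arbitrary: l rule: less_induct)
  case less
  show ?case
  proof (cases l)
    case (Cons p k)
    let ?k = "filter (\<lambda>q. snd q \<noteq> snd p) l"
    have p: "\<phi> (snd p) \<in> carrier M" using less.prems Cons by auto
    have k: "set ?k \<subseteq> carrier R \<times> S" using less.prems by auto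
    have len: "length ?k < length l" using Cons by (simp add: le_imp_less_Suc)
    have "lin_comb M \<phi> ?k = \<zero>\<^bsub>M\<^esub>"
      using less.hyps[OF len k less.prems(2)] less.prems(3) by (simp add: coef_filter)
    then show ?thesis using lin_comb_remove[OF less.prems(1,2) p] less.prems(3) p by simp
  qed simp
qed

lemma lin_comb_eq:
  assumes "set l \<subseteq> carrier R \<times> S" "set l' \<subseteq> carrier R \<times> S" "\<phi> \<in> S \<rightarrow> carrier M"
    "\<And>t. coef R t l = coef R t l'"
  shows "lin_comb M \<phi> l = lin_comb M \<phi> l'"
proof -
  note s = scale_closed[OF assms(2), of "\<ominus> \<one>"]
  have a: "set (l @ scale R (\<ominus> \<one>) l') \<subseteq> carrier R \<times> S" using s assms by simp
  have "coef R t (l @ scale R (\<ominus> \<one>) l') = \<zero>" for t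
    using s coef_closed[OF assms(2), of t]
    by (simp add: coef_append[OF assms(1)] coef_scale[OF assms(2)] assms(4) l_minus R.r_neg)
  from lin_comb_null[OF a assms(3) this]
  have "lin_comb M \<phi> l \<oplus>\<^bsub>M\<^esub> \<ominus>\<^bsub>M\<^esub> lin_comb M \<phi> l' = \<zero>\<^bsub>M\<^esub>"
    using s lin_comb_closed[OF assms(2,3)]
    by (simp add: lin_comb_append[OF assms(1) _ assms(3)] lin_comb_scale[OF assms(2) _ assms(3)]
        smult_l_minus)
  then show ?thesis using lin_comb_closed[OF assms(1,3)] lin_comb_closed[OF assms(2,3)]
    by (metis M.minus_equality M.minus_minus M.a_inv_closed)
qed

lemma lin_comb_linear:
  assumes "set l \<subseteq> carrier R \<times> S" "set l' \<subseteq> carrier R \<times> S" "set l'' \<subseteq> carrier R \<times> S"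
    "\<phi> \<in> S \<rightarrow> carrier M" "r \<in> carrier R" "s \<in> carrier R"
    "\<And>t. coef R t l'' = r \<otimes> coef R t l \<oplus> s \<otimes> coef R t l'"
  shows "lin_comb M \<phi> l'' = r \<odot>\<^bsub>M\<^esub> lin_comb M \<phi> l \<oplus>\<^bsub>M\<^esub> s \<odot>\<^bsub>M\<^esub> lin_comb M \<phi> l'"
proof -
  note c = scale_closed[OF assms(1,5)] scale_closed[OF assms(2,6)]
  have "lin_comb M \<phi> l'' = lin_comb M \<phi> (scale R r l @ scale R s l')"
    using c by (intro lin_comb_eq[OF assms(3) _ assms(4)])
      (auto simp: coef_append[OF c] coef_scale[OF assms(1,5)] coef_scale[OF assms(2,6)] assms(7))
  then show ?thesis
    by (simp add: lin_comb_append[OF c assms(4)] lin_comb_scale[OF assms(1,5,4)] lin_comb_scale[OF assms(2,6,4)])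
qed

lemma lin_comb_add:
  assumes "set l \<subseteq> carrier R \<times> S" "\<phi> \<in> S \<rightarrow> carrier M" "\<psi> \<in> S \<rightarrow> carrier M"
  shows "lin_comb M (\<lambda>t. \<phi> t \<oplus>\<^bsub>M\<^esub> \<psi> t) l = lin_comb M \<phi> l \<oplus>\<^bsub>M\<^esub> lin_comb M \<psi> l"
  using assms
proof (induction l)
  case (Cons p l)
  have l: "set l \<subseteq> carrier R \<times> S" "fst p \<in> carrier R" "\<phi> (snd p) \<in> carrier M" "\<psi> (snd p) \<in> carrier M"
    using Cons.prems by auto
  show ?case using Cons.IH[OF l(1) Cons.prems(2,3)] l lin_comb_closed[OF l(1) Cons.prems(2)]
      lin_comb_closed[OF l(1) Cons.prems(3)]
    by (simp add: smult_r_distr M.a_ac)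
qed simp

lemma lin_comb_neg:
  assumes "set l \<subseteq> carrier R \<times> S" "\<phi> \<in> S \<rightarrow> carrier M"
  shows "lin_comb M (\<lambda>t. \<ominus>\<^bsub>M\<^esub> \<phi> t) l = \<ominus>\<^bsub>M\<^esub> lin_comb M \<phi> l"
  using assms
proof (induction l)
  case (Cons p l)
  have l: "set l \<subseteq> carrier R \<times> S" "fst p \<in> carrier R" "\<phi> (snd p) \<in> carrier M"
    using Cons.prems by auto
  show ?case using Cons.IH[OF l(1) Cons.prems(2)] l lin_comb_closed[OF l(1) Cons.prems(2)]
    by (simp add: smult_r_minus M.minus_add)
qed (simp add: M.neg_zero)

lemma lin_comb_diff:
  assumes "set l \<subseteq> carrier R \<times> S" "\<phi> \<in> S \<rightarrow> carrier M" "\<psi> \<in> S \<rightarrow> carrier M"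
  shows "lin_comb M (\<lambda>t. \<phi> t \<ominus>\<^bsub>M\<^esub> \<psi> t) l = lin_comb M \<phi> l \<ominus>\<^bsub>M\<^esub> lin_comb M \<psi> l"
  using lin_comb_add[OF assms(1,2), of "\<lambda>t. \<ominus>\<^bsub>M\<^esub> \<psi> t"] lin_comb_neg[OF assms(1,3)] assms(3)
  by (simp add: M.minus_eq Pi_iff)

end

lemma lin_comb_hom:
  assumes "g \<in> mod_hom R M N" "module R M" "module R N"
    "set l \<subseteq> carrier R \<times> S" "\<phi> \<in> S \<rightarrow> carrier M"
  shows "lin_comb N (\<lambda>t. g (\<phi> t)) l = g (lin_comb M \<phi> l)"
  using assms(4)
proof (induction l)
  case Nil
  show ?case using mod_hom_zero[OF assms(1-3)] by simp
next
  case (Cons p l)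
  interpret M: module R M by fact
  have l: "set l \<subseteq> carrier R \<times> S" "fst p \<in> carrier R" "\<phi> (snd p) \<in> carrier M"
    using Cons.prems assms(5) by auto
  show ?case using Cons.IH[OF l(1)] l M.lin_comb_closed[OF l(1) assms(5)]
    by (simp add: mod_hom_add[OF assms(1)] mod_hom_smult[OF assms(1)])
qed

section \<open>Baer's criterion\<close>

text \<open>Injectivity in the form of Baer's test. It speaks of ideals only and therefore involves
  no further universe of modules.\<close>

definition baer :: "('r, 'x) ring_scheme \<Rightarrow> ('r, 'm) module \<Rightarrow> bool" where
  "baer R M \<longleftrightarrow> (\<forall>J f. ideal J R \<and> f \<in> J \<rightarrow> carrier M
      \<and> (\<forall>a\<in>J. \<forall>b\<in>J. f (a \<oplus>\<^bsub>R\<^esub> b) = f a \<oplus>\<^bsub>M\<^esub> f b)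
      \<and> (\<forall>r\<in>carrier R. \<forall>a\<in>J. f (r \<otimes>\<^bsub>R\<^esub> a) = r \<odot>\<^bsub>M\<^esub> f a)
    \<longrightarrow> (\<exists>z\<in>carrier M. \<forall>a\<in>J. f a = a \<odot>\<^bsub>M\<^esub> z))"

text \<open>\<open>L\<close> plays the role of a submodule of the free module on \<open>S\<close>,
  and \<open>\<Phi>\<close> of a linear map on it; \<open>lin\<close> expresses linearity
  independently of the representing lists. The coefficients at \<open>t\<close> of the members of
  \<open>L\<close> supported in \<open>insert t U\<close> form an ideal, and Baer's test on it
  yields the value \<open>z\<close> at the new generator.\<close>

lemma baer_extend_step:
  fixes R :: "('r, 'x) ring_scheme" (structure) and \<Phi> :: "('r \<times> 't) list \<Rightarrow> 'm"
  assumes "module R M" "baer R M"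
    and L: "\<And>l. L l \<Longrightarrow> set l \<subseteq> carrier R \<times> S" "L []" "\<And>l. L l \<Longrightarrow> \<Phi> l \<in> carrier M"
    and lin: "\<And>l l' l'' r s. L l \<Longrightarrow> L l' \<Longrightarrow> set l'' \<subseteq> carrier R \<times> S \<Longrightarrow> r \<in> carrier R \<Longrightarrow> s \<in> carrier R \<Longrightarrow>
      (\<And>t. coef R t l'' = r \<otimes>\<^bsub>R\<^esub> coef R t l \<oplus>\<^bsub>R\<^esub> s \<otimes>\<^bsub>R\<^esub> coef R t l') \<Longrightarrow>
      L l'' \<and> \<Phi> l'' = r \<odot>\<^bsub>M\<^esub> \<Phi> l \<oplus>\<^bsub>M\<^esub> s \<odot>\<^bsub>M\<^esub> \<Phi> l'"
    and U: "U \<subseteq> S" "t \<in> S" "t \<notin> U" "\<psi> \<in> S \<rightarrow> carrier M"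
      "\<And>l. L l \<Longrightarrow> snd ` set l \<subseteq> U \<Longrightarrow> lin_comb M \<psi> l = \<Phi> l"
  shows "\<exists>z\<in>carrier M. \<forall>l. L l \<longrightarrow> snd ` set l \<subseteq> insert t U \<longrightarrow> lin_comb M (\<psi>(t := z)) l = \<Phi> l"
proof -
  interpret module R M by fact
  let ?LU = "\<lambda>l. L l \<and> snd ` set l \<subseteq> insert t U"
  define \<psi>0 where "\<psi>0 = \<psi>(t := \<zero>\<^bsub>M\<^esub>)"
  have \<psi>0: "\<psi>0 \<in> S \<rightarrow> carrier M" "\<psi>0 t = \<zero>\<^bsub>M\<^esub>" using U by (auto simp: \<psi>0_def)
  \<comment> \<open>The defect that the value at \<open>t\<close> has to supply: \<open>z\<close>
    must satisfy \<open>coef R t l \<odot> z = d l\<close>.\<close>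
  define d where "d l = \<Phi> l \<ominus>\<^bsub>M\<^esub> lin_comb M \<psi>0 l" for l
  have d_closed: "d l \<in> carrier M" if "L l" for l
    using L(3)[OF that] lin_comb_closed[OF L(1)[OF that] \<psi>0(1)] by (simp add: d_def)
  \<comment> \<open>A zero coefficient at \<open>t\<close> does not mean that \<open>t\<close> is
    absent from the list. Deleting its entries leaves all coefficients unchanged, so by
    \<open>lin\<close> with scalars 1 and 0 the shorter list is still in \<open>L\<close> and has
    the same value.\<close>
  have lc0: "lin_comb M \<psi>0 l = \<Phi> l" if "?LU l" "coef R t l = \<zero>" for l
  proof -
    let ?k = "filter (\<lambda>p. snd p \<noteq> t) l"
    have l: "set l \<subseteq> carrier R \<times> S" using L(1) that by blast
    have k: "set ?k \<subseteq> carrier R \<times> S" using l by auto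
    have kL: "L ?k \<and> \<Phi> ?k = \<one> \<odot>\<^bsub>M\<^esub> \<Phi> l \<oplus>\<^bsub>M\<^esub> \<zero> \<odot>\<^bsub>M\<^esub> \<Phi> l"
      using that(2) by (intro lin k) (auto simp: that coef_filter coef_closed[OF l])
    then have "\<Phi> ?k = \<Phi> l" using L(3) that by simp
    moreover have "lin_comb M \<psi> ?k = \<Phi> ?k" using kL U(5)[of ?k] that(1) by auto
    moreover have "lin_comb M \<psi>0 ?k = lin_comb M \<psi> ?k"
      by (rule lin_comb_cong) (auto simp: \<psi>0_def)
    moreover have "lin_comb M \<psi>0 l = lin_comb M \<psi>0 ?k"
      using lin_comb_remove[OF l \<psi>0(1), of t] \<psi>0 lin_comb_closed[OF k \<psi>0(1)] coef_closed[OF l] by simp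
    ultimately show ?thesis by simp
  qed
  have d_lin: "?LU l'' \<and> d l'' = r \<odot>\<^bsub>M\<^esub> d l \<oplus>\<^bsub>M\<^esub> s \<odot>\<^bsub>M\<^esub> d l'"
    if "?LU l" "?LU l'" "r \<in> carrier R" "s \<in> carrier R" "l'' = scale R r l @ scale R s l'" for l l' l'' r s
  proof -
    have l: "set l \<subseteq> carrier R \<times> S" "set l' \<subseteq> carrier R \<times> S" using L(1) that by blast+
    note sc = scale_closed[OF l(1) that(3)] scale_closed[OF l(2) that(4)]
    have l'': "set l'' \<subseteq> carrier R \<times> S" using sc that(5) by simp
    have co: "coef R t l'' = r \<otimes> coef R t l \<oplus> s \<otimes> coef R t l'" for t
      using coef_append[OF sc] coef_scale[OF l(1) that(3)] coef_scale[OF l(2) that(4)] that(5) by simp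
    have sn: "snd ` set l'' \<subseteq> insert t U" using that by (auto simp: scale_def)
    have 1: "L l'' \<and> \<Phi> l'' = r \<odot>\<^bsub>M\<^esub> \<Phi> l \<oplus>\<^bsub>M\<^esub> s \<odot>\<^bsub>M\<^esub> \<Phi> l'"
      using that by (intro lin l'' co) auto
    have 2: "lin_comb M \<psi>0 l'' = r \<odot>\<^bsub>M\<^esub> lin_comb M \<psi>0 l \<oplus>\<^bsub>M\<^esub> s \<odot>\<^bsub>M\<^esub> lin_comb M \<psi>0 l'"
      by (rule lin_comb_linear[OF l l'' \<psi>0(1) that(3,4) co])
    have c: "\<Phi> l \<in> carrier M" "\<Phi> l' \<in> carrier M" "lin_comb M \<psi>0 l \<in> carrier M" "lin_comb M \<psi>0 l' \<in> carrier M"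
      using L(3) that lin_comb_closed[OF l(1) \<psi>0(1)] lin_comb_closed[OF l(2) \<psi>0(1)] by auto
    have "d l'' = r \<odot>\<^bsub>M\<^esub> d l \<oplus>\<^bsub>M\<^esub> s \<odot>\<^bsub>M\<^esub> d l'"
      using 1 2 c that(3,4)
      by (simp add: d_def M.minus_eq smult_r_distr smult_r_minus M.minus_add M.a_ac)
    then show ?thesis using 1 sn by auto
  qed
  \<comment> \<open>The defect depends on the coefficient at \<open>t\<close> alone:
    \<open>lc0\<close> applies to the difference of the two lists. This makes the choice in
    \<open>f\<close> below harmless.\<close>
  have d_eq: "d l = d l'" if "?LU l" "?LU l'" "coef R t l = coef R t l'" for l l'
  proof -
    let ?l = "scale R \<one> l @ scale R (\<ominus> \<one>) l'"
    have l: "set l \<subseteq> carrier R \<times> S" "set l' \<subseteq> carrier R \<times> S" using L(1) that by blast+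
    have one: "\<one> \<in> carrier R" "\<ominus> \<one> \<in> carrier R" by auto
    note D = d_lin[OF that(1,2) one refl]
    have dc: "d l \<in> carrier M" "d l' \<in> carrier M" using d_closed that by auto
    have co: "coef R t ?l = \<zero>"
      using coef_append[OF scale_closed[OF l(1)] scale_closed[OF l(2)], of \<one> "\<ominus> \<one>" t]
        coef_scale[OF l(1), of \<one>] coef_scale[OF l(2), of "\<ominus> \<one>"] coef_closed[OF l(1), of t] coef_closed[OF l(2), of t]
      by (simp add: that(3) l_minus R.r_neg)
    have "d ?l = \<zero>\<^bsub>M\<^esub>" using lc0[OF _ co] D L(3) unfolding d_def
      by (metis M.minus_eq M.r_neg)
    then have "d l \<oplus>\<^bsub>M\<^esub> \<ominus>\<^bsub>M\<^esub> d l' = \<zero>\<^bsub>M\<^esub>" using D dc by (simp add: smult_l_minus)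
    then show ?thesis using dc by (metis M.minus_equality M.minus_minus M.a_inv_closed)
  qed
  define J where "J = {coef R t l | l. ?LU l}"
  define f where "f a = d (SOME l. ?LU l \<and> coef R t l = a)" for a
  have f: "f (coef R t l) = d l" if "?LU l" for l
  proof -
    have "?LU (SOME l'. ?LU l' \<and> coef R t l' = coef R t l) \<and> coef R t (SOME l'. ?LU l' \<and> coef R t l' = coef R t l) = coef R t l"
      by (rule someI[of "\<lambda>l'. ?LU l' \<and> coef R t l' = coef R t l" l]) (use that in auto)
    then show ?thesis unfolding f_def using that by (intro d_eq) auto
  qed
  have J_lin: "r \<otimes> a \<oplus> s \<otimes> b \<in> J \<and> f (r \<otimes> a \<oplus> s \<otimes> b) = r \<odot>\<^bsub>M\<^esub> f a \<oplus>\<^bsub>M\<^esub> s \<odot>\<^bsub>M\<^esub> f b"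
    if ab: "a \<in> J" "b \<in> J" and that: "r \<in> carrier R" "s \<in> carrier R" for a b r s
  proof -
    obtain l l' where l: "?LU l" "a = coef R t l" "?LU l'" "b = coef R t l'"
      using ab unfolding J_def by blast
    have ls: "set l \<subseteq> carrier R \<times> S" "set l' \<subseteq> carrier R \<times> S" using L(1) l by blast+
    note D = d_lin[OF l(1,3) that refl]
    have "coef R t (scale R r l @ scale R s l') = r \<otimes> a \<oplus> s \<otimes> b"
      using coef_append[OF scale_closed[OF ls(1) that(1)] scale_closed[OF ls(2) that(2)], of t]
        coef_scale[OF ls(1) that(1)] coef_scale[OF ls(2) that(2)] l by simp
    then show ?thesis using D f[of "scale R r l @ scale R s l'"] f[OF l(1)] f[OF l(3)] l
      unfolding J_def by (metis (mono_tags, lifting) mem_Collect_eq)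
  qed
  have J_carr: "J \<subseteq> carrier R" using coef_closed[OF L(1)] unfolding J_def by auto
  have f_closed: "f a \<in> carrier M" if "a \<in> J" for a
    using that f d_closed by (auto simp: J_def)
  have zJ: "\<zero> \<in> J" using L(2) unfolding J_def by (auto intro!: exI[of _ "[]"])
  have addJ: "a \<oplus> b \<in> J \<and> f (a \<oplus> b) = f a \<oplus>\<^bsub>M\<^esub> f b" if "a \<in> J" "b \<in> J" for a b
    using J_lin[OF that, of \<one> \<one>] that J_carr f_closed by (auto simp: subset_iff)
  have mulJ: "r \<otimes> a \<in> J \<and> f (r \<otimes> a) = r \<odot>\<^bsub>M\<^esub> f a" if "a \<in> J" "r \<in> carrier R" for a r
    using J_lin[OF that(1) zJ that(2) R.zero_closed] that J_carr f_closed zJ by (auto simp: subset_iff)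
  have "ideal J R"
  proof (rule idealI)
    show "ring R" by unfold_locales
    show "subgroup J (add_monoid R)"
    proof (unfold_locales)
      show "inv\<^bsub>add_monoid R\<^esub> a \<in> J" if "a \<in> J" for a
        using mulJ[OF that, of "\<ominus> \<one>"] that J_carr by (auto simp: subset_iff l_minus a_inv_def[symmetric])
    qed (use J_carr zJ addJ in auto)
    show "x \<otimes> a \<in> J" "a \<otimes> x \<in> J" if "a \<in> J" "x \<in> carrier R" for a x
      using mulJ[OF that] that J_carr by (auto simp: m_comm subset_iff)
  qed
  then obtain z where z: "z \<in> carrier M" "\<And>a. a \<in> J \<Longrightarrow> f a = a \<odot>\<^bsub>M\<^esub> z"
    using assms(2) f_closed addJ mulJ unfolding baer_def by (metis Pi_I')
  have "lin_comb M (\<psi>(t := z)) l = \<Phi> l" if l: "L l" "snd ` set l \<subseteq> insert t U" for l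
  proof -
    let ?k = "filter (\<lambda>p. snd p \<noteq> t) l"
    note ls = L(1)[OF l(1)]
    have k: "set ?k \<subseteq> carrier R \<times> S" using ls by auto
    have \<psi>z: "\<psi>(t := z) \<in> S \<rightarrow> carrier M" using U z by auto
    have "lin_comb M (\<psi>(t := z)) ?k = lin_comb M \<psi>0 ?k"
      by (rule lin_comb_cong) (auto simp: \<psi>0_def)
    moreover have "lin_comb M \<psi>0 l = lin_comb M \<psi>0 ?k"
      using lin_comb_remove[OF ls \<psi>0(1), of t] \<psi>0 lin_comb_closed[OF k \<psi>0(1)] coef_closed[OF ls] by simp
    moreover have "lin_comb M (\<psi>(t := z)) l = coef R t l \<odot>\<^bsub>M\<^esub> z \<oplus>\<^bsub>M\<^esub> lin_comb M (\<psi>(t := z)) ?k"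
      using lin_comb_remove[OF ls \<psi>z, of t] z by simp
    moreover have "coef R t l \<in> J" using l unfolding J_def by blast
    then have "coef R t l \<odot>\<^bsub>M\<^esub> z = d l" using z(2) f[of l] l by simp
    moreover have "d l \<oplus>\<^bsub>M\<^esub> lin_comb M \<psi>0 l = \<Phi> l"
      using L(3)[OF l(1)] lin_comb_closed[OF ls \<psi>0(1)] by (simp add: d_def M.minus_eq M.a_assoc M.l_neg)
    ultimately show ?thesis by simp
  qed
  then show ?thesis using z by auto
qed

text \<open>Baer's theorem for a submodule of a free module: Zorn's lemma gives a maximal partial
  assignment of values to generators, and \<open>baer_extend_step\<close> shows that it is total on
  \<open>S\<close>.\<close>

lemma baer_extend:
  fixes R :: "('r, 'x) ring_scheme" (structure) and \<Phi> :: "('r \<times> 't) list \<Rightarrow> 'm"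
  assumes "module R M" "baer R M"
    and L: "\<And>l. L l \<Longrightarrow> set l \<subseteq> carrier R \<times> S" "L []" "\<And>l. L l \<Longrightarrow> \<Phi> l \<in> carrier M"
    and lin: "\<And>l l' l'' r s. L l \<Longrightarrow> L l' \<Longrightarrow> set l'' \<subseteq> carrier R \<times> S \<Longrightarrow> r \<in> carrier R \<Longrightarrow> s \<in> carrier R \<Longrightarrow>
      (\<And>t. coef R t l'' = r \<otimes>\<^bsub>R\<^esub> coef R t l \<oplus>\<^bsub>R\<^esub> s \<otimes>\<^bsub>R\<^esub> coef R t l') \<Longrightarrow>
      L l'' \<and> \<Phi> l'' = r \<odot>\<^bsub>M\<^esub> \<Phi> l \<oplus>\<^bsub>M\<^esub> s \<odot>\<^bsub>M\<^esub> \<Phi> l'"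
  shows "\<exists>\<psi> \<in> S \<rightarrow> carrier M. \<forall>l. L l \<longrightarrow> lin_comb M \<psi> l = \<Phi> l"
proof -
  interpret module R M by fact
  \<comment> \<open>Assignments are kept as graphs, so that chains have their union as upper bound.
    Quantifying over every function that agrees with \<open>G\<close> on the support avoids fixing
    values outside the domain.\<close>
  define \<A> where "\<A> = {G. G \<subseteq> S \<times> carrier M \<and> single_valued G \<and>
    (\<forall>\<psi> l. L l \<and> (\<forall>t\<in>snd ` set l. (t, \<psi> t) \<in> G) \<longrightarrow> lin_comb M \<psi> l = \<Phi> l)}"
  have \<Phi>Nil: "\<Phi> [] = \<zero>\<^bsub>M\<^esub>"
    using lin[OF L(2,2), of "[]" \<zero> \<zero>] L(2,3) by simp
  have "\<exists>G\<in>\<A>. \<forall>G'\<in>\<A>. G \<subseteq> G' \<longrightarrow> G' = G"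
  proof (rule subset_Zorn')
    fix \<C> assume ch: "subset.chain \<A> \<C>"
    then have C: "\<And>G. G \<in> \<C> \<Longrightarrow> G \<in> \<A>" "\<And>G H. G \<in> \<C> \<Longrightarrow> H \<in> \<C> \<Longrightarrow> G \<subseteq> H \<or> H \<subseteq> G"
      unfolding subset.chain_def by blast+
    \<comment> \<open>A list mentions finitely many generators, so one member of the chain covers
      it. The empty list is separate because the chain may be empty.\<close>
    have fin: "l = [] \<or> (\<exists>G\<in>\<C>. \<forall>t\<in>snd ` set l. (t, \<psi> t) \<in> G)" if "\<forall>t\<in>snd ` set l. (t, \<psi> t) \<in> \<Union>\<C>"
      for \<psi> and l :: "('r \<times> 't) list"
      using that
    proof (induction l)
      case (Cons p l)
      obtain G where G: "G \<in> \<C>" "(snd p, \<psi> (snd p)) \<in> G" using Cons.prems by auto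
      show ?case
      proof (cases "l = []")
        case False
        then obtain H where "H \<in> \<C>" "\<forall>t\<in>snd ` set l. (t, \<psi> t) \<in> H" using Cons by auto
        then show ?thesis using G C(2)[of G H] by auto
      qed (use G in auto)
    qed simp
    have "lin_comb M \<psi> l = \<Phi> l" if l: "L l" "\<forall>t\<in>snd ` set l. (t, \<psi> t) \<in> \<Union>\<C>" for \<psi> l
    proof (cases "l = []")
      case False
      then obtain G where "G \<in> \<C>" "\<forall>t\<in>snd ` set l. (t, \<psi> t) \<in> G" using fin[OF l(2)] by auto
      then show ?thesis using C(1) l(1) unfolding \<A>_def by blast
    qed (simp add: \<Phi>Nil)
    moreover have "\<Union>\<C> \<subseteq> S \<times> carrier M" using C(1) unfolding \<A>_def by blast
    moreover have "single_valued (\<Union>\<C>)"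
    proof (rule single_valuedI)
      fix a b c assume "(a, b) \<in> \<Union>\<C>" "(a, c) \<in> \<Union>\<C>"
      then obtain G where "G \<in> \<C>" "(a, b) \<in> G" "(a, c) \<in> G" using C(2) by blast
      then show "b = c" using C(1) unfolding \<A>_def single_valued_def by blast
    qed
    ultimately show "\<Union>\<C> \<in> \<A>" unfolding \<A>_def by blast
  qed
  then obtain G where G: "G \<in> \<A>" "\<And>G'. G' \<in> \<A> \<Longrightarrow> G \<subseteq> G' \<Longrightarrow> G' = G" by blast
  have GS: "G \<subseteq> S \<times> carrier M" "single_valued G"
    and Glc: "\<And>\<psi> l. L l \<Longrightarrow> (\<forall>t\<in>snd ` set l. (t, \<psi> t) \<in> G) \<Longrightarrow> lin_comb M \<psi> l = \<Phi> l"
    using G(1) unfolding \<A>_def by auto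
  define \<psi> where "\<psi> t = (if t \<in> Domain G then THE y. (t, y) \<in> G else \<zero>\<^bsub>M\<^esub>)" for t
  have \<psi>G: "(t, \<psi> t) \<in> G" if tD: "t \<in> Domain G" for t
  proof -
    obtain y where "(t, y) \<in> G" using tD by blast
    moreover from this have "(THE y. (t, y) \<in> G) = y" using GS(2) by (auto simp: single_valued_def)
    ultimately show ?thesis using tD by (simp add: \<psi>_def)
  qed
  have \<psi>S: "\<psi> \<in> S \<rightarrow> carrier M"
  proof
    fix t show "\<psi> t \<in> carrier M"
      using \<psi>G[of t] GS(1) by (cases "t \<in> Domain G") (auto simp: \<psi>_def)
  qed
  have \<psi>L: "lin_comb M \<psi> l = \<Phi> l" if "L l" "snd ` set l \<subseteq> Domain G" for l
    using that by (intro Glc) (auto intro!: \<psi>G)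
  have SD: "S \<subseteq> Domain G"
  proof
    fix t assume t: "t \<in> S"
    show "t \<in> Domain G"
    proof (rule ccontr)
      assume nt: "t \<notin> Domain G"
      have "\<exists>z\<in>carrier M. \<forall>l. L l \<longrightarrow> snd ` set l \<subseteq> insert t (Domain G) \<longrightarrow> lin_comb M (\<psi>(t := z)) l = \<Phi> l"
        by (rule baer_extend_step[where L = L and S = S and \<Phi> = \<Phi>, OF assms(1,2) L lin _ t nt \<psi>S \<psi>L])
          (use GS(1) in auto)
      then obtain z where z: "z \<in> carrier M"
        "\<And>l. L l \<Longrightarrow> snd ` set l \<subseteq> insert t (Domain G) \<Longrightarrow> lin_comb M (\<psi>(t := z)) l = \<Phi> l" by blast
      have "insert (t, z) G \<in> \<A>"
        unfolding \<A>_def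
      proof (intro CollectI conjI allI impI)
        show "insert (t, z) G \<subseteq> S \<times> carrier M" using GS t z by auto
        show "single_valued (insert (t, z) G)" using GS(2) nt by (auto simp: single_valued_def)
        fix \<chi> l assume l: "L l \<and> (\<forall>u\<in>snd ` set l. (u, \<chi> u) \<in> insert (t, z) G)"
        have "\<chi> u = (\<psi>(t := z)) u" if "u \<in> snd ` set l" for u
        proof (cases "u = t")
          case True then show ?thesis using l that nt by auto
        next
          case False
          then have "(u, \<chi> u) \<in> G" using l that by auto
          then have "\<psi> u = \<chi> u" using \<psi>G[of u] GS(2) by (auto simp: single_valued_def)
          then show ?thesis using False by simp
        qed
        then have "lin_comb M \<chi> l = lin_comb M (\<psi>(t := z)) l" by (rule lin_comb_cong)
        also have "\<dots> = \<Phi> l" using l by (intro z) auto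
        finally show "lin_comb M \<chi> l = \<Phi> l" .
      qed
      then have "insert (t, z) G = G" by (rule G(2)) auto
      then show False using nt by auto
    qed
  qed
  have "lin_comb M \<psi> l = \<Phi> l" if "L l" for l
  proof (rule \<psi>L[OF that])
    have "snd ` set l \<subseteq> S" using L(1)[OF that] by auto
    then show "snd ` set l \<subseteq> Domain G" using SD by (rule subset_trans)
  qed
  then show ?thesis using \<psi>S by blast
qed

section \<open>A functorial free resolution\<close>

text \<open>\<open>Star\<close> is the generator in degree 0, and \<open>Node l\<close> is the
  generator whose boundary is the combination \<open>l\<close>. One type thus holds the generators
  of all degrees.\<close>

datatype 'r tree = Star | Node (args: "('r \<times> 'r tree) list")
  where "args Star = []"

text \<open>The boundary map of the resolution, extended from generators to combinations.\<close>

definition flat :: "('r, 'x) ring_scheme \<Rightarrow> ('r \<times> 'r tree) list \<Rightarrow> ('r \<times> 'r tree) list" where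
  "flat R l = concat (map (\<lambda>(r, t). scale R r (args t)) l)"

text \<open>
  The set \<open>gens R I j\<close> generates the degree \<open>j\<close> part of a free resolution of \<open>R/I\<close>: in degree \<open>0\<close>
  one generator, in degree \<open>j + 1\<close> one generator for each formal combination of the generators of
  degree \<open>j\<close> that lies in \<open>I\<close> (for \<open>j = 0\<close>) or is a cycle. A smaller ideal has fewer generators,
  so the maps between the resolutions for decreasing ideals are inclusions.
\<close>

primrec gens :: "('r, 'x) ring_scheme \<Rightarrow> 'r set \<Rightarrow> nat \<Rightarrow> 'r tree set" where
  "gens R I 0 = {Star}"
| "gens R I (Suc j) = Node ` {l. set l \<subseteq> carrier R \<times> gens R I j \<and>
    (case j of 0 \<Rightarrow> coef R Star l \<in> I | Suc _ \<Rightarrow> (\<forall>t. coef R t (flat R l) = \<zero>\<^bsub>R\<^esub>))}"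

text \<open>A homomorphism from the free module on \<open>gens R I j\<close> is just a function on \<open>gens R I j\<close>.\<close>

definition cobd :: "('r, 'm, 'y) module_scheme \<Rightarrow> ('r tree \<Rightarrow> 'm) \<Rightarrow> 'r tree \<Rightarrow> 'm" where
  "cobd M \<phi> t = lin_comb M \<phi> (args t)"

definition cocycle ::
  "('r, 'x) ring_scheme \<Rightarrow> 'r set \<Rightarrow> ('r, 'm, 'y) module_scheme \<Rightarrow> nat \<Rightarrow> ('r tree \<Rightarrow> 'm) \<Rightarrow> bool" where
  "cocycle R I M j \<phi> \<longleftrightarrow> \<phi> \<in> gens R I j \<rightarrow> carrier M \<and> (\<forall>t\<in>gens R I (Suc j). cobd M \<phi> t = \<zero>\<^bsub>M\<^esub>)"

declare gens.simps(2) [simp del]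

lemma gens_SucD:
  "t \<in> gens R I (Suc j) \<Longrightarrow> set (args t) \<subseteq> carrier R \<times> gens R I j"
  by (auto simp: gens.simps(2))

lemma gens_1: "gens R I (Suc 0) = Node ` {l. set l \<subseteq> carrier R \<times> {Star} \<and> coef R Star l \<in> I}"
  by (simp add: gens.simps(2))

lemma gens_Suc_Suc: "gens R I (Suc (Suc j)) =
    Node ` {l. set l \<subseteq> carrier R \<times> gens R I (Suc j) \<and> (\<forall>t. coef R t (flat R l) = \<zero>\<^bsub>R\<^esub>)}"
  by (subst gens.simps(2)) simp

lemma gens_mono:
  assumes "I \<subseteq> J" shows "gens R I j \<subseteq> gens R J j"
proof (induction j)
  case (Suc j)
  show ?case
  proof (cases j)
    case 0
    then show ?thesis using assms by (auto simp: gens_1)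
  next
    case (Suc k)
    then show ?thesis using \<open>gens R I j \<subseteq> gens R J j\<close> unfolding Suc gens_Suc_Suc
      by (intro image_mono) (auto simp del: gens.simps)
  qed
qed simp

lemma flat_simps [simp]:
  "flat R [] = []" "flat R (p # l) = scale R (fst p) (args (snd p)) @ flat R l"
  by (auto simp: flat_def split: prod.splits)

lemma flat_closed:
  assumes "cring R" "set l \<subseteq> carrier R \<times> gens R I (Suc j)"
  shows "set (flat R l) \<subseteq> carrier R \<times> gens R I j"
  using assms(2)
proof (induction l)
  case (Cons p l)
  then have "snd p \<in> gens R I (Suc j)" "fst p \<in> carrier R" by auto
  then show ?case using Cons cring.scale_closed[OF assms(1) gens_SucD[of "snd p" R I j]] by auto
qed simp

text \<open>The coboundary is precomposition with the boundary \<open>flat\<close>.\<close>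

lemma (in module) lin_comb_cobd:
  assumes "set l \<subseteq> carrier R \<times> gens R I (Suc j)" "\<phi> \<in> gens R I j \<rightarrow> carrier M"
  shows "lin_comb M (cobd M \<phi>) l = lin_comb M \<phi> (flat R l)"
  using assms(1)
proof (induction l)
  case (Cons p l)
  then have p: "snd p \<in> gens R I (Suc j)" "fst p \<in> carrier R" and l: "set l \<subseteq> carrier R \<times> gens R I (Suc j)"
    by auto
  note a = gens_SucD[OF p(1)]
  show ?case using Cons.IH[OF l] p flat_closed[OF R.is_cring l] scale_closed[OF a p(2)]
    by (simp add: cobd_def lin_comb_append[of _ "gens R I j"] lin_comb_scale[OF a] assms(2))
qed simp

lemma (in module) cobd_closed:
  "\<phi> \<in> gens R I j \<rightarrow> carrier M \<Longrightarrow> t \<in> gens R I (Suc j) \<Longrightarrow> cobd M \<phi> t \<in> carrier M"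
  unfolding cobd_def by (rule lin_comb_closed[OF gens_SucD])

text \<open>A generator of degree \<open>j + 2\<close> is by construction a cycle, so all
  coefficients of its flattened boundary vanish and \<open>lin_comb_null\<close> applies.\<close>

lemma (in module) cobd_cobd:
  assumes "t \<in> gens R I (Suc (Suc j))" "\<phi> \<in> gens R I j \<rightarrow> carrier M"
  shows "cobd M (cobd M \<phi>) t = \<zero>\<^bsub>M\<^esub>"
proof -
  note a = gens_SucD[OF assms(1)]
  have "\<forall>s. coef R s (flat R (args t)) = \<zero>" using assms(1) by (auto simp: gens_Suc_Suc)
  then show ?thesis using lin_comb_null[OF flat_closed[OF R.is_cring a] assms(2)]
    by (simp add: cobd_def[of M "cobd M \<phi>"] lin_comb_cobd[OF a assms(2)])
qed

lemma (in module) cocycle_cobd: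
  "\<phi> \<in> gens R I j \<rightarrow> carrier M \<Longrightarrow> cocycle R I M (Suc j) (cobd M \<phi>)"
  unfolding cocycle_def using cobd_closed cobd_cobd by blast

lemma cocycle_mono:
  assumes "cocycle R J M j \<phi>" "I \<subseteq> J"
  shows "cocycle R I M j \<phi>"
  using assms(1) gens_mono[OF assms(2), of R j] gens_mono[OF assms(2), of R "Suc j"] unfolding cocycle_def by blast

lemma cobd_cong:
  assumes "t \<in> gens R I (Suc j)" "\<And>s. s \<in> gens R I j \<Longrightarrow> \<phi> s = \<psi> s"
  shows "cobd M \<phi> t = cobd M \<psi> t"
  unfolding cobd_def using gens_SucD[OF assms(1)] assms(2) by (intro lin_comb_cong) auto

lemma cobd_restrict [simp]: "cobd (M\<lparr>carrier := H\<rparr>) = cobd M"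
  by (intro ext) (simp add: cobd_def)

lemma (in module) cobd_diff:
  assumes "t \<in> gens R I (Suc j)" "\<phi> \<in> gens R I j \<rightarrow> carrier M" "\<psi> \<in> gens R I j \<rightarrow> carrier M"
  shows "cobd M (\<lambda>s. \<phi> s \<ominus>\<^bsub>M\<^esub> \<psi> s) t = cobd M \<phi> t \<ominus>\<^bsub>M\<^esub> cobd M \<psi> t"
  unfolding cobd_def by (rule lin_comb_diff[OF gens_SucD[OF assms(1)] assms(2,3)])

lemma cobd_hom:
  assumes "g \<in> mod_hom R M N" "module R M" "module R N"
    "t \<in> gens R I (Suc j)" "\<phi> \<in> gens R I j \<rightarrow> carrier M"
  shows "cobd N (\<lambda>s. g (\<phi> s)) t = g (cobd M \<phi> t)"
  unfolding cobd_def by (rule lin_comb_hom[OF assms(1-3) gens_SucD[OF assms(4)] assms(5)])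

text \<open>Coefficients of a flattened combination are themselves linear combinations in the module \<open>R\<close>.\<close>

definition self_module :: "('r, 'x) ring_scheme \<Rightarrow> ('r, 'r) module" where
  "self_module R = \<lparr>carrier = carrier R, monoid.mult = monoid.mult R, one = one R,
    zero = zero R, add = add R, smult = monoid.mult R\<rparr>"

lemma self_module_simps [simp]:
  "carrier (self_module R) = carrier R" "zero (self_module R) = zero R"
  "add (self_module R) = add R" "smult (self_module R) = monoid.mult R"
  by (auto simp: self_module_def)

lemma (in cring) module_self_module: "module R (self_module R)"
proof (rule moduleI)
  show "abelian_group (self_module R)"
    by (rule abelian_groupI) (auto simp: a_ac intro: l_neg)
qed (auto simp: is_cring l_distr r_distr m_assoc)

lemma (in cring) coef_flat:
  assumes "set l \<subseteq> carrier R \<times> gens R I (Suc j)"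
  shows "coef R t (flat R l) = lin_comb (self_module R) (\<lambda>s. coef R t (args s)) l"
  using assms
proof (induction l)
  case (Cons p l)
  then have p: "snd p \<in> gens R I (Suc j)" "fst p \<in> carrier R" and l: "set l \<subseteq> carrier R \<times> gens R I (Suc j)"
    by auto
  note a = gens_SucD[OF p(1)]
  show ?case using Cons.IH[OF l] coef_append[OF scale_closed[OF a p(2)] flat_closed[OF is_cring l]]
      coef_scale[OF a p(2)] by simp
qed simp

lemma (in cring) coef_flat_linear:
  assumes "set l \<subseteq> carrier R \<times> gens R I (Suc j)" "set l' \<subseteq> carrier R \<times> gens R I (Suc j)"
    "set l'' \<subseteq> carrier R \<times> gens R I (Suc j)" "r \<in> carrier R" "s \<in> carrier R"
    "\<And>t. coef R t l'' = r \<otimes> coef R t l \<oplus> s \<otimes> coef R t l'"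
  shows "coef R t (flat R l'') = r \<otimes> coef R t (flat R l) \<oplus> s \<otimes> coef R t (flat R l')"
proof -
  have "(\<lambda>s. coef R t (args s)) \<in> gens R I (Suc j) \<rightarrow> carrier (self_module R)"
    using coef_closed[OF gens_SucD] by auto
  from module.lin_comb_linear[OF module_self_module assms(1-3) this assms(4-6)]
  show ?thesis by (simp add: coef_flat[OF assms(1)] coef_flat[OF assms(2)] coef_flat[OF assms(3)])
qed

text \<open>Shows that the boundaries of the generators form a submodule as
  \<open>baer_extend\<close> demands: in the lowest degree because \<open>I\<close> is an ideal,
  above it because they are the kernel of \<open>flat\<close>.\<close>

lemma gens_Suc_linear:
  assumes "cring R" "ideal I R" "Node l \<in> gens R I (Suc j)" "Node l' \<in> gens R I (Suc j)"
    "set l'' \<subseteq> carrier R \<times> gens R I j" "r \<in> carrier R" "s \<in> carrier R"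
    "\<And>t. coef R t l'' = r \<otimes>\<^bsub>R\<^esub> coef R t l \<oplus>\<^bsub>R\<^esub> s \<otimes>\<^bsub>R\<^esub> coef R t l'"
  shows "Node l'' \<in> gens R I (Suc j)"
proof (cases j)
  case 0
  interpret cring R by fact
  interpret I: ideal I R by fact
  show ?thesis using assms(3-8) unfolding 0 gens_1
    by (auto simp: I.I_l_closed I.a_closed)
next
  case (Suc k)
  interpret cring R by fact
  have l: "set l \<subseteq> carrier R \<times> gens R I (Suc k)" "set l' \<subseteq> carrier R \<times> gens R I (Suc k)"
    "set l'' \<subseteq> carrier R \<times> gens R I (Suc k)"
    using gens_SucD[OF assms(3)] gens_SucD[OF assms(4)] assms(5) Suc by simp_all
  show ?thesis using assms(3,4,6,7) l coef_flat_linear[OF l assms(6-8)] unfolding Suc gens_Suc_Suc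
    by (auto simp: image_iff)
qed

text \<open>The generators carry no relations among themselves; linearity of a cocycle comes from
  the next degree. The combination \<open>r Node l + s Node l' - Node l''\<close> is a cycle, hence
  itself the boundary of a generator, and the cocycle vanishes there.\<close>

lemma cocycle_linear:
  assumes "module R M" "cocycle R I M (Suc j) \<phi>" "Node l \<in> gens R I (Suc j)" "Node l' \<in> gens R I (Suc j)"
    "Node l'' \<in> gens R I (Suc j)" "r \<in> carrier R" "s \<in> carrier R"
    "\<And>t. coef R t l'' = r \<otimes>\<^bsub>R\<^esub> coef R t l \<oplus>\<^bsub>R\<^esub> s \<otimes>\<^bsub>R\<^esub> coef R t l'"
  shows "\<phi> (Node l'') = r \<odot>\<^bsub>M\<^esub> \<phi> (Node l) \<oplus>\<^bsub>M\<^esub> s \<odot>\<^bsub>M\<^esub> \<phi> (Node l')"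
proof -
  interpret module R M by fact
  let ?q = "[(r, Node l), (s, Node l'), (\<ominus>\<^bsub>R\<^esub> \<one>\<^bsub>R\<^esub>, Node l'')]"
  have l: "set l \<subseteq> carrier R \<times> gens R I j" "set l' \<subseteq> carrier R \<times> gens R I j"
    "set l'' \<subseteq> carrier R \<times> gens R I j"
    using gens_SucD[OF assms(3)] gens_SucD[OF assms(4)] gens_SucD[OF assms(5)] by simp_all
  have m: "\<ominus>\<^bsub>R\<^esub> \<one>\<^bsub>R\<^esub> \<in> carrier R" by simp
  note sc = scale_closed[OF l(1) assms(6)] scale_closed[OF l(2) assms(7)] scale_closed[OF l(3) m]
  have sc23: "set (scale R s l' @ scale R (\<ominus>\<^bsub>R\<^esub> \<one>\<^bsub>R\<^esub>) l'') \<subseteq> carrier R \<times> gens R I j" using sc by simp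
  have cancel: "a \<oplus>\<^bsub>R\<^esub> (b \<oplus>\<^bsub>R\<^esub> \<ominus>\<^bsub>R\<^esub> (a \<oplus>\<^bsub>R\<^esub> b)) = \<zero>\<^bsub>R\<^esub>" if "a \<in> carrier R" "b \<in> carrier R" for a b
    using that by (metis R.a_assoc R.a_closed R.a_inv_closed R.r_neg)
  have "coef R t (flat R ?q) = \<zero>\<^bsub>R\<^esub>" for t
    using coef_append[OF sc(1) sc23] coef_append[OF sc(2,3)] coef_scale[OF l(1) assms(6)] coef_scale[OF l(2) assms(7)]
      coef_scale[OF l(3) m] coef_closed[OF l(1), of t] coef_closed[OF l(2), of t] assms(6-8)
    by (simp add: R.l_minus cancel)
  then have "Node ?q \<in> gens R I (Suc (Suc j))"
    using assms(3-7) m unfolding gens_Suc_Suc by auto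
  then have "cobd M \<phi> (Node ?q) = \<zero>\<^bsub>M\<^esub>" using assms(2) unfolding cocycle_def by blast
  moreover have c: "\<phi> (Node l) \<in> carrier M" "\<phi> (Node l') \<in> carrier M" "\<phi> (Node l'') \<in> carrier M"
    using assms(2-5) unfolding cocycle_def by auto
  ultimately have "(r \<odot>\<^bsub>M\<^esub> \<phi> (Node l) \<oplus>\<^bsub>M\<^esub> s \<odot>\<^bsub>M\<^esub> \<phi> (Node l')) \<ominus>\<^bsub>M\<^esub> \<phi> (Node l'') = \<zero>\<^bsub>M\<^esub>"
    using assms(6,7) by (simp add: cobd_def smult_l_minus M.minus_eq M.a_assoc)
  from M.diff_eq_zeroD[OF this] c assms(6,7) show ?thesis by simp
qed

text \<open>This is the vanishing of \<open>Ext^(j+1)(R/I, M)\<close>. The cocycle is a linear map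
  on the submodule of lists \<open>l\<close> with \<open>Node l\<close> a generator. An extension of
  it to the whole free module on \<open>gens R I j\<close> is a cochain with the required
  coboundary.\<close>

lemma baer_cocycle:
  assumes "module R M" "baer R M" "ideal I R" "cocycle R I M (Suc j) \<phi>"
  shows "\<exists>\<psi> \<in> gens R I j \<rightarrow> carrier M. \<forall>t\<in>gens R I (Suc j). \<phi> t = cobd M \<psi> t"
proof -
  interpret module R M by fact
  interpret I: ideal I R by fact
  have nil: "Node [] \<in> gens R I (Suc j)"
    by (cases j) (auto simp: gens_1 gens_Suc_Suc)
  have "\<exists>\<psi> \<in> gens R I j \<rightarrow> carrier M. \<forall>l. Node l \<in> gens R I (Suc j) \<longrightarrow> lin_comb M \<psi> l = \<phi> (Node l)"
  proof (rule baer_extend[where L = "\<lambda>l. Node l \<in> gens R I (Suc j)" and \<Phi> = "\<lambda>l. \<phi> (Node l)", OF assms(1,2) _ nil])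
    show "set l \<subseteq> carrier R \<times> gens R I j" if "Node l \<in> gens R I (Suc j)" for l
      using gens_SucD[OF that] by simp
    show "\<phi> (Node l) \<in> carrier M" if "Node l \<in> gens R I (Suc j)" for l
      using that assms(4) unfolding cocycle_def by auto
    fix l l' l'' :: "('a \<times> 'a tree) list" and r s
    assume a: "Node l \<in> gens R I (Suc j)" "Node l' \<in> gens R I (Suc j)"
      "set l'' \<subseteq> carrier R \<times> gens R I j" "r \<in> carrier R" "s \<in> carrier R"
      "\<And>t. coef R t l'' = r \<otimes>\<^bsub>R\<^esub> coef R t l \<oplus>\<^bsub>R\<^esub> s \<otimes>\<^bsub>R\<^esub> coef R t l'"
    note b = gens_Suc_linear[OF R.is_cring assms(3) a]
    show "Node l'' \<in> gens R I (Suc j) \<and>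
      \<phi> (Node l'') = r \<odot>\<^bsub>M\<^esub> \<phi> (Node l) \<oplus>\<^bsub>M\<^esub> s \<odot>\<^bsub>M\<^esub> \<phi> (Node l')"
      using b cocycle_linear[OF assms(1,4) a(1,2) b a(4-6)] by simp
  qed
  then obtain \<psi> where \<psi>: "\<psi> \<in> gens R I j \<rightarrow> carrier M"
    "\<And>l. Node l \<in> gens R I (Suc j) \<Longrightarrow> lin_comb M \<psi> l = \<phi> (Node l)" by blast
  have "\<phi> t = cobd M \<psi> t" if "t \<in> gens R I (Suc j)" for t
  proof -
    obtain l where "t = Node l" using \<open>t \<in> gens R I (Suc j)\<close> by (auto simp: gens.simps(2))
    then show ?thesis using \<psi>(2) \<open>t \<in> gens R I (Suc j)\<close> by (simp add: cobd_def)
  qed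
  then show ?thesis using \<psi>(1) by blast
qed

section \<open>Effaceability of local cohomology\<close>

text \<open>Stands for the descending powers of \<open>\<aa>\<close>.\<close>

locale ideal_filtration = cring R for R :: "('r, 'x) ring_scheme" (structure) +
  fixes P :: "nat \<Rightarrow> 'r set"
  assumes P_ideal: "ideal (P n) R" and P_decr: "P (Suc n) \<subseteq> P n"
begin

lemma P_antimono: "n \<le> m \<Longrightarrow> P m \<subseteq> P n"
  by (rule lift_Suc_antimono_le) (rule P_decr)

lemma P_carrier: "r \<in> P n \<Longrightarrow> r \<in> carrier R"
  using ideal.Icarr[OF P_ideal] .

definition torsion :: "('r, 'm, 'y) module_scheme \<Rightarrow> 'm set" where
  "torsion M = {x \<in> carrier M. \<exists>n. \<forall>r\<in>P n. r \<odot>\<^bsub>M\<^esub> x = \<zero>\<^bsub>M\<^esub>}"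

text \<open>\<open>eff j M\<close> says that \<open>colim Ext\<^sup>j\<^sup>+\<^sup>1(R/P\<^sub>n, M) = 0\<close>, that is, \<open>H\<^sup>j\<^sup>+\<^sup>1(M) = 0\<close>.\<close>

definition eff :: "nat \<Rightarrow> ('r, 'm, 'y) module_scheme \<Rightarrow> bool" where
  "eff j M \<longleftrightarrow> (\<forall>n \<phi>. cocycle R (P n) M (Suc j) \<phi> \<longrightarrow>
    (\<exists>m\<ge>n. \<exists>\<psi> \<in> gens R (P m) j \<rightarrow> carrier M. \<forall>t\<in>gens R (P m) (Suc j). \<phi> t = cobd M \<psi> t))"

lemma effE:
  assumes "eff j M" "cocycle R (P n) M (Suc j) \<phi>"
  obtains m \<psi> where "n \<le> m" "\<psi> \<in> gens R (P m) j \<rightarrow> carrier M"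
    "\<And>t. t \<in> gens R (P m) (Suc j) \<Longrightarrow> \<phi> t = cobd M \<psi> t"
  using assms unfolding eff_def by blast

lemma effI:
  assumes "\<And>n \<phi>. cocycle R (P n) M (Suc j) \<phi> \<Longrightarrow>
    \<exists>m\<ge>n. \<exists>\<psi> \<in> gens R (P m) j \<rightarrow> carrier M. \<forall>t\<in>gens R (P m) (Suc j). \<phi> t = cobd M \<psi> t"
  shows "eff j M"
  using assms unfolding eff_def by blast

text \<open>Links the resolution to torsion: a cochain of degree 0 is one element
  \<open>\<psi> Star\<close>, and its coboundary takes as values exactly the multiples of it by
  elements of \<open>P n\<close>.\<close>

lemma cobd_Star:
  assumes "module R M" "\<psi> Star \<in> carrier M"
  shows "t \<in> gens R (P n) (Suc 0) \<Longrightarrow> \<exists>r\<in>P n. cobd M \<psi> t = r \<odot>\<^bsub>M\<^esub> \<psi> Star"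
    "r \<in> P n \<Longrightarrow> \<exists>t\<in>gens R (P n) (Suc 0). cobd M \<psi> t = r \<odot>\<^bsub>M\<^esub> \<psi> Star"
proof -
  interpret M: module R M by fact
  show "\<exists>r\<in>P n. cobd M \<psi> t = r \<odot>\<^bsub>M\<^esub> \<psi> Star" if t: "t \<in> gens R (P n) (Suc 0)"
  proof -
    obtain l where l: "t = Node l" "set l \<subseteq> carrier R \<times> {Star}" "coef R Star l \<in> P n"
      using t by (auto simp: gens_1)
    have "filter (\<lambda>p. snd p \<noteq> Star) l = []" using l(2) by (auto simp: filter_empty_conv)
    then have "cobd M \<psi> t = coef R Star l \<odot>\<^bsub>M\<^esub> \<psi> Star"
      using M.lin_comb_remove[OF l(2), of \<psi> Star] assms(2) l P_carrier by (simp add: cobd_def)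
    then show ?thesis using l(3) by blast
  qed
  show "\<exists>t\<in>gens R (P n) (Suc 0). cobd M \<psi> t = r \<odot>\<^bsub>M\<^esub> \<psi> Star" if "r \<in> P n"
    using that assms(2) P_carrier[OF that]
    by (intro bexI[of _ "Node [(r, Star)]"]) (auto simp: gens_1 cobd_def)
qed

lemma torsion_iff:
  assumes "module R M" "\<psi> Star \<in> carrier M"
  shows "\<psi> Star \<in> torsion M \<longleftrightarrow> (\<exists>n. \<forall>t\<in>gens R (P n) (Suc 0). cobd M \<psi> t = \<zero>\<^bsub>M\<^esub>)"
proof -
  have "(\<forall>t\<in>gens R (P n) (Suc 0). cobd M \<psi> t = \<zero>\<^bsub>M\<^esub>) \<longleftrightarrow> (\<forall>r\<in>P n. r \<odot>\<^bsub>M\<^esub> \<psi> Star = \<zero>\<^bsub>M\<^esub>)" for n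
    using cobd_Star[of M \<psi>, OF assms] by metis
  then show ?thesis using assms(2) by (simp add: torsion_def)
qed

lemma cocycle_antimono:
  "cocycle R (P n) M j \<phi> \<Longrightarrow> n \<le> m \<Longrightarrow> cocycle R (P m) M j \<phi>"
  using cocycle_mono P_antimono by blast

lemma gens_antimono: "n \<le> m \<Longrightarrow> gens R (P m) j \<subseteq> gens R (P n) j"
  by (intro gens_mono P_antimono)

lemma Pi_antimono: "\<phi> \<in> gens R (P n) j \<rightarrow> A \<Longrightarrow> n \<le> m \<Longrightarrow> \<phi> \<in> gens R (P m) j \<rightarrow> A"
  using gens_antimono by blast

lemma cocycle_closed: "cocycle R I M j \<phi> \<Longrightarrow> t \<in> gens R I j \<Longrightarrow> \<phi> t \<in> carrier M"
  unfolding cocycle_def by blast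

lemma cocycle_hom:
  assumes "cocycle R (P n) M j \<phi>" "g \<in> mod_hom R M N" "module R M" "module R N"
  shows "cocycle R (P n) N j (\<lambda>t. g (\<phi> t))"
  using assms(1) cobd_hom[OF assms(2-4), of _ "P n" j \<phi>] mod_hom_zero[OF assms(2-4)] mod_hom_closed[OF assms(2)]
  unfolding cocycle_def by auto

lemma torsion_diff:
  assumes "module R M" "\<And>r. r \<in> P n \<Longrightarrow> r \<odot>\<^bsub>M\<^esub> x = r \<odot>\<^bsub>M\<^esub> y" "x \<in> carrier M" "y \<in> carrier M"
  shows "x \<ominus>\<^bsub>M\<^esub> y \<in> torsion M"
proof -
  interpret M: module R M by fact
  have "r \<odot>\<^bsub>M\<^esub> (x \<ominus>\<^bsub>M\<^esub> y) = \<zero>\<^bsub>M\<^esub>" if "r \<in> P n" for r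
    using assms(2)[OF that] assms(3,4) P_carrier[OF that]
    by (simp add: M.M.minus_eq M.smult_r_distr M.smult_r_minus M.M.r_neg)
  then show ?thesis using assms(3,4) by (auto simp: torsion_def)
qed

end

section \<open>The long exact sequence of local cohomology, piece by piece\<close>

locale short_exact = ideal_filtration R P for R :: "('r, 'x) ring_scheme" (structure) and P +
  fixes B :: "('r, 'b) module" and C :: "('r, 'c) module" and g :: "'b \<Rightarrow> 'c"
  assumes B: "module R B" and C: "module R C" and g: "g \<in> mod_hom R B C"
    and surj: "g ` carrier B = carrier C"
begin

text \<open>The kernel keeps the operations of \<open>B\<close>, so a cochain in \<open>A\<close> is
  literally a cochain in \<open>B\<close> with the same coboundary.\<close>

definition A :: "('r, 'b) module" where "A = B\<lparr>carrier := {b \<in> carrier B. g b = \<zero>\<^bsub>C\<^esub>}\<rparr>"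

lemma A_simps [simp]:
  "carrier A = {b \<in> carrier B. g b = \<zero>\<^bsub>C\<^esub>}" "zero A = zero B" "smult A = smult B" "cobd A = cobd B"
  by (auto simp: A_def)

interpretation B: module R B by (rule B)
interpretation C: module R C by (rule C)

text \<open>Freeness of the resolution: cochains are bare functions on generators, so they lift
  value by value.\<close>

lemma lift:
  assumes "\<phi> \<in> S \<rightarrow> carrier C"
  obtains \<psi> where "\<psi> \<in> S \<rightarrow> carrier B" "\<And>s. s \<in> S \<Longrightarrow> g (\<psi> s) = \<phi> s"
proof -
  have "\<forall>s\<in>S. \<exists>b. b \<in> carrier B \<and> g b = \<phi> s" using assms surj by (auto simp: Pi_iff image_iff set_eq_iff) metis
  then show ?thesis using that by (metis (no_types, lifting) Pi_I)
qed

lemma cocycle_kernel: "cocycle R I A j \<phi> \<Longrightarrow> cocycle R I B j \<phi>"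
  unfolding cocycle_def by auto

lemma diff_kernel:
  assumes "x \<in> carrier B" "y \<in> carrier B" "g x = g y"
  shows "x \<ominus>\<^bsub>B\<^esub> y \<in> carrier A"
  using assms mod_hom_diff[OF g B C, of x y] mod_hom_closed[OF g]
  by (simp add: C.M.minus_eq C.M.r_neg)

text \<open>Exactness of \<open>\<Gamma>(B)\<close>, \<open>\<Gamma>(C)\<close>,
  \<open>H^1(A)\<close> in the middle. For any preimage \<open>b\<close> of \<open>x\<close>, the
  multiples of \<open>b\<close> by \<open>P n\<close> give a cocycle in \<open>A\<close>. Once it is
  the coboundary of an element of \<open>A\<close>, subtracting that element from \<open>b\<close>
  makes \<open>b\<close> torsion.\<close>

lemma torsion_lift:
  assumes "eff 0 A" "x \<in> torsion C"
  shows "\<exists>b\<in>torsion B. g b = x"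
proof -
  obtain n where n: "x \<in> carrier C" "\<forall>r\<in>P n. r \<odot>\<^bsub>C\<^esub> x = \<zero>\<^bsub>C\<^esub>" using assms(2) by (auto simp: torsion_def)
  obtain b where b: "b \<in> carrier B" "g b = x" using n(1) unfolding surj[symmetric] by blast
  let ?b = "\<lambda>_ :: 'r tree. b"
  have "cocycle R (P n) B (Suc 0) (cobd B ?b)" using b by (intro B.cocycle_cobd) auto
  moreover have "g (cobd B ?b t) = \<zero>\<^bsub>C\<^esub>" if t: "t \<in> gens R (P n) (Suc 0)" for t
  proof -
    obtain r where r: "r \<in> P n" "cobd B ?b t = r \<odot>\<^bsub>B\<^esub> b" using cobd_Star(1)[where \<psi> = ?b, OF B b(1) t] by blast
    then show ?thesis using mod_hom_smult[OF g P_carrier[OF r(1)] b(1)] b(2) n(2) by simp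
  qed
  ultimately have "cocycle R (P n) A (Suc 0) (cobd B ?b)" unfolding cocycle_def by auto
  from effE[OF assms(1) this] obtain m \<psi> where \<psi>: "n \<le> m" "\<psi> \<in> gens R (P m) 0 \<rightarrow> carrier A"
    "\<And>t. t \<in> gens R (P m) (Suc 0) \<Longrightarrow> cobd B ?b t = cobd A \<psi> t" by blast
  have \<psi>S: "\<psi> Star \<in> carrier B" "g (\<psi> Star) = \<zero>\<^bsub>C\<^esub>" using \<psi>(2) by auto
  have "r \<odot>\<^bsub>B\<^esub> b = r \<odot>\<^bsub>B\<^esub> \<psi> Star" if "r \<in> P m" for r
  proof -
    have t: "Node [(r, Star)] \<in> gens R (P m) (Suc 0)" using that P_carrier[OF that] by (simp add: gens_1)
    show ?thesis using \<psi>(3)[OF t] b \<psi>S P_carrier[OF that] by (simp add: cobd_def)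
  qed
  then have "b \<ominus>\<^bsub>B\<^esub> \<psi> Star \<in> torsion B" using b \<psi>S by (intro torsion_diff[OF B])
  moreover have "g (b \<ominus>\<^bsub>B\<^esub> \<psi> Star) = x"
    using mod_hom_diff[OF g B C b(1) \<psi>S(1)] b \<psi>S n by (simp add: C.M.diff_zero)
  ultimately show ?thesis by blast
qed

text \<open>Exactness of \<open>\<Gamma>(B)\<close>, \<open>\<Gamma>(C)\<close>,
  \<open>H^1(A)\<close>, \<open>H^1(B)\<close>: the kernel of the last map comes from
  \<open>\<Gamma>(C)\<close>, and the first map is onto by assumption.\<close>

lemma eff_kernel_0:
  assumes "\<And>x. x \<in> torsion C \<Longrightarrow> \<exists>b\<in>torsion B. g b = x" "eff 0 B"
  shows "eff 0 A"
proof (rule effI)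
  fix n \<phi> assume \<phi>: "cocycle R (P n) A (Suc 0) \<phi>"
  obtain m \<psi> where \<psi>: "n \<le> m" "\<psi> \<in> gens R (P m) 0 \<rightarrow> carrier B"
    "\<And>t. t \<in> gens R (P m) (Suc 0) \<Longrightarrow> \<phi> t = cobd B \<psi> t"
    using effE[OF assms(2) cocycle_kernel[OF \<phi>]] by blast
  have \<psi>S: "\<psi> Star \<in> carrier B" using \<psi>(2) by auto
  have "cobd C (\<lambda>t. g (\<psi> t)) t = \<zero>\<^bsub>C\<^esub>" if "t \<in> gens R (P m) (Suc 0)" for t
    using cobd_hom[OF g B C that \<psi>(2)] \<psi>(3)[OF that] cocycle_closed[OF \<phi> subsetD[OF gens_antimono[OF \<psi>(1)] that]]
    by simp
  then have "g (\<psi> Star) \<in> torsion C"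
    using torsion_iff[OF C, of "\<lambda>t. g (\<psi> t)"] mod_hom_closed[OF g \<psi>S] by blast
  then obtain b where b: "b \<in> torsion B" "g b = g (\<psi> Star)" using assms(1) by blast
  then have bB: "b \<in> carrier B" by (simp add: torsion_def)
  then obtain k where k: "\<And>t. t \<in> gens R (P k) (Suc 0) \<Longrightarrow> cobd B (\<lambda>_. b) t = \<zero>\<^bsub>B\<^esub>"
    using torsion_iff[OF B, of "\<lambda>_. b"] b(1) by blast
  \<comment> \<open>Subtracting the torsion element \<open>b\<close> moves \<open>\<psi>\<close>
    into the kernel. Its coboundary vanishes from index \<open>k\<close> on, so that of
    \<open>\<psi>\<close> is unchanged there.\<close>
  let ?m = "max m k"
  have "(\<lambda>t. \<psi> t \<ominus>\<^bsub>B\<^esub> b) \<in> gens R (P ?m) 0 \<rightarrow> carrier A"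
    using diff_kernel[OF \<psi>S bB] b by auto
  moreover have "\<phi> t = cobd A (\<lambda>t. \<psi> t \<ominus>\<^bsub>B\<^esub> b) t" if t: "t \<in> gens R (P ?m) (Suc 0)" for t
  proof -
    have t': "t \<in> gens R (P m) (Suc 0)" "t \<in> gens R (P k) (Suc 0)"
      using t gens_antimono[of m ?m] gens_antimono[of k ?m] by auto
    show ?thesis using B.cobd_diff[OF t'(1) \<psi>(2), of "\<lambda>_. b"] bB \<psi>(3)[OF t'(1)] k[OF t'(2)]
        B.cobd_closed[OF \<psi>(2) t'(1)] by (simp add: B.M.diff_zero)
  qed
  ultimately show "\<exists>m\<ge>n. \<exists>\<psi> \<in> gens R (P m) 0 \<rightarrow> carrier A. \<forall>t\<in>gens R (P m) (Suc 0). \<phi> t = cobd A \<psi> t"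
    using \<psi>(1) by (intro exI[of _ ?m] conjI bexI) auto
qed

text \<open>Exactness of \<open>H^(j+1)(C)\<close>, \<open>H^(j+2)(A)\<close>,
  \<open>H^(j+2)(B)\<close> in the middle.\<close>

lemma eff_kernel:
  assumes "eff j C" "eff (Suc j) B"
  shows "eff (Suc j) A"
proof (rule effI)
  fix n \<phi> assume \<phi>: "cocycle R (P n) A (Suc (Suc j)) \<phi>"
  obtain m \<psi> where \<psi>: "n \<le> m" "\<psi> \<in> gens R (P m) (Suc j) \<rightarrow> carrier B"
    "\<And>t. t \<in> gens R (P m) (Suc (Suc j)) \<Longrightarrow> \<phi> t = cobd B \<psi> t"
    using effE[OF assms(2) cocycle_kernel[OF \<phi>]] by blast
  have "cobd C (\<lambda>t. g (\<psi> t)) t = \<zero>\<^bsub>C\<^esub>" if "t \<in> gens R (P m) (Suc (Suc j))" for t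
    using cobd_hom[OF g B C that \<psi>(2)] \<psi>(3)[OF that] cocycle_closed[OF \<phi> subsetD[OF gens_antimono[OF \<psi>(1)] that]]
    by simp
  then have "cocycle R (P m) C (Suc j) (\<lambda>t. g (\<psi> t))"
    using \<psi>(2) mod_hom_closed[OF g] unfolding cocycle_def by auto
  from effE[OF assms(1) this] obtain k \<chi> where \<chi>: "m \<le> k" "\<chi> \<in> gens R (P k) j \<rightarrow> carrier C"
    "\<And>t. t \<in> gens R (P k) (Suc j) \<Longrightarrow> g (\<psi> t) = cobd C \<chi> t" by blast
  \<comment> \<open>Subtracting the coboundary of a lift of \<open>\<chi>\<close> brings
    \<open>\<psi>\<close> into the kernel of \<open>g\<close> without changing its own
    coboundary.\<close>
  obtain \<xi> where \<xi>: "\<xi> \<in> gens R (P k) j \<rightarrow> carrier B" "\<And>s. s \<in> gens R (P k) j \<Longrightarrow> g (\<xi> s) = \<chi> s"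
    using lift[OF \<chi>(2)] by blast
  note \<psi>k = Pi_antimono[OF \<psi>(2) \<chi>(1)]
  have \<xi>g: "g (cobd B \<xi> t) = g (\<psi> t)" if "t \<in> gens R (P k) (Suc j)" for t
    using cobd_hom[OF g B C that \<xi>(1)] cobd_cong[OF that, of "\<lambda>s. g (\<xi> s)" \<chi> C] \<xi>(2) \<chi>(3)[OF that] by simp
  have c: "cobd B \<xi> \<in> gens R (P k) (Suc j) \<rightarrow> carrier B" using B.cobd_closed[OF \<xi>(1)] by blast
  have "(\<lambda>t. \<psi> t \<ominus>\<^bsub>B\<^esub> cobd B \<xi> t) \<in> gens R (P k) (Suc j) \<rightarrow> carrier A"
    using diff_kernel[OF Pi_mem[OF \<psi>k] Pi_mem[OF c] \<xi>g[symmetric]] by blast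
  moreover have "\<phi> t = cobd A (\<lambda>t. \<psi> t \<ominus>\<^bsub>B\<^esub> cobd B \<xi> t) t" if t: "t \<in> gens R (P k) (Suc (Suc j))" for t
  proof -
    have t': "t \<in> gens R (P m) (Suc (Suc j))" using t gens_antimono[OF \<chi>(1)] by blast
    show ?thesis using B.cobd_diff[OF t \<psi>k c] B.cobd_cobd[OF t \<xi>(1)] \<psi>(3)[OF t']
        B.cobd_closed[OF \<psi>k t] by (simp add: B.M.diff_zero)
  qed
  ultimately show "\<exists>m\<ge>n. \<exists>\<psi> \<in> gens R (P m) (Suc j) \<rightarrow> carrier A. \<forall>t\<in>gens R (P m) (Suc (Suc j)). \<phi> t = cobd A \<psi> t"
    using \<psi>(1) \<chi>(1) by (intro exI[of _ k] conjI bexI) auto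
qed

text \<open>Exactness of \<open>H^(j+1)(B)\<close>, \<open>H^(j+1)(C)\<close>,
  \<open>H^(j+2)(A)\<close> in the middle. This is the step that lowers the cohomological
  degree.\<close>

lemma eff_image:
  assumes "eff (Suc j) A" "eff j B"
  shows "eff j C"
proof (rule effI)
  fix n \<phi> assume \<phi>: "cocycle R (P n) C (Suc j) \<phi>"
  then obtain \<xi> where \<xi>: "\<xi> \<in> gens R (P n) (Suc j) \<rightarrow> carrier B"
      "\<And>s. s \<in> gens R (P n) (Suc j) \<Longrightarrow> g (\<xi> s) = \<phi> s"
    using lift[of \<phi> "gens R (P n) (Suc j)"] unfolding cocycle_def by blast
  have "g (cobd B \<xi> t) = \<zero>\<^bsub>C\<^esub>" if "t \<in> gens R (P n) (Suc (Suc j))" for t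
    using cobd_hom[OF g B C that \<xi>(1)] cobd_cong[OF that, of "\<lambda>s. g (\<xi> s)" \<phi> C] \<xi>(2) \<phi> that
    unfolding cocycle_def by simp
  then have "cocycle R (P n) A (Suc (Suc j)) (cobd B \<xi>)"
    using B.cocycle_cobd[OF \<xi>(1)] unfolding cocycle_def by auto
  from effE[OF assms(1) this] obtain m \<psi> where \<psi>: "n \<le> m" "\<psi> \<in> gens R (P m) (Suc j) \<rightarrow> carrier A"
    "\<And>t. t \<in> gens R (P m) (Suc (Suc j)) \<Longrightarrow> cobd B \<xi> t = cobd A \<psi> t" by blast
  note \<xi>m = Pi_antimono[OF \<xi>(1) \<psi>(1)]
  have \<psi>B: "\<psi> \<in> gens R (P m) (Suc j) \<rightarrow> carrier B" "\<And>t. t \<in> gens R (P m) (Suc j) \<Longrightarrow> g (\<psi> t) = \<zero>\<^bsub>C\<^esub>"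
    using \<psi>(2) by auto
  \<comment> \<open>The lift \<open>\<xi>\<close> is not a cocycle, but its coboundary is also the
    coboundary of \<open>\<psi>\<close>, which lies in the kernel; the difference is a cocycle and
    still lifts \<open>\<phi>\<close>.\<close>
  let ?\<eta> = "\<lambda>t. \<xi> t \<ominus>\<^bsub>B\<^esub> \<psi> t"
  have \<eta>: "?\<eta> t \<in> carrier B" "g (?\<eta> t) = \<phi> t" if "t \<in> gens R (P m) (Suc j)" for t
  proof -
    have t: "t \<in> gens R (P n) (Suc j)" using gens_antimono[OF \<psi>(1)] that by blast
    have b: "\<xi> t \<in> carrier B" "\<psi> t \<in> carrier B" using \<xi>m \<psi>B that by auto
    then show "?\<eta> t \<in> carrier B" by simp
    show "g (?\<eta> t) = \<phi> t" using mod_hom_diff[OF g B C b] \<psi>B(2)[OF that] \<xi>(2)[OF t] mod_hom_closed[OF g b(1)]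
      by (simp add: C.M.diff_zero)
  qed
  have "cobd B ?\<eta> t = \<zero>\<^bsub>B\<^esub>" if "t \<in> gens R (P m) (Suc (Suc j))" for t
    using B.cobd_diff[OF that \<xi>m \<psi>B(1)] \<psi>(3)[OF that] B.cobd_closed[OF \<psi>B(1) that]
    by (simp add: B.M.minus_eq B.M.r_neg)
  then have "cocycle R (P m) B (Suc j) ?\<eta>" using \<eta> unfolding cocycle_def by auto
  from effE[OF assms(2) this] obtain k \<chi> where \<chi>: "m \<le> k" "\<chi> \<in> gens R (P k) j \<rightarrow> carrier B"
    "\<And>t. t \<in> gens R (P k) (Suc j) \<Longrightarrow> ?\<eta> t = cobd B \<chi> t" by blast
  have "(\<lambda>t. g (\<chi> t)) \<in> gens R (P k) j \<rightarrow> carrier C" using \<chi>(2) mod_hom_closed[OF g] by auto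
  moreover have "\<phi> t = cobd C (\<lambda>t. g (\<chi> t)) t" if "t \<in> gens R (P k) (Suc j)" for t
    using cobd_hom[OF g B C that \<chi>(2)] \<chi>(3)[OF that] \<eta>(2)[of t] subsetD[OF gens_antimono[OF \<chi>(1)] that] by simp
  ultimately show "\<exists>m\<ge>n. \<exists>\<psi> \<in> gens R (P m) j \<rightarrow> carrier C. \<forall>t\<in>gens R (P m) (Suc j). \<phi> t = cobd C \<psi> t"
    using \<psi>(1) \<chi>(1) by (intro exI[of _ k] conjI bexI) auto
qed

end

section \<open>Retracts, injective modules and products\<close>

context ideal_filtration
begin

text \<open>Used twice to change modules: for a module as a retract of the degree 0 cycles of its
  resolution, and for cycles of the mapping cone in high degrees.\<close>

lemma eff_retract:
  assumes "eff j N" "i \<in> mod_hom R M N" "p \<in> mod_hom R N M" "module R M" "module R N"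
    and "\<And>x. x \<in> carrier M \<Longrightarrow> p (i x) = x"
  shows "eff j M"
proof (rule effI)
  fix n \<phi> assume \<phi>: "cocycle R (P n) M (Suc j) \<phi>"
  from effE[OF assms(1) cocycle_hom[OF \<phi> assms(2,4,5)]]
  obtain m \<psi> where \<psi>: "n \<le> m" "\<psi> \<in> gens R (P m) j \<rightarrow> carrier N"
    "\<And>t. t \<in> gens R (P m) (Suc j) \<Longrightarrow> i (\<phi> t) = cobd N \<psi> t" by blast
  have "(\<lambda>t. p (\<psi> t)) \<in> gens R (P m) j \<rightarrow> carrier M" using \<psi>(2) mod_hom_closed[OF assms(3)] by auto
  moreover have "\<phi> t = cobd M (\<lambda>t. p (\<psi> t)) t" if "t \<in> gens R (P m) (Suc j)" for t
    using cobd_hom[OF assms(3,5,4) that \<psi>(2)] \<psi>(3)[OF that] assms(6)[of "\<phi> t"] \<phi> gens_antimono[OF \<psi>(1), of "Suc j"] that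
    unfolding cocycle_def by fastforce
  ultimately show "\<exists>m\<ge>n. \<exists>\<psi> \<in> gens R (P m) j \<rightarrow> carrier M. \<forall>t\<in>gens R (P m) (Suc j). \<phi> t = cobd M \<psi> t"
    using \<psi>(1) by blast
qed

lemma eff_baer:
  assumes "module R M" "baer R M"
  shows "eff j M"
  using baer_cocycle[OF assms P_ideal] by (intro effI) blast

end

definition prod_module :: "('r, 'm) module \<Rightarrow> ('r, 'n) module \<Rightarrow> ('r, 'm \<times> 'n) module" where
  "prod_module M N = \<lparr>carrier = carrier M \<times> carrier N, monoid.mult = undefined, one = undefined,
    zero = (\<zero>\<^bsub>M\<^esub>, \<zero>\<^bsub>N\<^esub>), add = (\<lambda>x y. (fst x \<oplus>\<^bsub>M\<^esub> fst y, snd x \<oplus>\<^bsub>N\<^esub> snd y)),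
    smult = (\<lambda>r x. (r \<odot>\<^bsub>M\<^esub> fst x, r \<odot>\<^bsub>N\<^esub> snd x))\<rparr>"

lemma prod_module_simps [simp]:
  "carrier (prod_module M N) = carrier M \<times> carrier N" "\<zero>\<^bsub>prod_module M N\<^esub> = (\<zero>\<^bsub>M\<^esub>, \<zero>\<^bsub>N\<^esub>)"
  "x \<oplus>\<^bsub>prod_module M N\<^esub> y = (fst x \<oplus>\<^bsub>M\<^esub> fst y, snd x \<oplus>\<^bsub>N\<^esub> snd y)"
  "r \<odot>\<^bsub>prod_module M N\<^esub> x = (r \<odot>\<^bsub>M\<^esub> fst x, r \<odot>\<^bsub>N\<^esub> snd x)"
  by (auto simp: prod_module_def)

lemma module_prod_module:
  assumes "module R M" "module R N"
  shows "module R (prod_module M N)"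
proof -
  interpret M: module R M by fact
  interpret N: module R N by fact
  show ?thesis
  proof (rule moduleI)
    show "abelian_group (prod_module M N)"
    proof (rule abelian_groupI)
      show "\<exists>y\<in>carrier (prod_module M N). y \<oplus>\<^bsub>prod_module M N\<^esub> x = \<zero>\<^bsub>prod_module M N\<^esub>"
        if "x \<in> carrier (prod_module M N)" for x
        using that by (intro bexI[of _ "(\<ominus>\<^bsub>M\<^esub> fst x, \<ominus>\<^bsub>N\<^esub> snd x)"]) (auto simp: M.M.l_neg N.M.l_neg)
    qed (auto simp: M.M.a_ac N.M.a_ac)
  qed (auto simp: M.R.is_cring M.smult_l_distr N.smult_l_distr M.smult_r_distr N.smult_r_distr
      M.smult_assoc1 N.smult_assoc1)
qed

lemma (in ideal_filtration) eff_prod_module: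
  assumes "module R M" "module R N" "eff j M" "eff j N"
  shows "eff j (prod_module M N)"
proof (rule effI)
  fix n \<phi> assume \<phi>: "cocycle R (P n) (prod_module M N) (Suc j) \<phi>"
  note MN = module_prod_module[OF assms(1,2)]
  have fst: "fst \<in> mod_hom R (prod_module M N) M" and snd: "snd \<in> mod_hom R (prod_module M N) N"
    by (auto intro!: mod_homI)
  from effE[OF assms(3) cocycle_hom[OF \<phi> fst MN assms(1)]]
  obtain m \<psi> where \<psi>: "n \<le> m" "\<psi> \<in> gens R (P m) j \<rightarrow> carrier M"
    "\<And>t. t \<in> gens R (P m) (Suc j) \<Longrightarrow> fst (\<phi> t) = cobd M \<psi> t" by blast
  \<comment> \<open>Restricting to the index already found makes the second index the larger one,
    where both components are coboundaries.\<close>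
  from effE[OF assms(4) cocycle_hom[OF cocycle_antimono[OF \<phi> \<psi>(1)] snd MN assms(2)]]
  obtain k \<chi> where \<chi>: "m \<le> k" "\<chi> \<in> gens R (P k) j \<rightarrow> carrier N"
    "\<And>t. t \<in> gens R (P k) (Suc j) \<Longrightarrow> snd (\<phi> t) = cobd N \<chi> t" by blast
  have p: "(\<lambda>t. (\<psi> t, \<chi> t)) \<in> gens R (P k) j \<rightarrow> carrier (prod_module M N)"
    using Pi_antimono[OF \<psi>(2) \<chi>(1)] \<chi>(2) by auto
  moreover have "\<phi> t = cobd (prod_module M N) (\<lambda>t. (\<psi> t, \<chi> t)) t" if "t \<in> gens R (P k) (Suc j)" for t
    using cobd_hom[OF fst MN assms(1) that p] cobd_hom[OF snd MN assms(2) that p] \<psi>(3)[of t] \<chi>(3)[OF that]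
      gens_antimono[OF \<chi>(1)] that by (auto intro: prod_eqI)
  ultimately show "\<exists>m\<ge>n. \<exists>\<psi> \<in> gens R (P m) j \<rightarrow> carrier (prod_module M N).
      \<forall>t\<in>gens R (P m) (Suc j). \<phi> t = cobd (prod_module M N) \<psi> t"
    using \<psi>(1) \<chi>(1) by (intro exI[of _ k] conjI bexI) auto
qed

section \<open>Semiinjective complexes\<close>

text \<open>A copy of the ideal \<open>J\<close> inside \<open>'m\<close>, the universe of test
  complexes; the injection \<open>e\<close> exists by the cardinality assumption. The inverse is
  taken on all of \<open>carrier R\<close>, so the copies of \<open>J\<close> and \<open>R\<close>
  share their operations and the inclusion is the identity function.\<close>

definition transported :: "('r, 'x) ring_scheme \<Rightarrow> ('r \<Rightarrow> 'm) \<Rightarrow> 'r set \<Rightarrow> ('r, 'm) module" where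
  "transported R e J = \<lparr>carrier = e ` J, monoid.mult = undefined, one = undefined,
    zero = e \<zero>\<^bsub>R\<^esub>,
    add = (\<lambda>x y. e (inv_into (carrier R) e x \<oplus>\<^bsub>R\<^esub> inv_into (carrier R) e y)),
    smult = (\<lambda>r x. e (r \<otimes>\<^bsub>R\<^esub> inv_into (carrier R) e x))\<rparr>"

lemma transported_simps:
  "carrier (transported R e J) = e ` J" "\<zero>\<^bsub>transported R e J\<^esub> = e \<zero>\<^bsub>R\<^esub>"
  "inj_on e (carrier R) \<Longrightarrow> a \<in> carrier R \<Longrightarrow> b \<in> carrier R \<Longrightarrow> e a \<oplus>\<^bsub>transported R e J\<^esub> e b = e (a \<oplus>\<^bsub>R\<^esub> b)"
  "inj_on e (carrier R) \<Longrightarrow> a \<in> carrier R \<Longrightarrow> r \<odot>\<^bsub>transported R e J\<^esub> e a = e (r \<otimes>\<^bsub>R\<^esub> a)"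
  by (simp_all add: transported_def)

lemma (in cring) module_transported:
  assumes e: "inj_on e (carrier R)" and J: "ideal J R"
  shows "module R (transported R e J)"
proof -
  interpret J: ideal J R by fact
  note s = transported_simps(1,2) transported_simps(3,4)[OF e]
  have c: "a \<in> J \<Longrightarrow> a \<in> carrier R" for a by (rule J.Icarr)
  show ?thesis
  proof (rule moduleI)
    show "abelian_group (transported R e J)"
    proof (rule abelian_groupI)
      show "\<exists>y\<in>carrier (transported R e J). y \<oplus>\<^bsub>transported R e J\<^esub> x = \<zero>\<^bsub>transported R e J\<^esub>"
        if "x \<in> carrier (transported R e J)" for x
      proof -
        obtain a where a: "x = e a" "a \<in> J" using \<open>x \<in> _\<close> by (auto simp: s)
        then have "e (\<ominus> a) \<in> carrier (transported R e J)" "e (\<ominus> a) \<oplus>\<^bsub>transported R e J\<^esub> x = \<zero>\<^bsub>transported R e J\<^esub>"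
          using c by (auto simp: s l_neg)
        then show ?thesis by blast
      qed
    qed (auto simp: s c a_ac)
  qed (auto simp: is_cring s c J.I_l_closed l_distr r_distr m_assoc)
qed

text \<open>The copy of \<open>J\<close> in every degree, with identity and zero alternating as
  differentials. The inclusion of an ideal into the ring is no quasiisomorphism, but it becomes one
  between these exact complexes.\<close>

definition zigzag :: "('r, 'x) ring_scheme \<Rightarrow> ('r \<Rightarrow> 'm) \<Rightarrow> 'r set \<Rightarrow> ('r, 'm) cpx" where
  "zigzag R e J = \<lparr>obj = (\<lambda>i. transported R e J), bd = (\<lambda>i x. if even i then x else e \<zero>\<^bsub>R\<^esub>)\<rparr>"

lemma (in cring) zigzag_exact:
  assumes e: "inj_on e (carrier R)" and J: "ideal J R"
  shows "chain_complex R (zigzag R e J)" "cycles (zigzag R e J) i \<subseteq> boundaries (zigzag R e J) i"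
proof -
  interpret J: ideal J R by fact
  note s = transported_simps(1,2) transported_simps(3,4)[OF e]
  have bd: "bd (zigzag R e J) i \<in> mod_hom R (transported R e J) (transported R e J)" for i
    by (rule mod_homI) (auto simp: zigzag_def s J.I_l_closed J.Icarr)
  then show "chain_complex R (zigzag R e J)" using module_transported[OF assms]
    by (auto simp: chain_complex_def zigzag_def s)
  show "cycles (zigzag R e J) i \<subseteq> boundaries (zigzag R e J) i"
    by (cases "even i") (auto simp: cycles_def boundaries_def zigzag_def s)
qed

text \<open>Uses the surjectivity half of semiinjectivity: \<open>f\<close> extends from the copy of
  \<open>J\<close> to the copy of \<open>R\<close>, and the image of 1 is the element that Baer's
  test asks for.\<close>

lemma (in cring) semiinjective_baer:
  fixes E :: "('a, 'm) cpx"
  assumes E: "semiinjective R E" and "carrier R \<lesssim> (UNIV :: 'm set)"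
  shows "baer R (obj E k)"
  unfolding baer_def
proof (intro allI impI, elim conjE)
  fix J f assume J: "ideal J R" and f: "f \<in> J \<rightarrow> carrier (obj E k)"
    "\<forall>a\<in>J. \<forall>b\<in>J. f (a \<oplus> b) = f a \<oplus>\<^bsub>obj E k\<^esub> f b"
    "\<forall>r\<in>carrier R. \<forall>a\<in>J. f (r \<otimes> a) = r \<odot>\<^bsub>obj E k\<^esub> f a"
  obtain e :: "'a \<Rightarrow> 'm" where e: "inj_on e (carrier R)" using assms(2) by (auto simp: lepoll_def)
  interpret J: ideal J R by fact
  have E_cc: "chain_complex R E" using E by (simp add: semiinjective_def)
  note s = transported_simps(1,2) transported_simps(3,4)[OF e]
  let ?X = "zigzag R e J" and ?Y = "zigzag R e (carrier R)"
  note X = zigzag_exact[OF e J] and Y = zigzag_exact[OF e oneideal]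
  have o: "obj ?X i = transported R e J" "obj ?Y i = transported R e (carrier R)" for i
    by (simp_all add: zigzag_def)
  have "(\<lambda>x. x) \<in> mod_hom R (transported R e J) (transported R e (carrier R))"
    by (rule mod_homI) (auto simp: s J.Icarr)
  then have "chain_map R ?X ?Y (\<lambda>i x. x)"
    using X(1) Y(1) by (auto simp: chain_map_def o) (simp add: zigzag_def)
  then have "quasi_iso R ?X ?Y (\<lambda>i x. x)" using X(2) Y(2) by (rule quasi_iso_exact)
  moreover have "injective_map ?X (\<lambda>i x. x)" by (simp add: injective_map_def)
  ultimately have sur: "surjective_map (hom_complex R ?Y E) (hom_complex R ?X E) (hom_pullback ?X (\<lambda>i x. x))"
    using E unfolding semiinjective_def by blast
  \<comment> \<open>An element of degree \<open>k\<close> of the Hom complex is only a graded map,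
    so \<open>f\<close> may be placed in spot 0 with zero elsewhere, without regard to the
    differentials.\<close>
  define \<alpha> where "\<alpha> i = (\<lambda>x\<in>e ` J. if i = 0 then f (inv_into (carrier R) e x) else \<zero>\<^bsub>obj E (i + k)\<^esub>)" for i :: int
  have inv: "inv_into (carrier R) e (e a) = a" if "a \<in> J" for a using e J.Icarr[OF that] by simp
  have \<alpha>0: "\<alpha> 0 (e a) = f a" if "a \<in> J" for a using that by (simp add: \<alpha>_def inv)
  have "\<alpha> i \<in> mod_hom R (transported R e J) (obj E (i + k)) \<inter> extensional (e ` J)" for i
  proof (cases "i = 0")
    case True
    have "\<alpha> 0 \<in> mod_hom R (transported R e J) (obj E k)"
      using f by (intro mod_homI) (auto simp: \<alpha>0 s J.I_l_closed J.a_closed J.Icarr)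
    then show ?thesis using True by (simp add: \<alpha>_def)
  next
    case False
    interpret M: module R "obj E (i + k)" using chain_complexD(1)[OF E_cc] .
    have "\<alpha> i \<in> mod_hom R (transported R e J) (obj E (i + k))"
      using False by (intro mod_homI) (auto simp: \<alpha>_def s J.I_l_closed J.Icarr)
    then show ?thesis by (simp add: \<alpha>_def)
  qed
  then have "\<alpha> \<in> carrier (obj (hom_complex R ?X E) k)"
    by (simp add: hom_complex_def hom_component_def o s)
  then obtain \<beta> where \<beta>: "\<beta> \<in> carrier (obj (hom_complex R ?Y E) k)" "\<alpha> = hom_pullback ?X (\<lambda>i x. x) k \<beta>"
    using sur unfolding surjective_map_def by blast
  have \<beta>0: "\<beta> 0 \<in> mod_hom R (transported R e (carrier R)) (obj E k)"
    using \<beta>(1) by (auto simp: hom_complex_def hom_component_def o dest!: spec[of _ 0])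
  have "f a = a \<odot>\<^bsub>obj E k\<^esub> \<beta> 0 (e \<one>)" if a: "a \<in> J" for a
  proof -
    have "f a = \<alpha> 0 (e a)" using a by (simp add: \<alpha>0)
    also have "\<dots> = \<beta> 0 (e a)" using a by (simp add: \<beta>(2) hom_pullback_def o s)
    also have "e a = a \<odot>\<^bsub>transported R e (carrier R)\<^esub> e \<one>" using J.Icarr[OF a] by (simp add: s)
    also have "\<beta> 0 \<dots> = a \<odot>\<^bsub>obj E k\<^esub> \<beta> 0 (e \<one>)"
      using J.Icarr[OF a] by (intro mod_hom_smult[OF \<beta>0]) (auto simp: s)
    finally show ?thesis .
  qed
  moreover have "\<beta> 0 (e \<one>) \<in> carrier (obj E k)" by (rule mod_hom_closed[OF \<beta>0]) (simp add: s)
  ultimately show "\<exists>z\<in>carrier (obj E k). \<forall>a\<in>J. f a = a \<odot>\<^bsub>obj E k\<^esub> z" by blast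
qed

text \<open>
  The truncation \<open>T\<close> of \<open>E\<close> above an exact spot \<open>v\<close> is exact, so \<open>Hom(T, E)\<close> is exact and the
  inclusion \<open>T \<rightarrow> E\<close> is null-homotopic; the homotopy splits \<open>E\<^sub>v\<^sub>+\<^sub>1 \<rightarrow> Z\<^sub>v\<close>.
\<close>

lemma semiinjective_split:
  fixes E :: "('r, 'm) cpx"
  assumes E: "semiinjective R E" and ex: "\<And>i. i \<ge> v \<Longrightarrow> cycles E i \<subseteq> boundaries E i"
  shows "\<exists>h \<in> mod_hom R ((obj E v)\<lparr>carrier := cycles E v\<rparr>) (obj E (v + 1)).
    \<forall>x\<in>cycles E v. bd E (v + 1) (h x) = x"
proof -
  have E_cc: "chain_complex R E" using E by (simp add: semiinjective_def)
  note E_mod = chain_complexD(1)[OF E_cc] and E_bd = chain_complexD(2)[OF E_cc]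
  define H where "H i = (if i > v then carrier (obj E i) else if i = v then cycles E v else {\<zero>\<^bsub>obj E i\<^esub>})" for i
  define Sub where "Sub H' = \<lparr>obj = (\<lambda>i. (obj E i)\<lparr>carrier := H' i\<rparr>), bd = bd E\<rparr>" for H' :: "int \<Rightarrow> 'm set"
  let ?T = "Sub H" and ?O = "Sub (\<lambda>i. {\<zero>\<^bsub>obj E i\<^esub>})"
  have bd0: "bd E i \<zero>\<^bsub>obj E i\<^esub> = \<zero>\<^bsub>obj E (i - 1)\<^esub>" for i by (rule mod_hom_zero[OF E_bd E_mod E_mod])
  have zero_sub: "submodule {\<zero>\<^bsub>obj E i\<^esub>} R (obj E i)" for i
  proof -
    interpret M: module R "obj E i" by (rule E_mod)
    show ?thesis by (rule M.submoduleI) (auto simp: M.M.neg_zero)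
  qed
  have H_sub: "submodule (H i) R (obj E i)" for i
    unfolding H_def using zero_sub submodule_cycles[OF E_cc] module.carrier_is_submodule[OF E_mod] by simp
  have Sub_cc: "chain_complex R (Sub H')" if "\<And>i. submodule (H' i) R (obj E i)" "\<And>i x. x \<in> H' i \<Longrightarrow> bd E i x \<in> H' (i - 1)" for H'
  proof -
    have c: "H' i \<subseteq> carrier (obj E i)" for i using module.submoduleE(1)[OF E_mod that(1)] .
    have "bd E i \<in> mod_hom R ((obj E i)\<lparr>carrier := H' i\<rparr>) ((obj E (i - 1))\<lparr>carrier := H' (i - 1)\<rparr>)" for i
      using that(2) c mod_hom_add[OF E_bd, of _ i] mod_hom_smult[OF E_bd, of _ _ i]
      by (intro mod_homI) (auto simp: subset_iff)
    then show ?thesis using module_restrict[OF that(1) E_mod] c chain_complexD(3)[OF E_cc]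
      by (auto simp: chain_complex_def Sub_def subset_iff)
  qed
  have "bd E i x \<in> H (i - 1)" if x: "x \<in> H i" for i x
  proof -
    consider "i - 1 > v" | "i - 1 = v" | "i = v" | "i < v" by linarith
    then show ?thesis
    proof cases
      case 2
      then have "i = v + 1" by simp
      then show ?thesis using x chain_complex_bd_succ[OF E_cc, where i = v]
        by (auto simp: H_def cycles_def intro: mod_hom_closed)
    qed (use x bd0 mod_hom_closed[OF E_bd] in \<open>auto simp: H_def cycles_def\<close>)
  qed
  then have T_cc: "chain_complex R ?T" by (rule Sub_cc[OF H_sub])
  have O_cc: "chain_complex R ?O" by (rule Sub_cc[OF zero_sub]) (auto simp: bd0)
  have HE: "H i \<subseteq> carrier (obj E i)" for i using module.submoduleE(1)[OF E_mod H_sub] .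
  have H0: "\<zero>\<^bsub>obj E i\<^esub> \<in> H i" for i
    using subgroup.one_closed[OF submodule.axioms(1)[OF H_sub]] by simp
  have T_ex: "cycles ?T i \<subseteq> boundaries ?T i" for i
  proof
    fix x assume x: "x \<in> cycles ?T i"
    show "x \<in> boundaries ?T i"
    proof (cases "i \<ge> v")
      case True
      then have "x \<in> cycles E i" using x HE by (auto simp: cycles_def Sub_def)
      then have "x \<in> bd E (i + 1) ` carrier (obj E (i + 1))" using ex[OF True] by (auto simp: boundaries_def)
      then show ?thesis using True by (auto simp: boundaries_def Sub_def H_def)
    next
      case False
      then have "x = \<zero>\<^bsub>obj E i\<^esub>" using x by (auto simp: cycles_def Sub_def H_def)
      then have "x = bd E (i + 1) \<zero>\<^bsub>obj E (i + 1)\<^esub>" using bd0[of "i + 1"] by simp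
      then show ?thesis using H0 by (auto simp: boundaries_def Sub_def)
    qed
  qed
  have O_ex: "cycles ?O i \<subseteq> boundaries ?O i" for i
    using bd0[of "i + 1"] by (auto simp: cycles_def boundaries_def Sub_def)
  \<comment> \<open>Comparison of \<open>T\<close> with the zero complex, whose Hom complex is zero.
    Here the quasiisomorphism half of semiinjectivity is used.\<close>
  have "chain_map R ?O ?T (\<lambda>i x. x)"
    using O_cc T_cc H0 by (auto simp: chain_map_def Sub_def intro!: mod_homI)
  then have "quasi_iso R ?O ?T (\<lambda>i x. x)" using O_ex T_ex by (rule quasi_iso_exact)
  moreover have "injective_map ?O (\<lambda>i x. x)" by (simp add: injective_map_def)
  ultimately have q: "quasi_iso R (hom_complex R ?T E) (hom_complex R ?O E) (hom_pullback ?O (\<lambda>i x. x))"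
    using E unfolding semiinjective_def by blast
  note qc = chain_mapD[OF quasi_isoD(1)[OF q]]
  define \<alpha> where "\<alpha> i = (\<lambda>x\<in>H i. x)" for i
  have \<alpha>: "\<alpha> \<in> carrier (obj (hom_complex R ?T E) 0)"
    using HE by (auto simp: hom_complex_def hom_component_def Sub_def \<alpha>_def subset_iff mod_hom_def
        module.submoduleE(4,5)[OF E_mod H_sub])
  have "\<alpha> \<in> cycles (hom_complex R ?T E) 0"
  proof -
    have "bd E i x \<ominus>\<^bsub>obj E (i - 1)\<^esub> \<alpha> (i - 1) (bd E i x) = \<zero>\<^bsub>obj E (i - 1)\<^esub>" if "x \<in> H i" for i x
    proof -
      interpret M: module R "obj E (i - 1)" by (rule E_mod)
      have "bd E i x \<in> H (i - 1)" using chain_complexD(2)[OF T_cc, of i] that by (auto simp: Sub_def dest: mod_hom_closed)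
      then show ?thesis using HE by (auto simp: \<alpha>_def M.M.minus_eq M.M.r_neg subset_iff)
    qed
    then have "bd (hom_complex R ?T E) 0 \<alpha> = \<zero>\<^bsub>obj (hom_complex R ?T E) (0 - 1)\<^esub>"
      by (auto simp: hom_complex_def hom_component_def Sub_def \<alpha>_def fun_eq_iff restrict_def)
    then show ?thesis using \<alpha> by (simp add: cycles_def)
  qed
  moreover have "hom_pullback ?O (\<lambda>i x. x) 0 \<alpha> \<in> boundaries (hom_complex R ?O E) 0"
  proof -
    have "hom_pullback ?O (\<lambda>i x. x) 0 \<alpha> = \<zero>\<^bsub>obj (hom_complex R ?O E) 0\<^esub>"
      using H0 by (auto simp: hom_pullback_def hom_complex_def hom_component_def Sub_def \<alpha>_def fun_eq_iff restrict_def)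
    then show ?thesis
      using module.submoduleE(1,2)[OF chain_complexD(1)[OF qc(2)] submodule_boundaries[OF qc(2)], of 0]
        submodule.axioms(1)[OF submodule_boundaries[OF qc(2)], of 0] subgroup.one_closed by force
  qed
  ultimately have "\<alpha> \<in> boundaries (hom_complex R ?T E) 0" by (rule quasi_isoD(2)[OF q])
  then obtain \<beta> where \<beta>: "\<beta> \<in> carrier (obj (hom_complex R ?T E) 1)" "\<alpha> = bd (hom_complex R ?T E) 1 \<beta>"
    by (auto simp: boundaries_def)
  have \<beta>h: "\<beta> i \<in> mod_hom R ((obj E i)\<lparr>carrier := H i\<rparr>) (obj E (i + 1))" for i
    using \<beta>(1) by (auto simp: hom_complex_def hom_component_def Sub_def)
  \<comment> \<open>In the odd degree 1 the differential of the Hom complex has a plus sign, so the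
    inclusion is \<open>d \<beta> + \<beta> d\<close>; the second term vanishes on cycles.\<close>
  have "bd E (v + 1) (\<beta> v x) = x" if x: "x \<in> cycles E v" for x
  proof -
    interpret M: module R "obj E v" by (rule E_mod)
    interpret N: module R "(obj E (v - 1))\<lparr>carrier := H (v - 1)\<rparr>" by (rule module_restrict[OF H_sub E_mod])
    have xH: "x \<in> H v" using x by (simp add: H_def)
    have "\<beta> (v - 1) \<zero>\<^bsub>obj E (v - 1)\<^esub> = \<zero>\<^bsub>obj E v\<^esub>"
      using mod_hom_zero[OF \<beta>h[of "v - 1"] N.module_axioms E_mod] by simp
    moreover have "x = \<alpha> v x" using xH by (simp add: \<alpha>_def)
    moreover have "\<alpha> v x = bd E (v + 1) (\<beta> v x) \<oplus>\<^bsub>obj E v\<^esub> \<beta> (v - 1) (bd E v x)"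
      using xH unfolding \<beta>(2) by (simp add: hom_complex_def Sub_def)
    moreover have "bd E (v + 1) (\<beta> v x) \<in> carrier (obj E v)"
      using mod_hom_closed[OF chain_complex_bd_succ(1)[OF E_cc] mod_hom_closed[OF \<beta>h, of x v]] xH by simp
    ultimately show ?thesis using cyclesD(2)[OF x] by simp
  qed
  then show ?thesis using \<beta>h[of v] by (intro bexI[of _ "\<beta> v"]) (auto simp: H_def)
qed

section \<open>Acyclic modules and complexes\<close>

definition cycle_module :: "('r, 'm) cpx \<Rightarrow> int \<Rightarrow> ('r, 'm) module" where
  "cycle_module X i = (obj X i)\<lparr>carrier := cycles X i\<rparr>"

lemma module_cycle_module: "chain_complex R X \<Longrightarrow> module R (cycle_module X i)"
  unfolding cycle_module_def by (intro module_restrict submodule_cycles chain_complexD)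

context ideal_filtration
begin

section \<open>The torsion functor on modules and complexes\<close>

lemma submodule_torsion:
  assumes "module R M"
  shows "submodule (torsion M) R M"
proof -
  interpret M: module R M by fact
  show ?thesis
  proof (rule M.submoduleI)
    show "torsion M \<subseteq> carrier M" by (auto simp: torsion_def)
    show "\<zero>\<^bsub>M\<^esub> \<in> torsion M" using P_carrier by (auto simp: torsion_def)
    show "\<ominus>\<^bsub>M\<^esub> a \<in> torsion M" if "a \<in> torsion M" for a
      using that P_carrier by (force simp: torsion_def M.smult_r_minus M.M.neg_zero)
    show "a \<oplus>\<^bsub>M\<^esub> b \<in> torsion M" if a: "a \<in> torsion M" and b: "b \<in> torsion M" for a b
    proof -
      obtain n m where n: "\<And>r. r \<in> P n \<Longrightarrow> r \<odot>\<^bsub>M\<^esub> a = \<zero>\<^bsub>M\<^esub>" and m: "\<And>r. r \<in> P m \<Longrightarrow> r \<odot>\<^bsub>M\<^esub> b = \<zero>\<^bsub>M\<^esub>"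
        and ab: "a \<in> carrier M" "b \<in> carrier M" using a b by (auto simp: torsion_def)
      have "r \<odot>\<^bsub>M\<^esub> (a \<oplus>\<^bsub>M\<^esub> b) = \<zero>\<^bsub>M\<^esub>" if "r \<in> P (max n m)" for r
        using that n m ab P_antimono[of n "max n m"] P_antimono[of m "max n m"] P_carrier[OF that]
        by (auto simp: M.smult_r_distr subset_iff)
      then show ?thesis using ab by (auto simp: torsion_def)
    qed
    show "r \<odot>\<^bsub>M\<^esub> a \<in> torsion M" if r: "r \<in> carrier R" and a: "a \<in> torsion M" for r a
    proof -
      obtain n where n: "\<And>r. r \<in> P n \<Longrightarrow> r \<odot>\<^bsub>M\<^esub> a = \<zero>\<^bsub>M\<^esub>" and a': "a \<in> carrier M"
        using a by (auto simp: torsion_def)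
      have "s \<odot>\<^bsub>M\<^esub> (r \<odot>\<^bsub>M\<^esub> a) = \<zero>\<^bsub>M\<^esub>" if "s \<in> P n" for s
      proof -
        have "s \<odot>\<^bsub>M\<^esub> (r \<odot>\<^bsub>M\<^esub> a) = r \<odot>\<^bsub>M\<^esub> (s \<odot>\<^bsub>M\<^esub> a)"
          using r a' P_carrier[OF that] by (simp add: M.smult_assoc1[symmetric] m_comm)
        then show ?thesis using n[OF that] r by simp
      qed
      then show ?thesis using r a' by (auto simp: torsion_def)
    qed
  qed
qed

lemma torsion_hom:
  assumes "f \<in> mod_hom R M N" "module R M" "module R N" "x \<in> torsion M"
  shows "f x \<in> torsion N"
proof -
  obtain n where n: "x \<in> carrier M" "\<And>r. r \<in> P n \<Longrightarrow> r \<odot>\<^bsub>M\<^esub> x = \<zero>\<^bsub>M\<^esub>"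
    using assms(4) by (auto simp: torsion_def)
  have "r \<odot>\<^bsub>N\<^esub> f x = \<zero>\<^bsub>N\<^esub>" if "r \<in> P n" for r
    using mod_hom_smult[OF assms(1) P_carrier[OF that] n(1)] n(2)[OF that] mod_hom_zero[OF assms(1-3)] by simp
  then show ?thesis using mod_hom_closed[OF assms(1) n(1)] by (auto simp: torsion_def)
qed

definition gam :: "('r, 'm) cpx \<Rightarrow> ('r, 'm) cpx" where
  "gam X = X\<lparr>obj := (\<lambda>i. (obj X i)\<lparr>carrier := torsion (obj X i)\<rparr>)\<rparr>"

lemma gam_simps [simp]:
  "carrier (obj (gam X) i) = torsion (obj X i)" "\<zero>\<^bsub>obj (gam X) i\<^esub> = \<zero>\<^bsub>obj X i\<^esub>"
  "x \<oplus>\<^bsub>obj (gam X) i\<^esub> y = x \<oplus>\<^bsub>obj X i\<^esub> y" "r \<odot>\<^bsub>obj (gam X) i\<^esub> x = r \<odot>\<^bsub>obj X i\<^esub> x"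
  "bd (gam X) = bd X"
  by (auto simp: gam_def)

lemma torsion_carrier: "x \<in> torsion M \<Longrightarrow> x \<in> carrier M"
  by (simp add: torsion_def)

lemma chain_complex_gam:
  assumes "chain_complex R X"
  shows "chain_complex R (gam X)"
  unfolding chain_complex_def
proof (intro conjI allI ballI)
  note X = chain_complexD[OF assms]
  show "module R (obj (gam X) i)" for i
    using module_restrict[OF submodule_torsion[OF X(1)] X(1)] by (simp add: gam_def)
  show "bd (gam X) i \<in> mod_hom R (obj (gam X) i) (obj (gam X) (i - 1))" for i
    using mod_hom_add[OF X(2), of _ i] mod_hom_smult[OF X(2), of _ _ i] torsion_hom[OF X(2) X(1) X(1), of _ i]
    by (intro mod_homI) (auto simp: torsion_carrier)
  show "bd (gam X) (i - 1) (bd (gam X) i x) = \<zero>\<^bsub>obj (gam X) (i - 2)\<^esub>" if "x \<in> carrier (obj (gam X) i)" for i x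
    using X(3)[of x i] that by (simp add: torsion_carrier)
qed

lemma chain_map_gam:
  assumes "chain_map R X Y f"
  shows "chain_map R (gam X) (gam Y) f"
  unfolding chain_map_def
proof (intro conjI allI ballI)
  note f = chain_mapD[OF assms]
  note X = chain_complexD(1)[OF f(1)] and Y = chain_complexD(1)[OF f(2)]
  show "chain_complex R (gam X)" "chain_complex R (gam Y)" using f chain_complex_gam by auto
  show "f i \<in> mod_hom R (obj (gam X) i) (obj (gam Y) i)" for i
    using mod_hom_add[OF f(3), of _ i] mod_hom_smult[OF f(3), of _ _ i] torsion_hom[OF f(3) X Y, of _ i]
    by (intro mod_homI) (auto simp: torsion_carrier)
  show "f (i - 1) (bd (gam X) i x) = bd (gam Y) i (f i x)" if "x \<in> carrier (obj (gam X) i)" for i x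
    using f(4)[of x i] that by (simp add: torsion_carrier)
qed

lemma cycles_gam: "cycles (gam X) i = cycles X i \<inter> torsion (obj X i)"
  by (auto simp: cycles_def torsion_carrier)

lemma boundaries_gam: "boundaries (gam X) i = bd X (i + 1) ` torsion (obj X (i + 1))"
  by (simp add: boundaries_def)

text \<open>Left exactness of \<Gamma>: it commutes with kernels.\<close>

lemma torsion_cycle_module: "torsion (cycle_module X i) = cycles (gam X) i"
  by (auto simp: torsion_def cycle_module_def cycles_def)

text \<open>Exactness at \<open>i\<close> makes the differential surjective onto the cycles. Its
  kernel equals the next cycle module as a record, so that results about \<open>A\<close> rewrite
  directly.\<close>

lemma short_exact_cycles:
  assumes "chain_complex R X" "cycles X i \<subseteq> boundaries X i"
  shows "short_exact R P (obj X (i + 1)) (cycle_module X i) (bd X (i + 1))"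
    "short_exact.A (obj X (i + 1)) (cycle_module X i) (bd X (i + 1)) = cycle_module X (i + 1)"
proof -
  have b: "bd X (i + 1) ` carrier (obj X (i + 1)) = cycles X i"
    using boundaries_subset_cycles[OF assms(1), of i] assms(2) by (simp add: boundaries_def)
  then have "bd X (i + 1) \<in> mod_hom R (obj X (i + 1)) (cycle_module X i)"
    using chain_complex_bd_succ(1)[OF assms(1), of i] by (auto simp: mod_hom_def cycle_module_def)
  then show S: "short_exact R P (obj X (i + 1)) (cycle_module X i) (bd X (i + 1))"
    using b by (intro short_exact.intro ideal_filtration_axioms short_exact_axioms.intro
        module_cycle_module[OF assms(1)] chain_complexD(1)[OF assms(1)]) (simp_all add: cycle_module_def)
  show "short_exact.A (obj X (i + 1)) (cycle_module X i) (bd X (i + 1)) = cycle_module X (i + 1)"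
    unfolding short_exact.A_def[OF S] by (simp add: cycle_module_def cycles_def)
qed

lemma torsion_lift_cycles:
  assumes "chain_complex R X" "cycles X i \<subseteq> boundaries X i" "eff 0 (cycle_module X (i + 1))"
  shows "cycles (gam X) i \<subseteq> boundaries (gam X) i"
  using short_exact.torsion_lift[OF short_exact_cycles(1)[OF assms(1,2)]] assms(3)
  unfolding short_exact_cycles(2)[OF assms(1,2)] torsion_cycle_module boundaries_gam by blast

text \<open>Dimension shifting along \<open>0 \<rightarrow> Z\<^sub>i \<rightarrow> F\<^sub>i \<rightarrow> Z\<^sub>i\<^sub>-\<^sub>1 \<rightarrow> 0\<close>.\<close>

lemma eff_cycles_resolution:
  assumes "chain_complex R F" "\<And>i. baer R (obj F i)"
    and "\<And>i. i < 0 \<Longrightarrow> cycles F i \<subseteq> boundaries F i"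
    and "\<And>i. i < 0 \<Longrightarrow> cycles (gam F) i \<subseteq> boundaries (gam F) i"
    and "i \<le> 0"
  shows "eff j (cycle_module F i)"
  using assms(5)
proof (induction j arbitrary: i)
  case 0
  have i: "i - 1 < 0" using 0 by simp
  note S = short_exact_cycles[OF assms(1) assms(3)[OF i]]
  \<comment> \<open>Exactness of the torsion complex in negative degrees is the surjectivity that
    \<open>eff_kernel_0\<close> demands.\<close>
  have "\<exists>b\<in>torsion (obj F (i - 1 + 1)). bd F (i - 1 + 1) b = x" if "x \<in> torsion (cycle_module F (i - 1))" for x
    using that assms(4)[OF i] unfolding torsion_cycle_module boundaries_gam by blast
  from short_exact.eff_kernel_0[OF S(1) this eff_baer[OF chain_complexD(1)[OF assms(1)] assms(2)]]
  show ?case unfolding S(2) by simp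
next
  case (Suc j)
  have i: "i - 1 < 0" using Suc.prems by simp
  note S = short_exact_cycles[OF assms(1) assms(3)[OF i]]
  \<comment> \<open>One cohomological degree more for degree \<open>i\<close> costs one step down in
    the complex, hence the induction over \<open>j\<close> with \<open>i\<close> arbitrary.\<close>
  have "eff j (cycle_module F (i - 1))" using Suc by simp
  from short_exact.eff_kernel[OF S(1) this eff_baer[OF chain_complexD(1)[OF assms(1)] assms(2)]]
  show ?case unfolding S(2) by simp
qed

text \<open>Translates acyclicity by a resolution into \<open>eff\<close>. As \<open>F\<close> may
  be nonzero in positive degrees, \<open>N\<close> need not be all of the cycles in degree 0. It is
  a retract of them: every cycle differs from exactly one \<open>\<iota> 0 x\<close> by a boundary,
  and sending it to \<open>x\<close> is the retraction \<open>p\<close>.\<close>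

lemma eff_resolution:
  assumes N: "module R N" and q: "quasi_iso R (stalk_complex N) F \<iota>"
    and inj: "\<And>i. baer R (obj F i)"
    and tor: "\<And>i. i < 0 \<Longrightarrow> cycles (gam F) i \<subseteq> boundaries (gam F) i"
  shows "eff j N"
proof -
  note c = chain_mapD[OF quasi_isoD(1)[OF q]]
  note F = chain_complexD(1)[OF c(2)]
  interpret N: module R N by (rule N)
  interpret F0: module R "obj F 0" by (rule F)
  have st: "obj (stalk_complex N) 0 = N" "cycles (stalk_complex N) 0 = carrier N" "boundaries (stalk_complex N) 0 = {\<zero>\<^bsub>N\<^esub>}"
    by (auto simp: stalk_complex_def cycles_def boundaries_def)
  have \<iota>0: "\<iota> 0 \<in> mod_hom R N (obj F 0)" using c(3)[of 0] by (simp add: st)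
  note B = module.submoduleE[OF F submodule_boundaries[OF c(2), of 0]]
  have ex: "cycles F i \<subseteq> boundaries F i" if "i < 0" for i
  proof
    fix y assume y: "y \<in> cycles F i"
    interpret Fi: module R "obj F i" by (rule F)
    obtain x where x: "x \<in> cycles (stalk_complex N) i" "y \<ominus>\<^bsub>obj F i\<^esub> \<iota> i x \<in> boundaries F i"
      using quasi_isoD(3)[OF q y] by blast
    have "x = \<zero>\<^bsub>obj (stalk_complex N) i\<^esub>" using x(1) that by (auto simp: cycles_def stalk_complex_def)
    then show "y \<in> boundaries F i"
      using x(2) mod_hom_zero[OF c(3) chain_complexD(1)[OF c(1)] F, of i] cyclesD(1)[OF y] by (simp add: Fi.M.diff_zero)
  qed
  have \<iota>Z: "\<iota> 0 x \<in> cycles F 0" if "x \<in> carrier N" for x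
    using c(4)[of x 0] that mod_hom_closed[OF \<iota>0 that] mod_hom_zero[OF c(3) chain_complexD(1)[OF c(1)] F, of "-1"]
    by (simp add: cycles_def stalk_complex_def)
  have uniq: "x = y" if "x \<in> carrier N" "y \<in> carrier N" "z \<in> carrier (obj F 0)"
    "z \<ominus>\<^bsub>obj F 0\<^esub> \<iota> 0 x \<in> boundaries F 0" "z \<ominus>\<^bsub>obj F 0\<^esub> \<iota> 0 y \<in> boundaries F 0" for x y z
  proof -
    have cancel: "u \<oplus>\<^bsub>obj F 0\<^esub> (v \<oplus>\<^bsub>obj F 0\<^esub> (\<ominus>\<^bsub>obj F 0\<^esub> u \<oplus>\<^bsub>obj F 0\<^esub> w)) = v \<oplus>\<^bsub>obj F 0\<^esub> w"
      if "u \<in> carrier (obj F 0)" "v \<in> carrier (obj F 0)" "w \<in> carrier (obj F 0)" for u v w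
      using that F0.M.a_lcomm[of u v "\<ominus>\<^bsub>obj F 0\<^esub> u \<oplus>\<^bsub>obj F 0\<^esub> w"] by (simp add: F0.M.r_neg2)
    note cl = mod_hom_closed[OF \<iota>0 that(1)] mod_hom_closed[OF \<iota>0 that(2)]
    have "\<iota> 0 (x \<ominus>\<^bsub>N\<^esub> y) = (z \<ominus>\<^bsub>obj F 0\<^esub> \<iota> 0 y) \<oplus>\<^bsub>obj F 0\<^esub> \<ominus>\<^bsub>obj F 0\<^esub> (z \<ominus>\<^bsub>obj F 0\<^esub> \<iota> 0 x)"
      using cl that(1-3) by (simp add: mod_hom_diff[OF \<iota>0 N F] F0.M.minus_eq F0.M.minus_add F0.M.a_ac F0.M.r_neg2 cancel)
    then have "\<iota> 0 (x \<ominus>\<^bsub>N\<^esub> y) \<in> boundaries F 0" using B(5)[OF that(5) B(3)[OF that(4)]] by simp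
    then have "x \<ominus>\<^bsub>N\<^esub> y = \<zero>\<^bsub>N\<^esub>" using quasi_isoD(2)[OF q, of "x \<ominus>\<^bsub>N\<^esub> y" 0] that(1,2) by (simp add: st)
    then show ?thesis using that(1,2) by (rule N.M.diff_eq_zeroD)
  qed
  define p where "p z = (SOME x. x \<in> carrier N \<and> z \<ominus>\<^bsub>obj F 0\<^esub> \<iota> 0 x \<in> boundaries F 0)" for z
  have p: "p z \<in> carrier N \<and> z \<ominus>\<^bsub>obj F 0\<^esub> \<iota> 0 (p z) \<in> boundaries F 0" if "z \<in> cycles F 0" for z
    unfolding p_def using quasi_isoD(3)[OF q that] unfolding st Bex_def by (rule someI_ex)
  have p_eq: "p z = x" if "z \<in> cycles F 0" "x \<in> carrier N" "z \<ominus>\<^bsub>obj F 0\<^esub> \<iota> 0 x \<in> boundaries F 0" for z x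
    using uniq[of "p z" x z] p[OF that(1)] that cyclesD(1)[OF that(1)] by simp
  note Z = module.submoduleE[OF F submodule_cycles[OF c(2), of 0]]
  have "p \<in> mod_hom R (cycle_module F 0) N"
  proof (rule mod_homI; simp add: cycle_module_def)
    show "p x \<in> carrier N" if "x \<in> cycles F 0" for x using p that by blast
    fix x y assume xy: "x \<in> cycles F 0" "y \<in> cycles F 0"
    note cl = cyclesD(1)[OF xy(1)] cyclesD(1)[OF xy(2)] mod_hom_closed[OF \<iota>0, of "p x"] mod_hom_closed[OF \<iota>0, of "p y"]
    have "(x \<oplus>\<^bsub>obj F 0\<^esub> y) \<ominus>\<^bsub>obj F 0\<^esub> \<iota> 0 (p x \<oplus>\<^bsub>N\<^esub> p y) =
      (x \<ominus>\<^bsub>obj F 0\<^esub> \<iota> 0 (p x)) \<oplus>\<^bsub>obj F 0\<^esub> (y \<ominus>\<^bsub>obj F 0\<^esub> \<iota> 0 (p y))"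
      using cl p[OF xy(1)] p[OF xy(2)] by (simp add: mod_hom_add[OF \<iota>0] F0.M.minus_eq F0.M.minus_add F0.M.a_ac)
    then show "p (x \<oplus>\<^bsub>obj F 0\<^esub> y) = p x \<oplus>\<^bsub>N\<^esub> p y"
      using xy p[OF xy(1)] p[OF xy(2)] Z(5) B(5) by (intro p_eq) auto
  next
    fix r x assume r: "r \<in> carrier R" and x: "x \<in> cycles F 0"
    have "(r \<odot>\<^bsub>obj F 0\<^esub> x) \<ominus>\<^bsub>obj F 0\<^esub> \<iota> 0 (r \<odot>\<^bsub>N\<^esub> p x) = r \<odot>\<^bsub>obj F 0\<^esub> (x \<ominus>\<^bsub>obj F 0\<^esub> \<iota> 0 (p x))"
      using r p[OF x] cyclesD(1)[OF x] mod_hom_closed[OF \<iota>0, of "p x"]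
      by (simp add: mod_hom_smult[OF \<iota>0] F0.M.minus_eq F0.smult_r_distr F0.smult_r_minus)
    then show "p (r \<odot>\<^bsub>obj F 0\<^esub> x) = r \<odot>\<^bsub>N\<^esub> p x"
      using r x p[OF x] Z(4) B(4) by (intro p_eq) auto
  qed
  moreover have "\<iota> 0 \<in> mod_hom R N (cycle_module F 0)"
    using \<iota>0 \<iota>Z by (auto simp: mod_hom_def cycle_module_def)
  moreover have "p (\<iota> 0 x) = x" if "x \<in> carrier N" for x
  proof (rule p_eq[OF \<iota>Z[OF that] that])
    have "\<zero>\<^bsub>obj F 0\<^esub> \<in> boundaries F 0" using subgroup.one_closed[OF submodule.axioms(1)[OF submodule_boundaries[OF c(2), of 0]]] by simp
    then show "\<iota> 0 x \<ominus>\<^bsub>obj F 0\<^esub> \<iota> 0 x \<in> boundaries F 0"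
      using mod_hom_closed[OF \<iota>0 that] by (simp add: F0.M.minus_eq F0.M.r_neg)
  qed
  moreover have "eff j (cycle_module F 0)"
    by (rule eff_cycles_resolution[OF c(2) inj ex tor]) auto
  ultimately show ?thesis using eff_retract[OF _ _ _ N module_cycle_module[OF c(2)]] by blast
qed

text \<open>\<open>eff_image\<close> turns \<open>Suc j\<close> in one degree into \<open>j\<close>
  in the degree below, so vanishing for all \<open>j\<close> from \<open>s\<close> upwards is
  propagated downwards; \<open>k\<close> counts the steps below \<open>s\<close>.\<close>

lemma torsion_exact:
  assumes "chain_complex R K" "\<And>i. cycles K i \<subseteq> boundaries K i" "\<And>i j. eff j (obj K i)"
    and "\<And>i j. i \<ge> s \<Longrightarrow> eff j (cycle_module K i)"
  shows "cycles (gam K) i \<subseteq> boundaries (gam K) i"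
proof -
  have down: "eff j (cycle_module K (s - int k))" for j k
  proof (induction k arbitrary: j)
    case (Suc k)
    note S = short_exact_cycles[OF assms(1,2), of "s - int (Suc k)"]
    have "eff (Suc j) (cycle_module K (s - int (Suc k) + 1))" using Suc[of "Suc j"] by (simp add: algebra_simps)
    then show ?case using short_exact.eff_image[OF S(1), of j] assms(3) unfolding S(2) by blast
  qed (use assms(4) in simp)
  have "eff j (cycle_module K i)" for i j
    using down[of j "nat (s - i)"] assms(4)[of i j] by (cases "i \<ge> s") auto
  then show ?thesis by (rule torsion_lift_cycles[OF assms(1,2)])
qed

end

section \<open>The mapping cone\<close>

text \<open>The cone lives over the product type, outside the universe of the resolutions;
  \<open>eff\<close> is meaningful there because it mentions no injective modules.\<close>

definition cone :: "('r, 'm) cpx \<Rightarrow> ('r, 'n) cpx \<Rightarrow> (int \<Rightarrow> 'm \<Rightarrow> 'n) \<Rightarrow> ('r, 'm \<times> 'n) cpx" where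
  "cone X Y f = \<lparr>obj = (\<lambda>i. prod_module (obj X (i - 1)) (obj Y i)),
    bd = (\<lambda>i x. (\<ominus>\<^bsub>obj X (i - 2)\<^esub> bd X (i - 1) (fst x), f (i - 1) (fst x) \<oplus>\<^bsub>obj Y (i - 1)\<^esub> bd Y i (snd x)))\<rparr>"

lemma cone_simps [simp]:
  "obj (cone X Y f) i = prod_module (obj X (i - 1)) (obj Y i)"
  "bd (cone X Y f) i x = (\<ominus>\<^bsub>obj X (i - 2)\<^esub> bd X (i - 1) (fst x), f (i - 1) (fst x) \<oplus>\<^bsub>obj Y (i - 1)\<^esub> bd Y i (snd x))"
  by (simp_all add: cone_def)

lemma chain_complex_cone:
  assumes "chain_map R X Y f"
  shows "chain_complex R (cone X Y f)"
proof -
  note f = chain_mapD[OF assms]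
  note X = chain_complexD[OF f(1)] and Y = chain_complexD[OF f(2)]
  have bd: "bd (cone X Y f) i \<in> mod_hom R (obj (cone X Y f) i) (obj (cone X Y f) (i - 1))" for i
  proof -
    interpret X': module R "obj X (i - 2)" by (rule X)
    interpret Y': module R "obj Y (i - 1)" by (rule Y)
    have dX: "bd X (i - 1) \<in> mod_hom R (obj X (i - 1)) (obj X (i - 2))" using X(2)[of "i - 1"] by simp
    note cl = mod_hom_closed[OF dX] mod_hom_closed[OF f(3), of _ "i - 1"] mod_hom_closed[OF Y(2), of _ i]
    show ?thesis
      by (rule mod_homI)
        (auto simp: cl mod_hom_add[OF dX] mod_hom_add[OF f(3)] mod_hom_add[OF Y(2)]
          mod_hom_smult[OF dX] mod_hom_smult[OF f(3)] mod_hom_smult[OF Y(2)]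
          X'.M.minus_add X'.smult_r_minus Y'.smult_r_distr Y'.M.a_ac)
  qed
  have "bd (cone X Y f) (i - 1) (bd (cone X Y f) i x) = \<zero>\<^bsub>obj (cone X Y f) (i - 2)\<^esub>"
    if x: "x \<in> carrier (obj (cone X Y f) i)" for i x
  proof -
    obtain a b where ab: "x = (a, b)" "a \<in> carrier (obj X (i - 1))" "b \<in> carrier (obj Y i)"
      using x by auto
    interpret X3: module R "obj X (i - 3)" by (rule X)
    interpret Y2: module R "obj Y (i - 2)" by (rule Y)
    have dX: "bd X (i - 1) \<in> mod_hom R (obj X (i - 1)) (obj X (i - 2))" using X(2)[of "i - 1"] by simp
    have dX2: "bd X (i - 2) \<in> mod_hom R (obj X (i - 2)) (obj X (i - 3))" using X(2)[of "i - 2"] by simp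
    have dY: "bd Y (i - 1) \<in> mod_hom R (obj Y (i - 1)) (obj Y (i - 2))" using Y(2)[of "i - 1"] by simp
    have da: "bd X (i - 1) a \<in> carrier (obj X (i - 2))" by (rule mod_hom_closed[OF dX ab(2)])
    have fa: "f (i - 1) a \<in> carrier (obj Y (i - 1))" by (rule mod_hom_closed[OF f(3) ab(2)])
    have db: "bd Y i b \<in> carrier (obj Y (i - 1))" by (rule mod_hom_closed[OF Y(2) ab(3)])
    have 1: "bd X (i - 2) (bd X (i - 1) a) = \<zero>\<^bsub>obj X (i - 3)\<^esub>" using X(3)[OF ab(2)] by simp
    have 2: "f (i - 2) (bd X (i - 1) a) = bd Y (i - 1) (f (i - 1) a)" using f(4)[OF ab(2)] by simp
    have 3: "bd Y (i - 1) (bd Y i b) = \<zero>\<^bsub>obj Y (i - 2)\<^esub>" by (rule Y(3)[OF ab(3)])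
    show ?thesis using da fa db 1 2 3 mod_hom_closed[OF dY fa]
      by (simp add: ab(1) mod_hom_neg[OF dX2 X(1) X(1)] mod_hom_neg[OF f(3) X(1) Y(1)] mod_hom_add[OF dY]
          X3.M.neg_zero Y2.M.l_neg)
  qed
  then show ?thesis unfolding chain_complex_def using bd module_prod_module[OF X(1) Y(1)] by simp
qed

lemma cone_exact:
  assumes "quasi_iso R X Y f"
  shows "cycles (cone X Y f) i \<subseteq> boundaries (cone X Y f) i"
proof
  fix x assume x: "x \<in> cycles (cone X Y f) i"
  note f = chain_mapD[OF quasi_isoD(1)[OF assms]]
  note X = chain_complexD[OF f(1)] and Y = chain_complexD[OF f(2)]
  interpret X1: module R "obj X (i - 1)" by (rule X)
  interpret X2: module R "obj X (i - 2)" by (rule X)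
  interpret Y1: module R "obj Y (i - 1)" by (rule Y)
  interpret Y0: module R "obj Y i" by (rule Y)
  interpret X0: module R "obj X i" by (rule X)
  obtain a b where ab: "x = (a, b)" "a \<in> carrier (obj X (i - 1))" "b \<in> carrier (obj Y i)"
    "\<ominus>\<^bsub>obj X (i - 2)\<^esub> bd X (i - 1) a = \<zero>\<^bsub>obj X (i - 2)\<^esub>"
    "f (i - 1) a \<oplus>\<^bsub>obj Y (i - 1)\<^esub> bd Y i b = \<zero>\<^bsub>obj Y (i - 1)\<^esub>"
    using x by (cases x) (auto simp: cycles_def)
  have dX: "bd X (i - 1) \<in> mod_hom R (obj X (i - 1)) (obj X (i - 2))" using X(2)[of "i - 1"] by simp
  have da: "bd X (i - 1) a \<in> carrier (obj X (i - 2))" by (rule mod_hom_closed[OF dX ab(2)])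
  have fa: "f (i - 1) a \<in> carrier (obj Y (i - 1))" by (rule mod_hom_closed[OF f(3) ab(2)])
  have db: "bd Y i b \<in> carrier (obj Y (i - 1))" by (rule mod_hom_closed[OF Y(2) ab(3)])
  have "bd X (i - 1) a = \<zero>\<^bsub>obj X (i - 2)\<^esub>" using ab(4) da by (metis X2.M.minus_minus X2.M.neg_zero)
  then have aZ: "a \<in> cycles X (i - 1)" using ab(2) by (simp add: cycles_def)
  have "f (i - 1) a = \<ominus>\<^bsub>obj Y (i - 1)\<^esub> bd Y i b" using ab(5) fa db by (metis Y1.M.minus_equality)
  also have "\<dots> = bd Y i (\<ominus>\<^bsub>obj Y i\<^esub> b)" by (rule mod_hom_neg[OF Y(2) Y(1) Y(1) ab(3), symmetric])
  finally have "f (i - 1) a \<in> boundaries Y (i - 1)" using ab(3) by (simp add: boundaries_def)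
  then have "a \<in> boundaries X (i - 1)" by (rule quasi_isoD(2)[OF assms aZ])
  then obtain a' where a': "a' \<in> carrier (obj X i)" "a = bd X i a'" by (auto simp: boundaries_def)
  have fa': "f i a' \<in> carrier (obj Y i)" by (rule mod_hom_closed[OF f(3) a'(1)])
  have fe: "f (i - 1) a = bd Y i (f i a')" using f(4)[OF a'(1)] a'(2) by simp
  \<comment> \<open>Injectivity on homology has given \<open>a = d a'\<close>. Replacing
    \<open>b\<close> by this sum yields a cycle of \<open>Y\<close>, to which surjectivity on
    homology applies.\<close>
  have "f i a' \<oplus>\<^bsub>obj Y i\<^esub> b \<in> cycles Y i"
    using fa' ab(3,5) fe by (simp add: cycles_def mod_hom_add[OF Y(2)])
  from quasi_isoD(3)[OF assms this] obtain c e where c: "c \<in> cycles X i" "e \<in> carrier (obj Y (i + 1))"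
    "(f i a' \<oplus>\<^bsub>obj Y i\<^esub> b) \<ominus>\<^bsub>obj Y i\<^esub> f i c = bd Y (i + 1) e" by (auto simp: boundaries_def)
  have cX: "c \<in> carrier (obj X i)" "bd X i c = \<zero>\<^bsub>obj X (i - 1)\<^esub>" using cyclesD[OF c(1)] by auto
  have fc: "f i c \<in> carrier (obj Y i)" by (rule mod_hom_closed[OF f(3) cX(1)])
  have de: "bd Y (i + 1) e \<in> carrier (obj Y i)" by (rule mod_hom_closed[OF chain_complex_bd_succ(1)[OF f(2)] c(2)])
  \<comment> \<open>The sign of the differential on the first component turns \<open>c - a'\<close>
    into \<open>a\<close>; the second component is arranged so that both images under
    \<open>f\<close> cancel.\<close>
  let ?y = "(c \<ominus>\<^bsub>obj X i\<^esub> a', e)"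
  have 1: "bd X i (c \<ominus>\<^bsub>obj X i\<^esub> a') = \<ominus>\<^bsub>obj X (i - 1)\<^esub> a"
    using mod_hom_diff[OF X(2) X(1) X(1) cX(1) a'(1)] cX(2) a'(2) ab(2) by (simp add: X1.M.minus_eq)
  have "f i (c \<ominus>\<^bsub>obj X i\<^esub> a') \<oplus>\<^bsub>obj Y i\<^esub> bd Y (i + 1) e =
    (f i c \<ominus>\<^bsub>obj Y i\<^esub> f i a') \<oplus>\<^bsub>obj Y i\<^esub> ((f i a' \<oplus>\<^bsub>obj Y i\<^esub> b) \<ominus>\<^bsub>obj Y i\<^esub> f i c)"
    using mod_hom_diff[OF f(3) X(1) Y(1) cX(1) a'(1)] c(3) by simp
  also have "\<dots> = b" using fc fa' ab(3)
    by (simp add: Y0.M.minus_eq Y0.M.a_ac Y0.M.r_neg Y0.M.r_neg1 Y0.M.r_neg2)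
  finally have "bd (cone X Y f) (i + 1) ?y = x" using 1 ab(1,2) by simp
  moreover have "?y \<in> carrier (obj (cone X Y f) (i + 1))" using cX a' c by simp
  ultimately show "x \<in> boundaries (cone X Y f) i" unfolding boundaries_def by blast
qed

lemma (in ideal_filtration) torsion_prod_module:
  assumes "module R M" "module R N"
  shows "torsion (prod_module M N) = torsion M \<times> torsion N"
proof -
  have "(a, b) \<in> torsion (prod_module M N)" if ab: "a \<in> torsion M" "b \<in> torsion N" for a b
  proof -
    obtain n m where n: "\<And>r. r \<in> P n \<Longrightarrow> r \<odot>\<^bsub>M\<^esub> a = \<zero>\<^bsub>M\<^esub>" and m: "\<And>r. r \<in> P m \<Longrightarrow> r \<odot>\<^bsub>N\<^esub> b = \<zero>\<^bsub>N\<^esub>"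
      and c: "a \<in> carrier M" "b \<in> carrier N" using ab by (auto simp: torsion_def)
    have "\<forall>r\<in>P (max n m). r \<odot>\<^bsub>M\<^esub> a = \<zero>\<^bsub>M\<^esub> \<and> r \<odot>\<^bsub>N\<^esub> b = \<zero>\<^bsub>N\<^esub>"
      using n m P_antimono[of n "max n m"] P_antimono[of m "max n m"] by (auto simp: subset_iff)
    then show ?thesis using c unfolding torsion_def by auto
  qed
  moreover have "fst c \<in> torsion M" "snd c \<in> torsion N" if "c \<in> torsion (prod_module M N)" for c
    using that assms module_prod_module[OF assms]
    by (auto intro!: torsion_hom[of _ "prod_module M N"] mod_homI)
  ultimately show ?thesis by (metis (no_types, lifting) SigmaE SigmaI equalityI prod.collapse subsetI)
qed

text \<open>Torsion commutes with finite products, so the torsion of the cone is the cone of the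
  torsion map. For injectivity on homology, \<open>f x = d e\<close> makes \<open>(x, -e)\<close> a
  cycle of degree \<open>i + 1\<close>; for surjectivity, a cycle \<open>y\<close> gives the cycle
  \<open>(0, y)\<close>. Exactness turns both into boundaries.\<close>

lemma (in ideal_filtration) quasi_iso_gam:
  assumes f: "chain_map R X Y f" and ex: "\<And>i. cycles (gam (cone X Y f)) i \<subseteq> boundaries (gam (cone X Y f)) i"
  shows "quasi_iso R (gam X) (gam Y) f"
  unfolding quasi_iso_iff[OF chain_map_gam[OF f]]
proof (intro allI conjI ballI impI)
  note c = chain_mapD[OF f]
  note X = chain_complexD[OF c(1)] and Y = chain_complexD[OF c(2)]
  note GY = chain_complexD[OF chain_complex_gam[OF c(2)]]
  note tor = torsion_prod_module[OF X(1) Y(1)]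
  fix i
  interpret Xm: module R "obj X (i - 1)" by (rule X)
  interpret Y: module R "obj Y i" by (rule Y)
  interpret Yp: module R "obj Y (i + 1)" by (rule Y)
  {
    fix x assume x: "x \<in> cycles (gam X) i" "f i x \<in> boundaries (gam Y) i"
    then obtain e where e: "e \<in> torsion (obj Y (i + 1))" "f i x = bd Y (i + 1) e" by (auto simp: boundaries_gam)
    have x': "x \<in> torsion (obj X i)" "bd X i x = \<zero>\<^bsub>obj X (i - 1)\<^esub>" "x \<in> carrier (obj X i)"
      using x(1) by (auto simp: cycles_gam dest: cyclesD)
    have me: "\<ominus>\<^bsub>obj Y (i + 1)\<^esub> e \<in> torsion (obj Y (i + 1))"
      by (rule Yp.submoduleE(3)[OF submodule_torsion[OF Y(1)] e(1)])
    have fx: "f i x \<in> carrier (obj Y i)" by (rule mod_hom_closed[OF c(3) x'(3)])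
    have "(x, \<ominus>\<^bsub>obj Y (i + 1)\<^esub> e) \<in> cycles (gam (cone X Y f)) (i + 1)"
      using x' me e fx mod_hom_neg[OF chain_complex_bd_succ(1)[OF c(2)] Y(1) Y(1) torsion_carrier[OF e(1)]]
      by (simp add: cycles_def tor Xm.M.neg_zero Y.M.r_neg)
    then have "(x, \<ominus>\<^bsub>obj Y (i + 1)\<^esub> e) \<in> boundaries (gam (cone X Y f)) (i + 1)" using ex by blast
    then obtain w where w: "w \<in> torsion (obj (cone X Y f) (i + 1 + 1))"
      "(x, \<ominus>\<^bsub>obj Y (i + 1)\<^esub> e) = bd (cone X Y f) (i + 1 + 1) w" unfolding boundaries_gam by blast
    define a where "a = fst w"
    have idx: "i + 1 + 1 - 1 = i + 1" "i + 1 + 1 - 2 = i" by simp_all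
    have a: "a \<in> torsion (obj X (i + 1))" "x = \<ominus>\<^bsub>obj X i\<^esub> bd X (i + 1) a"
      using w unfolding cone_simps tor idx by (auto simp only: a_def mem_Times_iff prod.inject)
    interpret Xp: module R "obj X (i + 1)" by (rule X)
    have "x = bd X (i + 1) (\<ominus>\<^bsub>obj X (i + 1)\<^esub> a)"
      using a mod_hom_neg[OF chain_complex_bd_succ(1)[OF c(1)] X(1) X(1) torsion_carrier[OF a(1)]] by simp
    moreover have "\<ominus>\<^bsub>obj X (i + 1)\<^esub> a \<in> torsion (obj X (i + 1))"
      by (rule Xp.submoduleE(3)[OF submodule_torsion[OF X(1)] a(1)])
    ultimately show "x \<in> boundaries (gam X) i" by (auto simp: boundaries_gam)
  next
    fix y assume y: "y \<in> cycles (gam Y) i"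
    have y': "y \<in> torsion (obj Y i)" "bd Y i y = \<zero>\<^bsub>obj Y (i - 1)\<^esub>" "y \<in> carrier (obj Y i)"
      using y by (auto simp: cycles_gam dest: cyclesD)
    have z: "\<zero>\<^bsub>obj X (i - 1)\<^esub> \<in> torsion (obj X (i - 1))"
      using subgroup.one_closed[OF submodule.axioms(1)[OF submodule_torsion[OF X(1)]]] by simp
    interpret Ym: module R "obj Y (i - 1)" by (rule Y)
    interpret Xmm: module R "obj X (i - 2)" by (rule X)
    have d0: "bd X (i - 1) \<zero>\<^bsub>obj X (i - 1)\<^esub> = \<zero>\<^bsub>obj X (i - 2)\<^esub>"
      using mod_hom_zero[OF X(2) X(1) X(1), of "i - 1"] by simp
    have "(\<zero>\<^bsub>obj X (i - 1)\<^esub>, y) \<in> cycles (gam (cone X Y f)) i"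
      using y' z d0 mod_hom_zero[OF c(3) X(1) Y(1), of "i - 1"]
      by (simp add: cycles_def tor Xmm.M.neg_zero)
    then have "(\<zero>\<^bsub>obj X (i - 1)\<^esub>, y) \<in> boundaries (gam (cone X Y f)) i" using ex by blast
    then obtain a e where a: "a \<in> torsion (obj X i)" "e \<in> torsion (obj Y (i + 1))"
      "\<zero>\<^bsub>obj X (i - 1)\<^esub> = \<ominus>\<^bsub>obj X (i - 1)\<^esub> bd X i a" "y = f i a \<oplus>\<^bsub>obj Y i\<^esub> bd Y (i + 1) e"
      by (auto simp: boundaries_gam tor)
    have aX: "a \<in> carrier (obj X i)" by (rule torsion_carrier[OF a(1)])
    have "bd X i a = \<zero>\<^bsub>obj X (i - 1)\<^esub>"
      using a(3) mod_hom_closed[OF X(2) aX] by (metis Xm.M.minus_minus Xm.M.neg_zero)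
    then have aZ: "a \<in> cycles (gam X) i" using a(1) aX by (simp add: cycles_def)
    interpret GY: module R "obj (gam Y) i" by (rule GY)
    have t: "f i a \<in> torsion (obj Y i)" "bd Y (i + 1) e \<in> torsion (obj Y i)"
      using torsion_hom[OF c(3) X(1) Y(1) a(1)] torsion_hom[OF chain_complex_bd_succ(1)[OF c(2)] Y(1) Y(1) a(2)] by auto
    have "y = f i a \<oplus>\<^bsub>obj (gam Y) i\<^esub> bd Y (i + 1) e" using a(4) by simp
    then have "y \<ominus>\<^bsub>obj (gam Y) i\<^esub> f i a = bd Y (i + 1) e"
      using t by (simp add: GY.M.minus_eq del: gam_simps(3)) (metis GY.M.a_comm GY.M.a_assoc GY.M.r_neg GY.M.r_zero GY.M.a_inv_closed gam_simps(1))
    then show "\<exists>x\<in>cycles (gam X) i. y \<ominus>\<^bsub>obj (gam Y) i\<^esub> f i x \<in> boundaries (gam Y) i"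
      using aZ a(2) by (auto simp: boundaries_gam)
  }
qed

section \<open>Powers of the ideal and assembly of the proof\<close>

lemma (in cring) ideal_filtration_powers:
  assumes "ideal \<aa> R"
  shows "ideal_filtration R (\<lambda>n. \<aa> [^]\<^bsub>ideals_set R\<^esub> (n :: nat))"
proof -
  interpret I: comm_monoid "ideals_set R" by (rule ideals_set_is_comm_monoid)
  have id: "ideal (\<aa> [^]\<^bsub>ideals_set R\<^esub> n) R" for n :: nat
    using I.nat_pow_closed[of \<aa> n] assms by (simp add: ideals_set_def)
  have "\<aa> [^]\<^bsub>ideals_set R\<^esub> Suc n \<subseteq> \<aa> [^]\<^bsub>ideals_set R\<^esub> n" for n :: nat
    using ideal_prod_inter[OF id[of n] assms] I.nat_pow_Suc[of \<aa> n] by (simp add: ideals_set_def)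
  then show ?thesis using id
    by (intro ideal_filtration.intro is_cring ideal_filtration_axioms.intro)
qed

lemma trivial_homologyD:
  assumes "chain_complex R X" "trivial_module (homology X i)"
  shows "cycles X i \<subseteq> boundaries X i"
proof
  fix x assume x: "x \<in> cycles X i"
  interpret M: module R "obj X i" by (rule chain_complexD(1)[OF assms(1)])
  have z: "\<zero>\<^bsub>obj X i\<^esub> \<in> boundaries X i"
    using subgroup.one_closed[OF submodule.axioms(1)[OF submodule_boundaries[OF assms(1)]]] by simp
  have "coset (obj X i) (boundaries X i) x \<in> carrier (homology X i)"
    using x unfolding carrier_homology by blast
  then have "coset (obj X i) (boundaries X i) x = boundaries X i"
    using assms(2) by (simp add: trivial_module_def) (simp add: homology_def)
  moreover have "x \<in> coset (obj X i) (boundaries X i) x"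
    using z cyclesD(1)[OF x] by (auto simp: coset_def image_iff intro!: bexI[of _ "\<zero>\<^bsub>obj X i\<^esub>"])
  ultimately show "x \<in> boundaries X i" by simp
qed

theorem theorem3p5:
  fixes R :: "('r, 'x) ring_scheme"
    and \<aa> :: "'r set"
    and C :: "('r, 'm) cpx"
    and X :: "('r, 'm) cpx"
  assumes "infinite (UNIV :: 'm set)"
    and "carrier R \<lesssim> (UNIV :: 'm set)"
    and "cring R"
    and "noetherian_ring R"
    and "ideal \<aa> R"
    and "\<aa> \<noteq> carrier R"
    and "chain_complex R C"
    and "torsion_acyclic_complex R \<aa> C"
    and "bounded_left C"
    and "is_RGamma R \<aa> C X"
  shows "derived_iso R X (torsion_complex R \<aa> C)"
proof -
  interpret cring R by fact
  interpret ideal_filtration R "\<lambda>n. \<aa> [^]\<^bsub>ideals_set R\<^esub> (n :: nat)"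
    by (rule ideal_filtration_powers[OF assms(5)])
  have gam_eq: "torsion_complex R \<aa> Y = gam Y" for Y :: "('r, 'm) cpx"
    by (simp add: torsion_complex_def gam_def torsion_module_def torsion_def)
  obtain E \<iota> where E: "semiinjective R E" and q: "quasi_iso R C E \<iota>" and X: "X = gam E"
    using assms(10) by (auto simp: is_RGamma_def semiinjective_resolution_def gam_eq)
  note \<iota> = quasi_isoD(1)[OF q]
  note c = chain_mapD[OF \<iota>]
  note C_mod = chain_complexD(1)[OF c(1)] and E_mod = chain_complexD(1)[OF c(2)]
  have eff_C: "eff j (obj C i)" for i j
  proof -
    obtain Y where Y: "is_RGamma R \<aa> (stalk_complex (obj C i)) Y" "\<forall>j>0. trivial_module (homology Y (- j))"
      using assms(8) unfolding torsion_acyclic_complex_def torsion_acyclic_module_def by blast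
    obtain F \<kappa> where F: "semiinjective R F" "quasi_iso R (stalk_complex (obj C i)) F \<kappa>"
      and YF: "Y = gam F"
      using Y(1) unfolding is_RGamma_def semiinjective_resolution_def gam_eq by blast
    have tr: "trivial_module (homology (gam F) (- j))" if "j > 0" for j
      using Y(2) that unfolding YF by simp
    have F_cc: "chain_complex R F" using F(1) by (simp add: semiinjective_def)
    have "cycles (gam F) k \<subseteq> boundaries (gam F) k" if "k < 0" for k
      using trivial_homologyD[OF chain_complex_gam[OF F_cc], of k] tr[of "- k"] that by simp
    then show ?thesis by (rule eff_resolution[OF C_mod F(2) semiinjective_baer[OF F(1) assms(2)]])
  qed
  have eff_E: "eff j (obj E i)" for i j
    by (rule eff_baer[OF E_mod semiinjective_baer[OF E assms(2)]])
  let ?K = "cone C E \<iota>"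
  note K = chain_complex_cone[OF \<iota>]
  obtain s where s: "\<And>v. v > s \<Longrightarrow> carrier (obj C v) = {\<zero>\<^bsub>obj C v\<^esub>}"
    using assms(9) unfolding bounded_left_def trivial_module_def by blast
  \<comment> \<open>\<open>C\<close> is zero above \<open>s\<close>, so there surjectivity on
    homology alone makes every cycle of \<open>E\<close> a boundary.\<close>
  have E_exact: "cycles E i \<subseteq> boundaries E i" if "i > s" for i
  proof
    fix y assume y: "y \<in> cycles E i"
    interpret M: module R "obj E i" by (rule E_mod)
    obtain x where x: "x \<in> cycles C i" "y \<ominus>\<^bsub>obj E i\<^esub> \<iota> i x \<in> boundaries E i"
      using quasi_isoD(3)[OF q y] by blast
    have "x = \<zero>\<^bsub>obj C i\<^esub>" using cyclesD(1)[OF x(1)] s[OF that] by simp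
    then show "y \<in> boundaries E i"
      using x(2) cyclesD(1)[OF y] mod_hom_zero[OF c(3) C_mod E_mod] by (simp add: M.M.diff_zero)
  qed
  \<comment> \<open>Degree \<open>i\<close> of the cone contains \<open>C\<close> in degree
    \<open>i - 1\<close>, which is zero once \<open>i - 1 > s\<close>; hence
    \<open>s + 2\<close>.\<close>
  have eff_top: "eff j (cycle_module ?K i)" if "i \<ge> s + 2" for i j
  proof -
    have "\<And>k. k \<ge> i \<Longrightarrow> cycles E k \<subseteq> boundaries E k" using E_exact that by simp
    from semiinjective_split[OF E this] obtain h where
      h: "h \<in> mod_hom R ((obj E i)\<lparr>carrier := cycles E i\<rparr>) (obj E (i + 1))"
        "\<And>x. x \<in> cycles E i \<Longrightarrow> bd E (i + 1) (h x) = x" by blast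
    have Ci: "carrier (obj C (i - 1)) = {\<zero>\<^bsub>obj C (i - 1)\<^esub>}" using s[of "i - 1"] that by simp
    have z1: "\<iota> (i - 1) \<zero>\<^bsub>obj C (i - 1)\<^esub> = \<zero>\<^bsub>obj E (i - 1)\<^esub>" by (rule mod_hom_zero[OF c(3) C_mod E_mod])
    have z2: "bd C (i - 1) \<zero>\<^bsub>obj C (i - 1)\<^esub> = \<zero>\<^bsub>obj C (i - 2)\<^esub>"
      using mod_hom_zero[OF chain_complexD(2)[OF c(1)] C_mod C_mod, of "i - 1"] by simp
    interpret C1: module R "obj C (i - 1)" by (rule C_mod)
    interpret C2: module R "obj C (i - 2)" by (rule C_mod)
    interpret E1: module R "obj E (i - 1)" by (rule E_mod)
    have cyc: "x \<in> cycles ?K i \<longleftrightarrow> fst x = \<zero>\<^bsub>obj C (i - 1)\<^esub> \<and> snd x \<in> cycles E i" for x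
      using mod_hom_closed[OF chain_complexD(2)[OF c(2)], of "snd x" i]
      by (auto simp: cycles_def Ci z1 z2 C2.M.neg_zero mem_Times_iff)
    have dh: "bd E (i + 1) y \<in> cycles E i" if "y \<in> carrier (obj E (i + 1))" for y
      using boundaries_subset_cycles[OF c(2), of i] that unfolding boundaries_def by blast
    \<comment> \<open>With the first component zero, cycles of the cone are cycles of
      \<open>E\<close>. The splitting \<open>h\<close> embeds them into \<open>E\<close> in degree
      \<open>i + 1\<close>, and the differential is the retraction.\<close>
    have "(\<lambda>x. h (snd x)) \<in> mod_hom R (cycle_module ?K i) (obj E (i + 1))"
      using mod_hom_closed[OF h(1)] mod_hom_add[OF h(1)] mod_hom_smult[OF h(1)]
      by (intro mod_homI) (auto simp: cycle_module_def cyc)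
    moreover have "(\<lambda>y. (\<zero>\<^bsub>obj C (i - 1)\<^esub>, bd E (i + 1) y)) \<in> mod_hom R (obj E (i + 1)) (cycle_module ?K i)"
      using dh mod_hom_add[OF chain_complex_bd_succ(1)[OF c(2)]] mod_hom_smult[OF chain_complex_bd_succ(1)[OF c(2)]]
      by (intro mod_homI) (auto simp: cycle_module_def cyc)
    moreover have "(\<zero>\<^bsub>obj C (i - 1)\<^esub>, bd E (i + 1) (h (snd x))) = x" if "x \<in> carrier (cycle_module ?K i)" for x
      using that h(2) by (auto simp: cycle_module_def cyc intro: prod_eqI)
    ultimately show ?thesis
      by (rule eff_retract[OF eff_E _ _ module_cycle_module[OF K] E_mod])
  qed
  have "eff j (obj ?K i)" for i j
    using eff_prod_module[OF C_mod E_mod eff_C eff_E] by simp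
  then have "cycles (gam ?K) i \<subseteq> boundaries (gam ?K) i" for i
    by (rule torsion_exact[OF K cone_exact[OF q] _ eff_top])
  then have Q: "quasi_iso R (gam C) (gam E) \<iota>" by (rule quasi_iso_gam[OF \<iota>])
  have m: "chain_map R (gam C) (gam E) \<iota>" by (rule quasi_isoD(1)[OF Q])
  note G = chain_mapD(1,2)[OF m]
  \<comment> \<open>The quasiisomorphism starts at the torsion of \<open>C\<close>, so the
    isomorphism from \<open>X\<close> is its formal inverse.\<close>
  have "dpath R (gam E) [Inv (gam C) \<iota> (gam E)] (gam C)"
    by (intro dpath_Inv[OF Q] dpath_Nil G)
  moreover have "dpath R (gam C) [Fwd (gam C) \<iota> (gam E)] (gam E)"
    by (intro dpath_Fwd[OF m] dpath_Nil G)
  ultimately show ?thesis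
    using deq_inv_left[OF Q] deq_inv_right[OF Q] unfolding derived_iso_def X gam_eq
    by (intro exI conjI) auto
qed

end
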